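(* Let $K$ be a separable infinite-dimensional Hilbert space and suppose that $\mathcal B(K)$ acts on $H=\mathcal{HS}(K)$ by left multiplications, with a fixed separating and cyclic unit vector $x_0\in H$. Let $k\ge 1$ be an integer. For a linear map $\phi\in\mathbb{CB}^\sigma(\mathcal B(K))$, the following are equivalent: (i) $\phi$ is $k$-positive; (ii) $\langle \mathrm C_\phi,\omega_{x,x}\rangle\ge 0$ for every $x\in H=\mathcal{HS}(K)$ with $\operatorname{rank} x\le k$; (iii) $\langle x\boxtimes x,\mathrm D_\phi\rangle\ge 0$ for every $x\in H=\mathcal{HS}(K)$ with $\operatorname{rank} x\le k$.
   Context: $\mathcal{HS}(K)$ is the Hilbert space of Hilbert–Schmidt operators on $K$ with $(x|y)=\operatorname{Tr}(xy^* )$ (inner products are linear in the first variable). $\mathcal B(K)$ acts on $H$ by $L_x(y)=xy$; the commutant is $\{R_x:x\in\mathcal B(K)\}$ with $R_x(y)=yx$. $\mathcal B(H)$ and $\mathcal T(H)=\mathcal B(H)_*$ (trace class operators) are paired by $\langle A,B\rangle=\operatorname{Tr}(AB)$. For vectors $x,y\in H$, $x\boxtimes y$ is the operator on $H$ given by $z\mapsto (z|y)x$; as an element of $\mathcal T(H)$ it is identified with the functional $\omega_{x,y}:A\mapsto(Ax|y)$ on $\mathcal B(H)$. The rank of $x\in H$ is its rank as an operator on $K$. A map is normal if it is continuous for the $\sigma$-weak topologies. $\mathbb{CB}^\sigma(\mathcal B(K))$ is the space of normal completely bounded linear maps $\phi:\mathcal B(K)\to\mathcal B(K)$. For such $\phi$,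 the map $R_yL_x\mapsto R_yL_{\phi(x)}$ ($x,y\in\mathcal B(K)$) extends uniquely to a normal linear map $\tilde\phi:\mathcal B(H)\to\mathcal B(H)$, with predual map $\tilde\phi_*:\mathcal T(H)\to\mathcal T(H)$ defined by $\langle A,\tilde\phi_*(B)\rangle=\langle\tilde\phi(A),B\rangle$. With $E_0=x_0\boxtimes x_0$, put $\mathrm C_\phi=\tilde\phi(E_0)\in\mathcal B(H)$ and $\mathrm D_\phi=\tilde\phi_*(E_0)\in\mathcal T(H)$. *)

theory Defs
  imports "HOL-Analysis.Analysis" "HOL-Library.Complex_Order" "HOL-Library.Extended_Nat"
begin

section \<open>Complex Hilbert spaces\<close>

class scaleC = scaleR +
  fixes scaleC :: "complex \<Rightarrow> 'a \<Rightarrow> 'a" (infixr "*\<^sub>C" 75)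
  assumes scaleR_scaleC: "scaleR r x = complex_of_real r *\<^sub>C x"

class complex_vector = scaleC + ab_group_add +
  assumes scaleC_add_right: "a *\<^sub>C (x + y) = a *\<^sub>C x + a *\<^sub>C y"
    and scaleC_add_left: "(a + b) *\<^sub>C x = a *\<^sub>C x + b *\<^sub>C x"
    and scaleC_scaleC: "a *\<^sub>C (b *\<^sub>C x) = (a * b) *\<^sub>C x"
    and scaleC_one: "1 *\<^sub>C x = x"
begin

subclass real_vector
  by standard (simp_all add: scaleR_scaleC scaleC_add_right scaleC_add_left scaleC_scaleC scaleC_one)

end

global_interpretation complex_vector: vector_space "scaleC :: complex \<Rightarrow> 'a \<Rightarrow> 'a::complex_vector"
  by standard (simp_all add: scaleC_add_right scaleC_add_left scaleC_scaleC scaleC_one)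

abbreviation clinear :: "('a::complex_vector \<Rightarrow> 'b::complex_vector) \<Rightarrow> bool"
  where "clinear \<equiv> Vector_Spaces.linear scaleC scaleC"

lemma clinearI:
  fixes f :: "'a::complex_vector \<Rightarrow> 'b::complex_vector"
  assumes "\<And>x y. f (x + y) = f x + f y" "\<And>c x. f (c *\<^sub>C x) = c *\<^sub>C f x"
  shows "clinear f"
  using assms
  by (simp add: complex_vector.vector_space_axioms module_hom_axioms_def module_hom_def
      Vector_Spaces.linear_def module_iff_vector_space complex_vector.module_axioms)

text \<open>Positive definite Hermitian forms, linear in the first argument. This locale supplies the
  Cauchy-Schwarz and triangle inequalities needed for making a type an instance of the class
  \<open>complex_inner\<close> below.\<close>

locale hermitian_form =
  fixes ip :: "'a::complex_vector \<Rightarrow> 'a \<Rightarrow> complex"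
  assumes ip_commute: "ip x y = cnj (ip y x)"
    and ip_add_left: "ip (x + y) z = ip x z + ip y z"
    and ip_scaleC_left: "ip (c *\<^sub>C x) y = c * ip x y"
    and ip_ge_zero: "0 \<le> ip x x"
    and ip_eq_zero: "ip x x = 0 \<Longrightarrow> x = 0"
begin

definition nrm :: "'a \<Rightarrow> real" where "nrm x = sqrt (Re (ip x x))"

lemma ip_add_right: "ip x (y + z) = ip x y + ip x z"
  by (metis ip_add_left ip_commute complex_cnj_add)

lemma ip_scaleC_right: "ip x (c *\<^sub>C y) = cnj c * ip x y"
  by (metis ip_commute ip_scaleC_left complex_cnj_mult)

lemma ip_zero_left [simp]: "ip 0 x = 0"
  using ip_add_left[of 0 0 x] by simp

lemma ip_zero_right [simp]: "ip x 0 = 0"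
  using ip_add_right[of x 0 0] by simp

lemma ip_minus_left [simp]: "ip (- x) y = - ip x y"
  using ip_add_left[of "- x" x y] by (simp add: eq_neg_iff_add_eq_0)

lemma ip_minus_right [simp]: "ip x (- y) = - ip x y"
  using ip_add_right[of x "- y" y] by (simp add: eq_neg_iff_add_eq_0)

lemma ip_diff_left: "ip (x - y) z = ip x z - ip y z"
  using ip_add_left[of x "- y" z] by simp

lemma ip_diff_right: "ip z (x - y) = ip z x - ip z y"
  using ip_add_right[of z x "- y"] by simp

lemma ip_self: "ip x x = complex_of_real ((nrm x)\<^sup>2)"
  using ip_ge_zero[of x] by (auto simp: complex_eq_iff less_eq_complex_def nrm_def)

lemma nrm_nonneg: "0 \<le> nrm x"
  using ip_ge_zero[of x] by (simp add: nrm_def less_eq_complex_def)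

lemma nrm_eq_zero: "nrm x = 0 \<longleftrightarrow> x = 0"
  using ip_self[of x] ip_eq_zero[of x] by auto

lemma Cauchy_Schwarz: "cmod (ip x y) \<le> nrm x * nrm y"
proof (cases "y = 0")
  case True
  then show ?thesis by (simp add: nrm_nonneg)
next
  case False
  define c where "c = ip x y / ip y y"
  have ny: "(nrm y)\<^sup>2 > 0" and yy: "ip y y \<noteq> 0"
    using False ip_self[of y] ip_eq_zero[of y] by (auto simp: zero_less_power2)
  have "ip (x - c *\<^sub>C y) (x - c *\<^sub>C y)
      = ip x x - cnj c * ip x y - c * (ip y x - cnj c * ip y y)"
    by (simp add: ip_diff_left ip_diff_right ip_scaleC_left ip_scaleC_right algebra_simps)
  also have "ip y x - cnj c * ip y y = 0"
    using yy ip_commute[of y x] ip_commute[of y y] by (simp add: c_def)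
  also have "ip x x - cnj c * ip x y - c * 0
      = complex_of_real ((nrm x)\<^sup>2 - (cmod (ip x y))\<^sup>2 / (nrm y)\<^sup>2)"
    using complex_norm_square[of "ip x y"]
    by (simp add: c_def ip_self mult.commute)
  finally have "0 \<le> (nrm x)\<^sup>2 - (cmod (ip x y))\<^sup>2 / (nrm y)\<^sup>2"
    using ip_ge_zero[of "x - c *\<^sub>C y"] by (metis Re_complex_of_real less_eq_complex_def zero_complex.sel(1))
  then have "(cmod (ip x y))\<^sup>2 \<le> (nrm x * nrm y)\<^sup>2"
    using ny by (simp add: field_simps power_mult_distrib)
  then show ?thesis
    by (rule power2_le_imp_le) (simp add: nrm_nonneg)
qed

lemma nrm_add_square: "(nrm (x + y))\<^sup>2 = (nrm x)\<^sup>2 + (nrm y)\<^sup>2 + 2 * Re (ip x y)"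
proof -
  have "complex_of_real ((nrm (x + y))\<^sup>2) = ip x x + ip y y + (ip x y + cnj (ip x y))"
    using ip_commute[of y x] by (simp only: ip_self[symmetric] ip_add_left ip_add_right ac_simps)
  also have "\<dots> = complex_of_real ((nrm x)\<^sup>2 + (nrm y)\<^sup>2 + 2 * Re (ip x y))"
    by (simp add: ip_self complex_add_cnj)
  finally show ?thesis using of_real_eq_iff by blast
qed

lemma nrm_scaleC: "nrm (c *\<^sub>C x) = cmod c * nrm x"
proof -
  have "complex_of_real ((nrm (c *\<^sub>C x))\<^sup>2) = (c * cnj c) * ip x x"
    by (simp only: ip_self[symmetric] ip_scaleC_left ip_scaleC_right ac_simps)
  also have "\<dots> = complex_of_real ((cmod c * nrm x)\<^sup>2)"
    by (simp add: ip_self power_mult_distrib flip: complex_norm_square)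
  finally have "(nrm (c *\<^sub>C x))\<^sup>2 = (cmod c * nrm x)\<^sup>2" using of_real_eq_iff by blast
  then show ?thesis
    by (simp add: nrm_nonneg)
qed

lemma nrm_triangle: "nrm (x + y) \<le> nrm x + nrm y"
proof -
  have "(nrm (x + y))\<^sup>2 \<le> (nrm x + nrm y)\<^sup>2"
    using Cauchy_Schwarz[of x y] complex_Re_le_cmod[of "ip x y"]
    by (simp add: nrm_add_square power2_sum)
  then show ?thesis
    by (rule power2_le_imp_le) (simp add: nrm_nonneg)
qed

end

class complex_inner = complex_vector + real_normed_vector +
  fixes cinner :: "'a \<Rightarrow> 'a \<Rightarrow> complex"
  assumes cinner_commute: "cinner x y = cnj (cinner y x)"
    and cinner_add_left: "cinner (x + y) z = cinner x z + cinner y z"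
    and cinner_scaleC_left: "cinner (c *\<^sub>C x) y = c * cinner x y"
    and cinner_ge_zero: "0 \<le> cinner x x"
    and norm_eq_sqrt_cinner: "norm x = sqrt (Re (cinner x x))"

global_interpretation cinner: hermitian_form "cinner :: 'a::complex_inner \<Rightarrow> 'a \<Rightarrow> complex"
  rewrites "hermitian_form.nrm cinner = (norm :: 'a::complex_inner \<Rightarrow> real)"
proof -
  show *: "hermitian_form (cinner :: 'a \<Rightarrow> 'a \<Rightarrow> complex)"
  proof
    fix x y z :: 'a and c :: complex
    show "cinner x x = 0 \<Longrightarrow> x = 0"
      using norm_eq_sqrt_cinner[of x] by simp
  qed (rule cinner_commute cinner_add_left cinner_scaleC_left cinner_ge_zero)+
  show "hermitian_form.nrm cinner = (norm :: 'a \<Rightarrow> real)"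
    by (intro ext) (simp add: hermitian_form.nrm_def[OF *] norm_eq_sqrt_cinner)
qed

class chilbert_space = complex_inner + complete_space

lemma norm_scaleC: "norm (c *\<^sub>C x) = cmod c * norm (x::'a::complex_inner)"
  by (rule cinner.nrm_scaleC)

lemma bounded_linear_cinner_left: "bounded_linear (\<lambda>x. cinner x (y::'a::complex_inner))"
proof (rule bounded_linear_intro[where K = "norm y"])
  show "cinner (r *\<^sub>R x) y = r *\<^sub>R cinner x y" for r x
    by (simp add: scaleR_scaleC cinner_scaleC_left scaleR_conv_of_real)
qed (simp_all add: cinner_add_left cinner.Cauchy_Schwarz)

lemma cinner_sum_left: "cinner (sum f A) y = (\<Sum>i\<in>A. cinner (f i) (y::'a::complex_inner))"
  by (rule linear_sum[OF bounded_linear.linear[OF bounded_linear_cinner_left]])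

lemma cinner_ext: "(\<And>z. cinner x z = cinner y z) \<Longrightarrow> x = (y::'a::complex_inner)"
  using cinner.ip_eq_zero[of "x - y"] by (simp add: cinner.ip_diff_left)

subsection \<open>Orthonormal bases\<close>

definition orthonormal :: "'a::complex_inner set \<Rightarrow> bool"
  where "orthonormal B \<longleftrightarrow> (\<forall>e\<in>B. norm e = 1) \<and> (\<forall>e\<in>B. \<forall>f\<in>B. e \<noteq> f \<longrightarrow> cinner e f = 0)"

text \<open>A maximal orthonormal set; in a Hilbert space this means that its closed span is everything.\<close>

definition is_onb :: "'a::complex_inner set \<Rightarrow> bool"
  where "is_onb B \<longleftrightarrow> orthonormal B \<and> (\<forall>x. (\<forall>e\<in>B. cinner x e = 0) \<longrightarrow> x = 0)"

lemma orthonormal_cinner: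
  assumes "orthonormal B" "e \<in> B" "f \<in> B"
  shows "cinner e f = (if e = f then 1 else 0)"
  using assms by (auto simp: orthonormal_def cinner.ip_self)

lemma cinner_orthonormal_sum:
  assumes "orthonormal B" "finite F" "F \<subseteq> B" "f \<in> B"
  shows "cinner (\<Sum>e\<in>F. c e *\<^sub>C e) f = (if f \<in> F then c f else 0)"
proof -
  have "cinner (\<Sum>e\<in>F. c e *\<^sub>C e) f = (\<Sum>e\<in>F. if e = f then c e else 0)"
    unfolding cinner_sum_left
    using assms by (intro sum.cong refl) (auto simp: cinner_scaleC_left orthonormal_cinner[OF assms(1)])
  then show ?thesis using assms by simp
qed

lemma norm_orthonormal_sum:
  assumes "orthonormal B" "finite F" "F \<subseteq> B"
  shows "(norm (\<Sum>e\<in>F. c e *\<^sub>C e))\<^sup>2 = (\<Sum>e\<in>F. (cmod (c e))\<^sup>2)"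
proof -
  let ?y = "\<Sum>e\<in>F. c e *\<^sub>C e"
  have "cinner ?y ?y = (\<Sum>e\<in>F. c e * cnj (cinner ?y e))"
    by (subst cinner_sum_left) (simp add: cinner_scaleC_left flip: cinner_commute)
  also have "\<dots> = (\<Sum>e\<in>F. c e * cnj (c e))"
    using assms(3) by (intro sum.cong refl) (simp add: cinner_orthonormal_sum[OF assms] subset_iff)
  also have "\<dots> = complex_of_real (\<Sum>e\<in>F. (cmod (c e))\<^sup>2)"
    by (simp flip: complex_norm_square)
  finally have "complex_of_real ((norm ?y)\<^sup>2) = complex_of_real (\<Sum>e\<in>F. (cmod (c e))\<^sup>2)"
    by (simp only: cinner.ip_self)
  then show ?thesis using of_real_eq_iff by blast
qed

lemma Bessel:
  assumes "orthonormal B" "finite F" "F \<subseteq> B"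
  shows "(\<Sum>e\<in>F. (cmod (cinner x e))\<^sup>2) \<le> (norm x)\<^sup>2"
proof -
  let ?y = "\<Sum>e\<in>F. cinner x e *\<^sub>C e"
  have "cinner ?y x = (\<Sum>e\<in>F. cinner x e * cnj (cinner x e))"
    by (simp add: cinner_sum_left cinner_scaleC_left flip: cinner_commute)
  also have "\<dots> = complex_of_real (\<Sum>e\<in>F. (cmod (cinner x e))\<^sup>2)"
    by (simp flip: complex_norm_square)
  finally have *: "cinner x ?y = complex_of_real (\<Sum>e\<in>F. (cmod (cinner x e))\<^sup>2)"
    by (metis cinner_commute complex_cnj_complex_of_real)
  have "0 \<le> (norm (x + - ?y))\<^sup>2" by simp
  also have "\<dots> = (norm x)\<^sup>2 + (norm ?y)\<^sup>2 - 2 * Re (cinner x ?y)"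
    by (simp add: cinner.nrm_add_square del: add_uminus_conv_diff)
  also have "\<dots> = (norm x)\<^sup>2 - (\<Sum>e\<in>F. (cmod (cinner x e))\<^sup>2)"
    using * norm_orthonormal_sum[OF assms, of "\<lambda>e. cinner x e"] by simp
  finally show ?thesis by simp
qed

lemma Riesz_Fischer:
  fixes B :: "'a::chilbert_space set"
  assumes B: "orthonormal B"
    and bound: "\<forall>F. finite F \<and> F \<subseteq> B \<longrightarrow> (\<Sum>e\<in>F. (cmod (c e))\<^sup>2) \<le> M"
  shows "\<exists>y. \<exists>F :: nat \<Rightarrow> 'a set. (\<forall>e\<in>B. cinner y e = c e) \<and> (\<forall>n. finite (F n)) \<and>
    (\<forall>n. F n \<subseteq> B) \<and> (\<lambda>n. \<Sum>e\<in>F n. c e *\<^sub>C e) \<longlonglongrightarrow> y"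
proof -
  define s where "s F = (\<Sum>e\<in>F. (cmod (c e))\<^sup>2)" for F
  define S where "S = Sup (s ` {F. finite F \<and> F \<subseteq> B})"
  have bdd: "bdd_above (s ` {F. finite F \<and> F \<subseteq> B})"
    using bound by (auto simp: s_def intro!: bdd_aboveI2[where M = M])
  have s_le: "s F \<le> S" if "finite F" "F \<subseteq> B" for F
    unfolding S_def using that bdd by (auto intro!: cSup_upper)
  have "\<exists>F. finite F \<and> F \<subseteq> B \<and> S - inverse (real (Suc n)) < s F" for n
  proof -
    have "S - inverse (real (Suc n)) < S" by simp
    then show ?thesis
      unfolding S_def using less_cSup_iff[OF _ bdd, of "Sup (s ` {F. finite F \<and> F \<subseteq> B}) - inverse (real (Suc n))"]
      by auto
  qed
  then obtain F' where F': "\<And>n. finite (F' n)" "\<And>n. F' n \<subseteq> B" "\<And>n. S - inverse (real (Suc n)) < s (F' n)"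
    by metis
  define F where "F n = (\<Union>i\<le>n. F' i)" for n
  have F: "finite (F n)" "F n \<subseteq> B" for n
    using F' by (auto simp: F_def)
  have F_mono: "F m \<subseteq> F n" if "m \<le> n" for m n
    using that by (fastforce simp: F_def)
  have s_F: "S - inverse (real (Suc n)) < s (F n)" for n
  proof -
    have "s (F' n) \<le> s (F n)"
      unfolding s_def using F by (intro sum_mono2) (auto simp: F_def)
    then show ?thesis using F'(3)[of n] by linarith
  qed
  define y where "y n = (\<Sum>e\<in>F n. c e *\<^sub>C e)" for n
  have y_diff: "(norm (y n - y m))\<^sup>2 \<le> inverse (real (Suc m))" if "m \<le> n" for m n
  proof -
    have "y n - y m = (\<Sum>e\<in>F n - F m. c e *\<^sub>C e)"
      unfolding y_def using sum_diff[OF F(1) F_mono[OF that], of "\<lambda>e. c e *\<^sub>C e"] by simp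
    then have "(norm (y n - y m))\<^sup>2 = (\<Sum>e\<in>F n - F m. (cmod (c e))\<^sup>2)"
      using norm_orthonormal_sum[OF B finite_Diff[OF F(1)] order_trans[OF Diff_subset F(2)], of c n "F m"]
      by simp
    also have "\<dots> = s (F n) - s (F m)"
      unfolding s_def by (rule sum_diff[OF F(1) F_mono[OF that]])
    also have "\<dots> \<le> inverse (real (Suc m))"
      using s_F[of m] s_le[OF F, of n] by linarith
    finally show ?thesis .
  qed
  have "Cauchy y"
  proof (rule metric_CauchyI)
    fix \<epsilon> :: real assume "0 < \<epsilon>"
    then obtain N where N: "inverse (real (Suc N)) < (\<epsilon> / 2)\<^sup>2"
      using reals_Archimedean[of "(\<epsilon> / 2)\<^sup>2"] by auto
    have *: "norm (y n - y N) < \<epsilon> / 2" if "n \<ge> N" for n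
      using y_diff[OF that] N \<open>0 < \<epsilon>\<close> by (intro power2_less_imp_less[of _ "\<epsilon> / 2"]) auto
    show "\<exists>N. \<forall>m\<ge>N. \<forall>n\<ge>N. dist (y m) (y n) < \<epsilon>"
      using * by (intro exI[of _ N]) (metis dist_norm dist_triangle_half_l)
  qed
  then obtain z where z: "y \<longlonglongrightarrow> z"
    using Cauchy_convergent convergent_def by blast
  have "cinner z e = c e" if e: "e \<in> B" for e
  proof -
    have lim: "(\<lambda>n. cinner (y n) e) \<longlonglongrightarrow> cinner z e"
      using bounded_linear.tendsto[OF bounded_linear_cinner_left z] .
    have y_e: "cinner (y n) e = (if e \<in> F n then c e else 0)" for n
      unfolding y_def by (rule cinner_orthonormal_sum[OF B F e])
    show ?thesis
    proof (cases "\<exists>N. e \<in> F N")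
      case True
      then obtain N where N: "e \<in> F N" by blast
      then have "\<forall>\<^sub>F n in sequentially. cinner (y n) e = c e"
        using F_mono by (auto simp: y_e eventually_sequentially)
      then show ?thesis
        by (rule LIMSEQ_unique[OF lim tendsto_eventually])
    next
      case False
      have "(cmod (c e))\<^sup>2 < inverse (real (Suc n))" for n
      proof -
        have "s (insert e (F n)) = (cmod (c e))\<^sup>2 + s (F n)"
          unfolding s_def using False F by simp
        then show ?thesis
          using s_le[of "insert e (F n)"] F e s_F[of n] by simp
      qed
      then have "\<not> 0 < (cmod (c e))\<^sup>2"
        using reals_Archimedean[of "(cmod (c e))\<^sup>2"] by (meson less_asym)
      then have "c e = 0" by simp
      then have "cinner (y n) e = 0" for n by (simp add: y_e)
      then have "(\<lambda>n. cinner (y n) e) \<longlonglongrightarrow> 0" by simp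
      then show ?thesis
        using lim LIMSEQ_unique \<open>c e = 0\<close> by metis
    qed
  qed
  then show ?thesis
    using F z unfolding y_def by (intro exI[of _ z] exI[of _ F]) simp
qed

lemma onb_expansion:
  fixes B :: "'a::chilbert_space set"
  assumes "is_onb B"
  shows "\<exists>F :: nat \<Rightarrow> 'a set. (\<forall>n. finite (F n)) \<and> (\<forall>n. F n \<subseteq> B) \<and>
    (\<lambda>n. \<Sum>e\<in>F n. cinner x e *\<^sub>C e) \<longlonglongrightarrow> x"
proof -
  have B: "orthonormal B" using assms by (simp add: is_onb_def)
  have "\<exists>y. \<exists>F :: nat \<Rightarrow> 'a set. (\<forall>e\<in>B. cinner y e = cinner x e) \<and> (\<forall>n. finite (F n)) \<and>
    (\<forall>n. F n \<subseteq> B) \<and> (\<lambda>n. \<Sum>e\<in>F n. cinner x e *\<^sub>C e) \<longlonglongrightarrow> y"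
    by (rule Riesz_Fischer[OF B]) (use Bessel[OF B] in blast)
  then obtain y and F :: "nat \<Rightarrow> 'a set" where *: "(\<forall>e\<in>B. cinner y e = cinner x e) \<and>
    (\<forall>n. finite (F n)) \<and> (\<forall>n. F n \<subseteq> B) \<and> (\<lambda>n. \<Sum>e\<in>F n. cinner x e *\<^sub>C e) \<longlonglongrightarrow> y"
    by (elim exE) (rule that)
  from * have y: "\<And>e. e \<in> B \<Longrightarrow> cinner y e = cinner x e" by blast
  from * have F: "\<forall>n. finite (F n)" "\<forall>n. F n \<subseteq> B" "(\<lambda>n. \<Sum>e\<in>F n. cinner x e *\<^sub>C e) \<longlonglongrightarrow> y"
    by simp_all
  have "\<forall>e\<in>B. cinner (y - x) e = 0"
    using y by (simp add: cinner.ip_diff_left)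
  then have "y - x = 0"
    using assms by (simp only: is_onb_def)
  then show ?thesis using F by (intro exI[of _ F]) simp
qed

lemma Parseval:
  fixes B :: "'a::chilbert_space set"
  assumes "is_onb B"
  shows "((\<lambda>e. (cmod (cinner x e))\<^sup>2) has_sum (norm x)\<^sup>2) B"
proof -
  have B: "orthonormal B" using assms by (simp add: is_onb_def)
  let ?g = "\<lambda>e. (cmod (cinner x e))\<^sup>2"
  have summable: "?g summable_on B"
    using Bessel[OF B] by (intro nonneg_bdd_above_summable_on) (auto intro!: bdd_aboveI2)
  have "infsum ?g B \<le> (norm x)\<^sup>2"
    using Bessel[OF B] by (intro infsum_le_finite_sums summable) auto
  moreover have "(norm x)\<^sup>2 \<le> infsum ?g B"
  proof -
    obtain F :: "nat \<Rightarrow> 'a set" where *: "(\<forall>n. finite (F n)) \<and> (\<forall>n. F n \<subseteq> B) \<and>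
      (\<lambda>n. \<Sum>e\<in>F n. cinner x e *\<^sub>C e) \<longlonglongrightarrow> x"
      using onb_expansion[OF assms, of x] by (rule exE)
    from * have F: "\<And>n. finite (F n)" "\<And>n. F n \<subseteq> B"
      "(\<lambda>n. \<Sum>e\<in>F n. cinner x e *\<^sub>C e) \<longlonglongrightarrow> x" by simp_all
    have "(\<lambda>n. (norm (\<Sum>e\<in>F n. cinner x e *\<^sub>C e))\<^sup>2) \<longlonglongrightarrow> (norm x)\<^sup>2"
      by (intro tendsto_intros F)
    moreover have "(norm (\<Sum>e\<in>F n. cinner x e *\<^sub>C e))\<^sup>2 \<le> infsum ?g B" for n
      unfolding norm_orthonormal_sum[OF B F(1,2)]
      by (intro finite_sum_le_infsum summable F) auto
    ultimately show ?thesis by (intro LIMSEQ_le_const2) auto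
  qed
  ultimately show ?thesis
    using summable by (simp add: has_sum_iff)
qed

lemma ex_onb: "\<exists>B :: 'a::chilbert_space set. is_onb B"
proof -
  have "\<exists>M\<in>{B::'a set. orthonormal B}. \<forall>X\<in>{B. orthonormal B}. M \<subseteq> X \<longrightarrow> X = M"
  proof (rule subset_Zorn')
    fix C assume C: "subset.chain {B::'a set. orthonormal B} C"
    have "cinner e f = 0" if "e \<in> X" "f \<in> Y" "X \<in> C" "Y \<in> C" "e \<noteq> f" for e f X Y
    proof -
      have "X \<subseteq> Y \<or> Y \<subseteq> X" "orthonormal X" "orthonormal Y"
        using C that by (auto simp: subset.chain_def)
      then show ?thesis using that by (auto simp: orthonormal_def subset_iff)
    qed
    moreover have "norm e = 1" if "e \<in> X" "X \<in> C" for e X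
      using C that by (auto simp: subset.chain_def orthonormal_def)
    ultimately show "\<Union>C \<in> {B. orthonormal B}"
      by (auto simp: orthonormal_def)
  qed
  then obtain M :: "'a set" where M: "orthonormal M" "\<And>X. orthonormal X \<Longrightarrow> M \<subseteq> X \<Longrightarrow> X = M"
    by blast
  have "x = 0" if x: "\<forall>e\<in>M. cinner x e = 0" for x
  proof (rule ccontr)
    assume "x \<noteq> 0"
    define u where "u = complex_of_real (inverse (norm x)) *\<^sub>C x"
    have u: "norm u = 1" using \<open>x \<noteq> 0\<close> by (simp add: u_def norm_scaleC norm_inverse)
    have ue: "cinner u e = 0" "cinner e u = 0" if "e \<in> M" for e
    proof -
      show "cinner u e = 0" using x that by (simp add: u_def cinner_scaleC_left)
      then show "cinner e u = 0" using cinner_commute[of e u] by simp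
    qed
    have "orthonormal (insert u M)"
      using M(1) u ue by (auto simp: orthonormal_def)
    then have "u \<in> M" using M(2) by blast
    then have "cinner u u = 0" using ue by blast
    then show False using u by (simp add: cinner.ip_self)
  qed
  then show ?thesis using M(1) by (auto simp: is_onb_def)
qed

definition some_onb :: "'a::chilbert_space set" where "some_onb = (SOME B. is_onb B)"

lemma is_onb_some_onb: "is_onb some_onb"
  unfolding some_onb_def by (rule someI_ex[OF ex_onb])

lemma Riesz_representation:
  fixes f :: "'a::chilbert_space \<Rightarrow> complex"
  assumes f: "bounded_linear f" and fC: "\<And>c x. f (c *\<^sub>C x) = c * f x"
  shows "\<exists>y. \<forall>x. f x = cinner x y"
proof -
  interpret f: bounded_linear f by fact
  obtain K where K: "0 \<le> K" "\<And>x. cmod (f x) \<le> norm x * K" using f.nonneg_bounded by blast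
  define B :: "'a set" where "B = some_onb"
  have B: "orthonormal B" "is_onb B" using is_onb_some_onb by (auto simp: B_def is_onb_def)
  have bound: "(\<Sum>e\<in>F. (cmod (cnj (f e)))\<^sup>2) \<le> K\<^sup>2"
    if F: "finite F" "F \<subseteq> B" for F
  proof -
    let ?s = "\<Sum>e\<in>F. (cmod (f e))\<^sup>2"
    let ?x = "\<Sum>e\<in>F. cnj (f e) *\<^sub>C e"
    have "f ?x = complex_of_real ?s"
      by (simp add: f.sum fC mult.commute flip: complex_norm_square)
    then have "cmod (f ?x) = ?s"
      by (simp only: norm_of_real abs_of_nonneg sum_nonneg zero_le_power2)
    then have "?s \<le> norm ?x * K"
      using K(2)[of ?x] by simp
    then have "?s\<^sup>2 \<le> (norm ?x * K)\<^sup>2" by (intro power_mono) (simp_all add: sum_nonneg)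
    also have "\<dots> = ?s * K\<^sup>2"
      using norm_orthonormal_sum[OF B(1) F, of "\<lambda>e. cnj (f e)"] by (simp add: power_mult_distrib)
    finally have "?s * ?s \<le> ?s * K\<^sup>2" by (simp add: power2_eq_square)
    moreover have "0 \<le> ?s" by (simp add: sum_nonneg)
    ultimately have "?s \<le> K\<^sup>2" 
      using mult_le_cancel_left_pos[of ?s ?s "K\<^sup>2"] by (cases "?s = 0") auto
    then show ?thesis by simp
  qed
  have "\<exists>y. \<forall>e\<in>B. cinner y e = cnj (f e)"
    using Riesz_Fischer[OF B(1), of "\<lambda>e. cnj (f e)" "K\<^sup>2"] bound by blast
  then obtain y where y: "\<And>e. e \<in> B \<Longrightarrow> cinner y e = cnj (f e)" by blast
  have "f x = cinner x y" for x
  proof -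
    obtain F :: "nat \<Rightarrow> 'a set" where *: "(\<forall>n. finite (F n)) \<and> (\<forall>n. F n \<subseteq> B) \<and>
      (\<lambda>n. \<Sum>e\<in>F n. cinner x e *\<^sub>C e) \<longlonglongrightarrow> x"
      using onb_expansion[OF B(2), of x] by (rule exE)
    from * have F: "\<And>n. finite (F n)" "\<And>n. F n \<subseteq> B"
      "(\<lambda>n. \<Sum>e\<in>F n. cinner x e *\<^sub>C e) \<longlonglongrightarrow> x" by simp_all
    have "f e = cinner e y" if "e \<in> B" for e
      using y[OF that] cinner_commute[of e y] by simp
    then have "f (\<Sum>e\<in>F n. cinner x e *\<^sub>C e) = cinner (\<Sum>e\<in>F n. cinner x e *\<^sub>C e) y" for n
      using F(2)[of n] unfolding f.sum fC cinner_sum_left cinner_scaleC_left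
      by (intro sum.cong refl) auto
    then show ?thesis
      using f.tendsto[OF F(3)] bounded_linear.tendsto[OF bounded_linear_cinner_left F(3), of y]
        LIMSEQ_unique by auto
  qed
  then show ?thesis by blast
qed

section \<open>Bounded operators\<close>

typedef (overloaded) 'a bop = "{f :: 'a::complex_inner \<Rightarrow> 'a. clinear f \<and> bounded_linear f}"
  morphisms bop_app Abs_bop
  by (rule exI[of _ "\<lambda>x. 0"]) (simp add: clinearI bounded_linear_zero)

notation bop_app (infixr "\<cdot>" 80)

setup_lifting type_definition_bop

lemma bounded_clinearI:
  fixes f :: "'a::complex_inner \<Rightarrow> 'a"
  assumes "\<And>x y. f (x + y) = f x + f y" "\<And>c x. f (c *\<^sub>C x) = c *\<^sub>C f x"
    "\<And>x. norm (f x) \<le> norm x * K"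
  shows "clinear f \<and> bounded_linear f"
  using assms by (auto intro!: clinearI bounded_linear_intro[where K = K] simp: scaleR_scaleC)

lemma bop_bounded_linear: "bounded_linear (bop_app A)"
  by transfer simp

lemma bop_clinear: "clinear (bop_app A)"
  by transfer simp

lemma bop_add: "A \<cdot> (x + y) = A \<cdot> x + A \<cdot> y"
  by (rule linear_add[OF bounded_linear.linear[OF bop_bounded_linear]])

lemma bop_diff: "A \<cdot> (x - y) = A \<cdot> x - A \<cdot> y"
  by (rule linear_diff[OF bounded_linear.linear[OF bop_bounded_linear]])

lemma bop_scaleC: "A \<cdot> (c *\<^sub>C x) = c *\<^sub>C (A \<cdot> x)"
  using bop_clinear[of A] by (simp add: Vector_Spaces.linear_iff)

lemma bop_bound: "\<exists>K\<ge>0. \<forall>x. norm (A \<cdot> x) \<le> norm x * K"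
  using bounded_linear.nonneg_bounded[OF bop_bounded_linear] by blast

lemma bop_eqI: "(\<And>x. A \<cdot> x = B \<cdot> x) \<Longrightarrow> A = B"
  by transfer auto

instantiation bop :: (complex_inner) complex_vector
begin

lift_definition zero_bop :: "'a bop" is "\<lambda>x. 0"
  by (simp add: clinearI bounded_linear_zero)

lift_definition plus_bop :: "'a bop \<Rightarrow> 'a bop \<Rightarrow> 'a bop" is "\<lambda>f g x. f x + g x"
  by (auto intro!: clinearI bounded_linear_add simp: Vector_Spaces.linear_iff algebra_simps scaleC_add_right)

lift_definition minus_bop :: "'a bop \<Rightarrow> 'a bop \<Rightarrow> 'a bop" is "\<lambda>f g x. f x - g x"
  by (auto intro!: clinearI bounded_linear_sub simp: Vector_Spaces.linear_iff algebra_simps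
      complex_vector.scale_right_diff_distrib)

lift_definition uminus_bop :: "'a bop \<Rightarrow> 'a bop" is "\<lambda>f x. - f x"
  by (auto intro!: clinearI bounded_linear_minus simp: Vector_Spaces.linear_iff)

lift_definition scaleC_bop :: "complex \<Rightarrow> 'a bop \<Rightarrow> 'a bop" is "\<lambda>c f x. c *\<^sub>C f x"
proof -
  fix c and f :: "'a \<Rightarrow> 'a"
  assume f: "clinear f \<and> bounded_linear f"
  then obtain K where K: "\<And>x. norm (f x) \<le> norm x * K"
    using bounded_linear.bounded by blast
  show "clinear (\<lambda>x. c *\<^sub>C f x) \<and> bounded_linear (\<lambda>x. c *\<^sub>C f x)"
  proof (rule bounded_clinearI[where K = "cmod c * K"])
    show "norm (c *\<^sub>C f x) \<le> norm x * (cmod c * K)" for x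
      using mult_left_mono[OF K[of x] norm_ge_zero[of c]] by (simp add: norm_scaleC mult_ac)
  qed (use f in \<open>auto simp: Vector_Spaces.linear_iff scaleC_add_right scaleC_scaleC mult_ac\<close>)
qed

definition scaleR_bop :: "real \<Rightarrow> 'a bop \<Rightarrow> 'a bop"
  where "scaleR_bop r A = complex_of_real r *\<^sub>C A"

instance
  by standard (auto intro!: bop_eqI simp: scaleR_bop_def zero_bop.rep_eq plus_bop.rep_eq minus_bop.rep_eq
      uminus_bop.rep_eq scaleC_bop.rep_eq scaleC_add_right scaleC_add_left scaleC_scaleC scaleC_one)

end

lemma bop_simps [simp]:
  "0 \<cdot> x = 0" "(A + B) \<cdot> x = A \<cdot> x + B \<cdot> x" "(A - B) \<cdot> x = A \<cdot> x - B \<cdot> x"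
  "(- A) \<cdot> x = - (A \<cdot> x)" "(c *\<^sub>C A) \<cdot> x = c *\<^sub>C (A \<cdot> x)"
  by (simp_all add: zero_bop.rep_eq plus_bop.rep_eq minus_bop.rep_eq uminus_bop.rep_eq scaleC_bop.rep_eq)

lift_definition bop_comp :: "'a::complex_inner bop \<Rightarrow> 'a bop \<Rightarrow> 'a bop" (infixl "\<circ>\<^sub>B" 82)
  is "\<lambda>f g x. f (g x)"
proof
  fix f g :: "'a \<Rightarrow> 'a"
  assume f: "clinear f \<and> bounded_linear f" and g: "clinear g \<and> bounded_linear g"
  show "clinear (\<lambda>x. f (g x))"
    using f g by (intro clinearI) (simp_all add: Vector_Spaces.linear_iff)
  show "bounded_linear (\<lambda>x. f (g x))"
    using f g bounded_linear_compose by blast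
qed

lemma bop_comp_app [simp]: "(A \<circ>\<^sub>B B) \<cdot> x = A \<cdot> (B \<cdot> x)"
  by transfer simp

lift_definition rank_one :: "'a::complex_inner \<Rightarrow> 'a \<Rightarrow> 'a bop" (infix "\<boxtimes>" 85)
  is "\<lambda>x y z. cinner z y *\<^sub>C x"
proof (rule bounded_clinearI)
  show "norm (cinner z y *\<^sub>C x) \<le> norm z * (norm y * norm x)" for x y z :: 'a
    using mult_right_mono[OF cinner.Cauchy_Schwarz[of z y] norm_ge_zero[of x]] by (simp add: norm_scaleC mult_ac)
qed (simp_all add: cinner_add_left cinner_scaleC_left scaleC_add_left scaleC_scaleC)

lemma rank_one_app [simp]: "(x \<boxtimes> y) \<cdot> z = cinner z y *\<^sub>C x"
  by transfer simp

definition adj :: "'a::complex_inner bop \<Rightarrow> 'a bop"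
  where "adj A = (THE B. \<forall>x y. cinner (A \<cdot> x) y = cinner x (B \<cdot> y))"

lemma cinner_ext_right: "(\<And>z. cinner z x = cinner z y) \<Longrightarrow> x = (y::'a::complex_inner)"
  using cinner.ip_eq_zero[of "x - y"] by (simp add: cinner.ip_diff_right)

lemma ex1_adj:
  fixes A :: "'a::chilbert_space bop"
  shows "\<exists>!B. \<forall>x y. cinner (A \<cdot> x) y = cinner x (B \<cdot> y)"
proof -
  have "\<exists>z. \<forall>x. cinner (A \<cdot> x) y = cinner x z" for y
    by (intro Riesz_representation bounded_linear_compose[OF bounded_linear_cinner_left bop_bounded_linear])
      (simp add: bop_scaleC cinner_scaleC_left)
  then obtain g where g: "\<And>x y. cinner (A \<cdot> x) y = cinner x (g y)" by metis
  obtain K where K: "0 \<le> K" "\<And>x. norm (A \<cdot> x) \<le> norm x * K" using bop_bound[of A] by blast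
  have "clinear g \<and> bounded_linear g"
  proof (rule bounded_clinearI)
    show "g (x + y) = g x + g y" for x y
      by (rule cinner_ext_right) (simp add: cinner.ip_add_right flip: g)
    show "g (c *\<^sub>C x) = c *\<^sub>C g x" for c x
      by (rule cinner_ext_right) (simp add: cinner.ip_scaleC_right flip: g)
    show "norm (g y) \<le> norm y * K" for y
    proof -
      have "complex_of_real ((norm (g y))\<^sup>2) = cinner (A \<cdot> g y) y"
        by (simp only: g cinner.ip_self)
      then have "(norm (g y))\<^sup>2 \<le> norm (A \<cdot> g y) * norm y"
        using cinner.Cauchy_Schwarz[of "A \<cdot> g y" y] by (metis abs_power2 norm_of_real)
      also have "\<dots> \<le> norm (g y) * K * norm y"
        using K(2) by (intro mult_right_mono) auto
      finally have "norm (g y) * norm (g y) \<le> norm (g y) * (norm y * K)"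
        by (simp add: power2_eq_square mult_ac)
      then show ?thesis
        using K(1) by (cases "norm (g y) = 0") (auto simp: mult_le_cancel_left_pos)
    qed
  qed
  then have "Abs_bop g \<cdot> y = g y" for y
    by (simp add: Abs_bop_inverse)
  then have ex: "\<forall>x y. cinner (A \<cdot> x) y = cinner x (Abs_bop g \<cdot> y)"
    by (simp add: g)
  show ?thesis
  proof (rule ex1I[of _ "Abs_bop g"])
    fix B assume "\<forall>x y. cinner (A \<cdot> x) y = cinner x (B \<cdot> y)"
    then show "B = Abs_bop g"
      using ex by (intro bop_eqI cinner_ext_right) metis
  qed (rule ex)
qed

lemma cinner_adj_right: "cinner x (adj A \<cdot> y) = cinner (A \<cdot> x) (y::'a::chilbert_space)"
  by (rule theI'[OF ex1_adj[of A], folded adj_def, rule_format, symmetric])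

lemma cinner_adj_left: "cinner (adj A \<cdot> x) y = cinner x (A \<cdot> (y::'a::chilbert_space))"
  by (metis cinner_adj_right cinner_commute)

lemma adj_eqI:
  fixes A :: "'a::chilbert_space bop"
  shows "(\<And>x y. cinner (A \<cdot> x) y = cinner x (B \<cdot> y)) \<Longrightarrow> adj A = B"
  by (intro bop_eqI cinner_ext_right) (simp add: cinner_adj_right)

lemma adj_adj [simp]: "adj (adj A) = (A :: 'a::chilbert_space bop)"
  by (rule adj_eqI) (rule cinner_adj_left)

lemma adj_simps:
  fixes A B :: "'a::chilbert_space bop"
  shows "adj 0 = (0 :: 'a bop)" "adj (A + B) = adj A + adj B" "adj (A - B) = adj A - adj B"
    "adj (c *\<^sub>C A) = cnj c *\<^sub>C adj A" "adj (A \<circ>\<^sub>B B) = adj B \<circ>\<^sub>B adj A"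
  by (auto intro!: adj_eqI simp: cinner_adj_right cinner_add_left cinner.ip_add_right
      cinner.ip_diff_left cinner.ip_diff_right cinner_scaleC_left cinner.ip_scaleC_right)

section \<open>Hilbert-Schmidt operators\<close>

definition hilbert_schmidt :: "'a::chilbert_space bop \<Rightarrow> bool"
  where "hilbert_schmidt T \<longleftrightarrow> (\<exists>B. is_onb B \<and> (\<lambda>e. (norm (T \<cdot> e))\<^sup>2) summable_on B)"

text \<open>The choice of the basis is immaterial on trace class operators, the only ones to which
  \<open>ctrace\<close> is applied below (\<open>infsum\<close> is \<open>0\<close> on non-summable families).\<close>

definition ctrace :: "'a::chilbert_space bop \<Rightarrow> complex"
  where "ctrace T = (\<Sum>\<^sub>\<infinity>e\<in>some_onb. cinner (T \<cdot> e) e)"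

lemma hs_swap:
  fixes T :: "'a::chilbert_space bop"
  assumes B: "is_onb B" and C: "is_onb C" and T: "(\<lambda>e. (norm (T \<cdot> e))\<^sup>2) summable_on B"
  shows "(\<lambda>f. (norm (adj T \<cdot> f))\<^sup>2) summable_on C"
    and "(\<Sum>\<^sub>\<infinity>f\<in>C. (norm (adj T \<cdot> f))\<^sup>2) = (\<Sum>\<^sub>\<infinity>e\<in>B. (norm (T \<cdot> e))\<^sup>2)"
proof -
  let ?g = "\<lambda>e f. (cmod (cinner (T \<cdot> e) f))\<^sup>2"
  have row: "(?g e has_sum (norm (T \<cdot> e))\<^sup>2) C" for e
    by (rule Parseval[OF C])
  have col: "((\<lambda>e. ?g e f) has_sum (norm (adj T \<cdot> f))\<^sup>2) B" for f
  proof -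
    have "?g e f = (cmod (cinner (adj T \<cdot> f) e))\<^sup>2" for e
      by (metis cinner_adj_left cinner_commute complex_mod_cnj)
    then show ?thesis using Parseval[OF B, of "adj T \<cdot> f"] by simp
  qed
  have row': "?g e summable_on C" "infsum (?g e) C = (norm (T \<cdot> e))\<^sup>2" for e
    using row[of e] by (simp_all only: has_sum_iff)
  have col': "(\<lambda>e. ?g e f) summable_on B" "(\<Sum>\<^sub>\<infinity>e\<in>B. ?g e f) = (norm (adj T \<cdot> f))\<^sup>2" for f
    using col[of f] by (simp_all only: has_sum_iff)
  have BC: "(\<lambda>(e, f). ?g e f) summable_on B \<times> C"
    by (rule summable_on_SigmaI[where g = "\<lambda>e. (norm (T \<cdot> e))\<^sup>2"]) (use row T in auto)
  have CB: "(\<lambda>(f, e). ?g e f) summable_on C \<times> B"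
    using BC by (subst summable_on_swap) simp
  have "(\<lambda>f. \<Sum>\<^sub>\<infinity>e\<in>B. ?g e f) summable_on C"
    by (rule summable_on_Sigma_banach[OF CB])
  then show "(\<lambda>f. (norm (adj T \<cdot> f))\<^sup>2) summable_on C"
    by (simp only: col')
  show "(\<Sum>\<^sub>\<infinity>f\<in>C. (norm (adj T \<cdot> f))\<^sup>2) = (\<Sum>\<^sub>\<infinity>e\<in>B. (norm (T \<cdot> e))\<^sup>2)"
    using infsum_swap_banach[OF BC] by (simp only: row' col')
qed

lemma hs_iff: "is_onb B \<Longrightarrow> hilbert_schmidt T \<longleftrightarrow> (\<lambda>e. (norm (T \<cdot> e))\<^sup>2) summable_on B"
  using hs_swap(1)[of _ B T] hs_swap(1)[of B B "adj T"] by (auto simp: hilbert_schmidt_def)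

lemma hs_adj [simp]: "hilbert_schmidt (adj T) \<longleftrightarrow> hilbert_schmidt T"
  using hs_swap(1)[OF is_onb_some_onb is_onb_some_onb, of T] hs_swap(1)[OF is_onb_some_onb is_onb_some_onb, of "adj T"]
  by (auto simp: hs_iff[OF is_onb_some_onb])

lemma hs_norm_adj:
  assumes "is_onb B" "is_onb C" "hilbert_schmidt T"
  shows "(\<Sum>\<^sub>\<infinity>f\<in>C. (norm (adj T \<cdot> f))\<^sup>2) = (\<Sum>\<^sub>\<infinity>e\<in>B. (norm (T \<cdot> e))\<^sup>2)"
  using hs_swap(2)[of B C T] assms by (auto simp: hs_iff)

lemma norm_add_square_le: "(norm (x + y))\<^sup>2 \<le> 2 * (norm x)\<^sup>2 + 2 * (norm (y::'a::real_normed_vector))\<^sup>2"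
proof -
  have "(norm (x + y))\<^sup>2 \<le> (norm x + norm y)\<^sup>2" by (intro power_mono norm_triangle_ineq) simp
  also have "\<dots> \<le> 2 * (norm x)\<^sup>2 + 2 * (norm y)\<^sup>2"
    using zero_le_power2[of "norm x - norm y"] by (simp add: power2_sum power2_diff)
  finally show ?thesis .
qed

lemma summable_on_le:
  fixes f g :: "'a \<Rightarrow> real"
  assumes "g summable_on A" "\<And>x. x \<in> A \<Longrightarrow> 0 \<le> f x" "\<And>x. x \<in> A \<Longrightarrow> f x \<le> g x"
  shows "f summable_on A"
proof -
  have "(\<lambda>x. norm (f x)) summable_on A"
  proof (rule Infinite_Sum.abs_summable_on_comparison_test)
    show "(\<lambda>x. norm (g x)) summable_on A"
      using assms(1) by (rule summable_on_iff_abs_summable_on_real[THEN iffD1])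
  qed (use assms in force)
  then show ?thesis by (rule summable_on_iff_abs_summable_on_real[THEN iffD2])
qed

lemma hs_zero: "hilbert_schmidt 0"
  by (simp add: hs_iff[OF is_onb_some_onb])

lemma hs_add: "hilbert_schmidt S \<Longrightarrow> hilbert_schmidt T \<Longrightarrow> hilbert_schmidt (S + T)"
  unfolding hs_iff[OF is_onb_some_onb]
proof (rule summable_on_le)
  assume "(\<lambda>e. (norm (S \<cdot> e))\<^sup>2) summable_on some_onb" "(\<lambda>e. (norm (T \<cdot> e))\<^sup>2) summable_on some_onb"
  then show "(\<lambda>e. 2 * (norm (S \<cdot> e))\<^sup>2 + 2 * (norm (T \<cdot> e))\<^sup>2) summable_on some_onb"
    by (intro summable_on_add summable_on_cmult_right)
qed (simp_all add: norm_add_square_le)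

lemma hs_scaleC: "hilbert_schmidt T \<Longrightarrow> hilbert_schmidt (c *\<^sub>C T)"
  unfolding hs_iff[OF is_onb_some_onb]
  by (simp add: norm_scaleC power_mult_distrib summable_on_cmult_right)

lemma hs_uminus: "hilbert_schmidt T \<Longrightarrow> hilbert_schmidt (- T)"
  unfolding hs_iff[OF is_onb_some_onb] by simp

lemma hs_diff: "hilbert_schmidt S \<Longrightarrow> hilbert_schmidt T \<Longrightarrow> hilbert_schmidt (S - T)"
  using hs_add[of S "- T"] hs_uminus[of T] by simp

lemma hs_comp_left: "hilbert_schmidt T \<Longrightarrow> hilbert_schmidt (A \<circ>\<^sub>B T)"
proof -
  assume T: "hilbert_schmidt T"
  obtain K where K: "0 \<le> K" "\<And>x. norm (A \<cdot> x) \<le> norm x * K" using bop_bound[of A] by blast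
  show ?thesis
    unfolding hs_iff[OF is_onb_some_onb]
  proof (rule summable_on_le)
    show "(\<lambda>e. (norm (T \<cdot> e))\<^sup>2 * K\<^sup>2) summable_on some_onb"
      using T unfolding hs_iff[OF is_onb_some_onb] by (rule summable_on_cmult_left)
    show "(norm ((A \<circ>\<^sub>B T) \<cdot> e))\<^sup>2 \<le> (norm (T \<cdot> e))\<^sup>2 * K\<^sup>2" for e
      using power_mono[OF K(2)[of "T \<cdot> e"], of 2] by (simp add: power_mult_distrib)
  qed simp
qed

lemma hs_comp_right: "hilbert_schmidt T \<Longrightarrow> hilbert_schmidt (T \<circ>\<^sub>B A)"
  using hs_comp_left[of "adj T" "adj A"] by (metis adj_adj adj_simps(5) hs_adj)

typedef (overloaded) 'a hs = "{T :: 'a::chilbert_space bop. hilbert_schmidt T}"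
  morphisms hs_op Abs_hs
  using hs_zero by blast

setup_lifting type_definition_hs

lemma hilbert_schmidt_hs_op: "hilbert_schmidt (hs_op x)"
  by transfer simp

instantiation hs :: (chilbert_space) complex_vector
begin

lift_definition zero_hs :: "'a hs" is 0 by (rule hs_zero)
lift_definition plus_hs :: "'a hs \<Rightarrow> 'a hs \<Rightarrow> 'a hs" is "(+)" by (rule hs_add)
lift_definition minus_hs :: "'a hs \<Rightarrow> 'a hs \<Rightarrow> 'a hs" is "(-)" by (rule hs_diff)
lift_definition uminus_hs :: "'a hs \<Rightarrow> 'a hs" is uminus by (rule hs_uminus)
lift_definition scaleC_hs :: "complex \<Rightarrow> 'a hs \<Rightarrow> 'a hs" is scaleC by (rule hs_scaleC)
definition scaleR_hs :: "real \<Rightarrow> 'a hs \<Rightarrow> 'a hs" where "scaleR_hs r x = complex_of_real r *\<^sub>C x"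

instance
  by standard (auto intro!: hs_op_inject[THEN iffD1] simp: scaleR_hs_def zero_hs.rep_eq plus_hs.rep_eq
      minus_hs.rep_eq uminus_hs.rep_eq scaleC_hs.rep_eq scaleC_add_right scaleC_add_left scaleC_scaleC scaleC_one)

end

definition hs_inner :: "'a::chilbert_space hs \<Rightarrow> 'a hs \<Rightarrow> complex"
  where "hs_inner x y = ctrace (hs_op x \<circ>\<^sub>B adj (hs_op y))"

lemma hs_inner_has_sum:
  "((\<lambda>e. cinner (adj (hs_op y) \<cdot> e) (adj (hs_op x) \<cdot> e)) has_sum hs_inner x y) some_onb"
proof -
  let ?f = "\<lambda>z e. (norm (adj (hs_op z) \<cdot> e))\<^sup>2"
  have sm: "?f z summable_on some_onb" for z :: "'a hs"
    using hilbert_schmidt_hs_op[of z] hs_iff[OF is_onb_some_onb, of "adj (hs_op z)"] by simp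
  have "(\<lambda>e. cinner (adj (hs_op y) \<cdot> e) (adj (hs_op x) \<cdot> e)) summable_on some_onb"
  proof (rule abs_summable_summable, rule summable_on_le)
    show "(\<lambda>e. ?f x e + ?f y e) summable_on some_onb"
      by (intro summable_on_add sm)
    show "norm (cinner (adj (hs_op y) \<cdot> e) (adj (hs_op x) \<cdot> e)) \<le> ?f x e + ?f y e" for e
    proof -
      let ?a = "norm (adj (hs_op y) \<cdot> e)" and ?b = "norm (adj (hs_op x) \<cdot> e)"
      have "norm (cinner (adj (hs_op y) \<cdot> e) (adj (hs_op x) \<cdot> e)) \<le> ?a * ?b"
        by (rule cinner.Cauchy_Schwarz)
      moreover have "0 \<le> (?a - ?b)\<^sup>2" "0 \<le> ?a * ?b" by simp_all
      ultimately show ?thesis unfolding power2_diff by linarith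
    qed
  qed simp
  then show ?thesis
    by (simp add: hs_inner_def ctrace_def cinner_adj_right)
qed

lemma hs_inner_self:
  "((\<lambda>e. (norm (adj (hs_op x) \<cdot> e))\<^sup>2) has_sum Re (hs_inner x x)) some_onb"
  using has_sum_Re[OF hs_inner_has_sum[of x x]] by (simp add: cinner.ip_self)

lemma onb_zero:
  fixes T :: "'a::chilbert_space bop"
  assumes B: "is_onb B" and T: "\<And>e. e \<in> B \<Longrightarrow> T \<cdot> e = 0"
  shows "T = 0"
proof (rule bop_eqI)
  fix x
  have "adj T \<cdot> T \<cdot> x = 0"
  proof -
    have "\<forall>e\<in>B. cinner (adj T \<cdot> T \<cdot> x) e = 0"
      using T by (simp add: cinner_adj_left)
    then show ?thesis using B by (simp add: is_onb_def)
  qed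
  then have "cinner (T \<cdot> x) (T \<cdot> x) = 0"
    by (simp flip: cinner_adj_right)
  then show "T \<cdot> x = 0 \<cdot> x"
    by (simp add: cinner.ip_eq_zero)
qed

interpretation hs: hermitian_form "hs_inner :: 'a::chilbert_space hs \<Rightarrow> 'a hs \<Rightarrow> complex"
proof
  fix x y z :: "'a hs" and c :: complex
  show "hs_inner x y = cnj (hs_inner y x)"
  proof (rule has_sum_unique[OF hs_inner_has_sum])
    show "((\<lambda>e. cinner (adj (hs_op y) \<cdot> e) (adj (hs_op x) \<cdot> e)) has_sum cnj (hs_inner y x)) some_onb"
      using hs_inner_has_sum[of x y] by (subst has_sum_cnj_iff[symmetric]) (simp flip: cinner_commute)
  qed
  show "hs_inner (x + y) z = hs_inner x z + hs_inner y z"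
  proof (rule has_sum_unique[OF hs_inner_has_sum])
    show "((\<lambda>e. cinner (adj (hs_op z) \<cdot> e) (adj (hs_op (x + y)) \<cdot> e)) has_sum
        hs_inner x z + hs_inner y z) some_onb"
      using has_sum_add[OF hs_inner_has_sum[of z x] hs_inner_has_sum[of z y]]
      by (simp add: plus_hs.rep_eq adj_simps cinner.ip_add_right)
  qed
  show "hs_inner (c *\<^sub>C x) y = c * hs_inner x y"
  proof (rule has_sum_unique[OF hs_inner_has_sum])
    show "((\<lambda>e. cinner (adj (hs_op y) \<cdot> e) (adj (hs_op (c *\<^sub>C x)) \<cdot> e)) has_sum
        c * hs_inner x y) some_onb"
      using has_sum_cmult_right[OF hs_inner_has_sum[of y x], of c]
      by (simp add: scaleC_hs.rep_eq adj_simps cinner.ip_scaleC_right)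
  qed
  have self: "hs_inner x x = complex_of_real (Re (hs_inner x x))"
    using has_sum_unique[OF hs_inner_has_sum[of x x], of "complex_of_real (Re (hs_inner x x))"]
      has_sum_of_real[OF hs_inner_self[of x]] by (simp add: cinner.ip_self)
  show "0 \<le> hs_inner x x"
    using has_sum_nonneg[OF hs_inner_self[of x]] by (subst self) (simp add: less_eq_complex_def)
  show "x = 0" if "hs_inner x x = 0"
  proof -
    have "adj (hs_op x) \<cdot> e = 0" if "e \<in> some_onb" for e
      using nonneg_has_sum_le_0D[OF hs_inner_self[of x] _ _ that] \<open>hs_inner x x = 0\<close> by simp
    then have "adj (hs_op x) = 0"
      by (rule onb_zero[OF is_onb_some_onb])
    then have "hs_op x = 0" by (metis adj_adj adj_simps(1))
    then show "x = 0" by (metis hs_op_inject zero_hs.rep_eq)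
  qed
qed

instantiation hs :: (chilbert_space) complex_inner
begin

definition cinner_hs :: "'a hs \<Rightarrow> 'a hs \<Rightarrow> complex"
  where "cinner_hs x y = ctrace (hs_op x \<circ>\<^sub>B adj (hs_op y))"
definition norm_hs :: "'a hs \<Rightarrow> real" where "norm_hs x = sqrt (Re (cinner x x))"
definition dist_hs :: "'a hs \<Rightarrow> 'a hs \<Rightarrow> real" where "dist_hs x y = norm (x - y)"
definition sgn_hs :: "'a hs \<Rightarrow> 'a hs" where "sgn_hs x = inverse (norm x) *\<^sub>R x"
definition uniformity_hs :: "('a hs \<times> 'a hs) filter"
  where "uniformity_hs = (INF e\<in>{0<..}. principal {(x, y). dist x y < e})"
definition open_hs :: "'a hs set \<Rightarrow> bool"
  where "open_hs U \<longleftrightarrow> (\<forall>x\<in>U. \<forall>\<^sub>F (x', y) in uniformity. x' = x \<longrightarrow> y \<in> U)"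

instance
proof -
  have ci: "cinner = (hs_inner :: 'a hs \<Rightarrow> _)"
    by (intro ext) (simp add: cinner_hs_def hs_inner_def)
  have nrm: "norm = (hs.nrm :: 'a hs \<Rightarrow> _)"
    by (intro ext) (simp add: norm_hs_def hs.nrm_def ci)
  show "OFCLASS('a hs, complex_inner_class)"
  proof
    fix x y z :: "'a hs" and c :: complex and a :: real
    show "dist x y = norm (x - y)" by (rule dist_hs_def)
    show "sgn x = x /\<^sub>R norm x" by (simp add: sgn_hs_def)
    show "norm x = 0 \<longleftrightarrow> x = 0" "norm (x + y) \<le> norm x + norm y"
      unfolding nrm by (rule hs.nrm_eq_zero hs.nrm_triangle)+
    show "norm (a *\<^sub>R x) = \<bar>a\<bar> * norm x"
      unfolding nrm scaleR_scaleC hs.nrm_scaleC by simp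
    show "cinner x y = cnj (cinner y x)" "cinner (x + y) z = cinner x z + cinner y z"
      "cinner (c *\<^sub>C x) y = c * cinner x y" "0 \<le> cinner x x"
      unfolding ci by (rule hs.ip_commute hs.ip_add_left hs.ip_scaleC_left hs.ip_ge_zero)+
    show "norm x = sqrt (Re (cinner x x))" by (rule norm_hs_def)
  qed (simp_all add: uniformity_hs_def open_hs_def)
qed

end

lemma hs_norm_has_sum:
  assumes B: "is_onb B"
  shows "((\<lambda>e. (norm (hs_op x \<cdot> e))\<^sup>2) has_sum (norm x)\<^sup>2) B"
proof -
  have "(norm x)\<^sup>2 = Re (hs_inner x x)"
    using hs.ip_ge_zero[of x] by (simp add: norm_hs_def cinner_hs_def hs_inner_def less_eq_complex_def)
  then have "(norm x)\<^sup>2 = (\<Sum>\<^sub>\<infinity>e\<in>some_onb. (norm (adj (hs_op x) \<cdot> e))\<^sup>2)"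
    using infsumI[OF hs_inner_self[of x]] by simp
  also have "\<dots> = (\<Sum>\<^sub>\<infinity>e\<in>B. (norm (hs_op x \<cdot> e))\<^sup>2)"
    by (rule hs_norm_adj[OF B is_onb_some_onb hilbert_schmidt_hs_op])
  finally show ?thesis
    using hilbert_schmidt_hs_op[of x] by (simp add: has_sum_iff hs_iff[OF B])
qed

lemma hs_op_simps [simp]:
  "hs_op 0 = 0" "hs_op (x + y) = hs_op x + hs_op y" "hs_op (x - y) = hs_op x - hs_op y"
  "hs_op (- x) = - hs_op x" "hs_op (c *\<^sub>C x) = c *\<^sub>C hs_op x"
  by (simp_all add: zero_hs.rep_eq plus_hs.rep_eq minus_hs.rep_eq uminus_hs.rep_eq scaleC_hs.rep_eq)

lemma norm_hs_op_le: "norm (hs_op x \<cdot> v) \<le> norm v * norm x"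
proof -
  let ?T = "hs_op x"
  define B :: "'a set" where "B = some_onb"
  have B: "is_onb B" "orthonormal B" using is_onb_some_onb by (auto simp: B_def is_onb_def)
  obtain F :: "nat \<Rightarrow> 'a set" where *: "(\<forall>n. finite (F n)) \<and> (\<forall>n. F n \<subseteq> B) \<and>
    (\<lambda>n. \<Sum>e\<in>F n. cinner v e *\<^sub>C e) \<longlonglongrightarrow> v"
    using onb_expansion[OF B(1), of v] by (rule exE)
  have bound: "norm (?T \<cdot> (\<Sum>e\<in>F n. cinner v e *\<^sub>C e)) \<le> norm v * norm x" for n
  proof -
    have F: "finite (F n)" "F n \<subseteq> B" using * by auto
    have "norm (?T \<cdot> (\<Sum>e\<in>F n. cinner v e *\<^sub>C e)) = norm (\<Sum>e\<in>F n. cinner v e *\<^sub>C (?T \<cdot> e))"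
      by (simp add: linear_sum[OF bounded_linear.linear[OF bop_bounded_linear]] bop_scaleC)
    also have "\<dots> \<le> (\<Sum>e\<in>F n. \<bar>cmod (cinner v e)\<bar> * \<bar>norm (?T \<cdot> e)\<bar>)"
      by (rule order_trans[OF norm_sum]) (simp add: norm_scaleC)
    also have "\<dots> \<le> L2_set (\<lambda>e. cmod (cinner v e)) (F n) * L2_set (\<lambda>e. norm (?T \<cdot> e)) (F n)"
      by (rule L2_set_mult_ineq)
    also have "\<dots> \<le> norm v * norm x"
    proof (rule mult_mono)
      show "L2_set (\<lambda>e. cmod (cinner v e)) (F n) \<le> norm v"
        unfolding L2_set_def using Bessel[OF B(2) F, of v] by (intro real_le_lsqrt) (auto intro: sum_nonneg)
      have "(\<Sum>e\<in>F n. (norm (?T \<cdot> e))\<^sup>2) \<le> (norm x)\<^sup>2"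
        by (rule finite_sum_le_has_sum[OF hs_norm_has_sum[OF B(1)]]) (use F in auto)
      then show "L2_set (\<lambda>e. norm (?T \<cdot> e)) (F n) \<le> norm x"
        unfolding L2_set_def by (intro real_le_lsqrt) (auto intro: sum_nonneg)
    qed (auto simp: L2_set_nonneg)
    finally show ?thesis .
  qed
  have "(\<lambda>n. norm (?T \<cdot> (\<Sum>e\<in>F n. cinner v e *\<^sub>C e))) \<longlonglongrightarrow> norm (?T \<cdot> v)"
    using * by (intro tendsto_norm bounded_linear.tendsto[OF bop_bounded_linear]) blast
  then show ?thesis
    using bound by (intro LIMSEQ_le_const2) auto
qed

instance hs :: (chilbert_space) chilbert_space
proof
  fix X :: "nat \<Rightarrow> 'a hs" assume X: "Cauchy X"
  define B :: "'a set" where "B = some_onb"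
  have B: "is_onb B" using is_onb_some_onb by (simp add: B_def)
  have Cauchy_v: "Cauchy (\<lambda>n. hs_op (X n) \<cdot> v)" for v
  proof (rule metric_CauchyI)
    fix \<epsilon> :: real assume "0 < \<epsilon>"
    then obtain N where N: "\<And>m n. m \<ge> N \<Longrightarrow> n \<ge> N \<Longrightarrow> norm (X m - X n) < \<epsilon> / (norm v + 1)"
      using CauchyD[OF X, of "\<epsilon> / (norm v + 1)"] by (auto simp: add_nonneg_pos)
    have "dist (hs_op (X m) \<cdot> v) (hs_op (X n) \<cdot> v) < \<epsilon>" if "m \<ge> N" "n \<ge> N" for m n
    proof -
      have "dist (hs_op (X m) \<cdot> v) (hs_op (X n) \<cdot> v) \<le> norm v * norm (X m - X n)"
        using norm_hs_op_le[of "X m - X n" v] by (simp add: dist_norm)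
      also have "\<dots> \<le> (norm v + 1) * norm (X m - X n)"
        by (intro mult_right_mono) auto
      also have "\<dots> < \<epsilon>"
      proof -
        have "0 < norm v + 1" by (simp add: add_nonneg_pos)
        then show ?thesis using N[OF that] by (simp only: pos_less_divide_eq mult.commute)
      qed
      finally show ?thesis .
    qed
    then show "\<exists>N. \<forall>m\<ge>N. \<forall>n\<ge>N. dist (hs_op (X m) \<cdot> v) (hs_op (X n) \<cdot> v) < \<epsilon>" by blast
  qed
  then have "\<exists>w. (\<lambda>n. hs_op (X n) \<cdot> v) \<longlonglongrightarrow> w" for v
    using Cauchy_convergent convergent_def by blast
  then obtain g where g: "\<And>v. (\<lambda>n. hs_op (X n) \<cdot> v) \<longlonglongrightarrow> g v" by metis
  obtain K where K: "\<And>n. norm (X n) \<le> K"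
    using Cauchy_Bseq[OF X] by (auto simp: Bseq_def)
  have "clinear g \<and> bounded_linear g"
  proof (rule bounded_clinearI)
    show "g (v + w) = g v + g w" for v w
      using g[of "v + w"] tendsto_add[OF g[of v] g[of w]] by (auto simp: bop_add intro: LIMSEQ_unique)
    show "g (c *\<^sub>C v) = c *\<^sub>C g v" for c v
    proof -
      have "bounded_linear (\<lambda>x::'a. c *\<^sub>C x)"
        by (rule bounded_linear_intro[where K = "cmod c"])
          (auto simp: scaleC_add_right scaleR_scaleC scaleC_scaleC norm_scaleC mult_ac)
      from bounded_linear.tendsto[OF this g[of v]] g[of "c *\<^sub>C v"] show ?thesis
        by (auto simp: bop_scaleC intro: LIMSEQ_unique)
    qed
    show "norm (g v) \<le> norm v * K" for v
    proof (rule LIMSEQ_le_const2[OF tendsto_norm[OF g]])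
      show "\<exists>N. \<forall>n\<ge>N. norm (hs_op (X n) \<cdot> v) \<le> norm v * K"
        using norm_hs_op_le K by (meson mult_left_mono norm_ge_zero order_trans)
    qed
  qed
  then have "bop_app (Abs_bop g) = g"
    by (simp add: Abs_bop_inverse)
  then obtain T where T: "\<And>v. T \<cdot> v = g v" by metis
  have key: "(\<Sum>e\<in>F. (norm ((T - hs_op (X n)) \<cdot> e))\<^sup>2) \<le> \<epsilon>\<^sup>2"
    if F: "finite F" "F \<subseteq> B" and N: "\<And>m. m \<ge> N \<Longrightarrow> norm (X m - X n) \<le> \<epsilon>" for F N n \<epsilon>
  proof (rule LIMSEQ_le_const2)
    show "(\<lambda>m. \<Sum>e\<in>F. (norm (hs_op (X m) \<cdot> e - hs_op (X n) \<cdot> e))\<^sup>2) \<longlonglongrightarrow>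
        (\<Sum>e\<in>F. (norm ((T - hs_op (X n)) \<cdot> e))\<^sup>2)"
      unfolding bop_simps T by (intro tendsto_intros g)
    show "\<exists>N. \<forall>m\<ge>N. (\<Sum>e\<in>F. (norm (hs_op (X m) \<cdot> e - hs_op (X n) \<cdot> e))\<^sup>2) \<le> \<epsilon>\<^sup>2"
    proof (intro exI[of _ N] allI impI)
      fix m assume "N \<le> m"
      have "(\<Sum>e\<in>F. (norm (hs_op (X m - X n) \<cdot> e))\<^sup>2) \<le> (norm (X m - X n))\<^sup>2"
        by (rule finite_sum_le_has_sum[OF hs_norm_has_sum[OF B]]) (use F in auto)
      also have "\<dots> \<le> \<epsilon>\<^sup>2"
        using N[OF \<open>N \<le> m\<close>] by (intro power_mono) auto
      finally show "(\<Sum>e\<in>F. (norm (hs_op (X m) \<cdot> e - hs_op (X n) \<cdot> e))\<^sup>2) \<le> \<epsilon>\<^sup>2"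
        by simp
    qed
  qed
  have hs: "hilbert_schmidt (T - hs_op (X n))" if "\<And>m. m \<ge> N \<Longrightarrow> norm (X m - X n) \<le> \<epsilon>" for N n \<epsilon>
    unfolding hs_iff[OF B]
    by (rule nonneg_bdd_above_summable_on) (use key that in \<open>auto intro!: bdd_aboveI2[where M = "\<epsilon>\<^sup>2"]\<close>)
  obtain N where N: "\<And>m n. m \<ge> N \<Longrightarrow> n \<ge> N \<Longrightarrow> norm (X m - X n) < 1"
    using CauchyD[OF X, of 1] by auto
  have "hilbert_schmidt (T - hs_op (X N))"
    by (rule hs[where N = N and \<epsilon> = 1]) (use N in \<open>simp add: less_imp_le\<close>)
  from hs_add[OF this hilbert_schmidt_hs_op[of "X N"]] have "hilbert_schmidt T" by simp
  then obtain Y where Y: "hs_op Y = T"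
    using Abs_hs_inverse[of T] by blast
  have "X \<longlonglongrightarrow> Y"
  proof (rule metric_LIMSEQ_I)
    fix \<epsilon> :: real assume "0 < \<epsilon>"
    then obtain N where N: "\<And>m n. m \<ge> N \<Longrightarrow> n \<ge> N \<Longrightarrow> norm (X m - X n) < \<epsilon> / 2"
      using CauchyD[OF X, of "\<epsilon> / 2"] by auto
    have "dist (X n) Y < \<epsilon>" if "n \<ge> N" for n
    proof -
      have "(norm (Y - X n))\<^sup>2 \<le> (\<epsilon> / 2)\<^sup>2"
      proof (rule has_sum_le_finite_sums[OF hs_norm_has_sum[OF B]])
        fix F assume F: "finite F" "F \<subseteq> B"
        have "(\<Sum>e\<in>F. (norm ((T - hs_op (X n)) \<cdot> e))\<^sup>2) \<le> (\<epsilon> / 2)\<^sup>2"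
          using N[OF _ that] by (intro key[OF F, where N = N]) (simp add: less_imp_le)
        then show "(\<Sum>e\<in>F. (norm (hs_op (Y - X n) \<cdot> e))\<^sup>2) \<le> (\<epsilon> / 2)\<^sup>2"
          by (simp add: Y)
      qed
      then have "norm (Y - X n) \<le> \<epsilon> / 2"
        by (rule power2_le_imp_le) (use \<open>0 < \<epsilon>\<close> in simp)
      then show ?thesis
        using \<open>0 < \<epsilon>\<close> by (simp add: dist_norm norm_minus_commute)
    qed
    then show "\<exists>N. \<forall>n\<ge>N. dist (X n) Y < \<epsilon>" by blast
  qed
  then show "convergent X" by (rule convergentI)
qed

section \<open>The left and right actions on Hilbert-Schmidt operators\<close>

definition left_mult :: "'a::chilbert_space bop \<Rightarrow> 'a hs bop"
  where "left_mult a = Abs_bop (\<lambda>y. Abs_hs (a \<circ>\<^sub>B hs_op y))"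

definition right_mult :: "'a::chilbert_space bop \<Rightarrow> 'a hs bop"
  where "right_mult a = Abs_bop (\<lambda>y. Abs_hs (hs_op y \<circ>\<^sub>B a))"

lemma hs_eqI: "hs_op x = hs_op y \<Longrightarrow> x = y"
  by (simp add: hs_op_inject)

lemma hs_op_left_mult [simp]: "hs_op (left_mult a \<cdot> y) = a \<circ>\<^sub>B hs_op (y :: 'a::chilbert_space hs)"
proof -
  define g where "g = (\<lambda>y. Abs_hs (a \<circ>\<^sub>B hs_op y))"
  have f: "hs_op (g y) = a \<circ>\<^sub>B hs_op y" for y
    by (simp add: g_def Abs_hs_inverse hs_comp_left hilbert_schmidt_hs_op)
  obtain K where K: "0 \<le> K" "\<And>x. norm (a \<cdot> x) \<le> norm x * K" using bop_bound[of a] by blast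
  have "clinear g \<and> bounded_linear g"
  proof (rule bounded_clinearI)
    show "g (x + y) = g x + g y" "g (c *\<^sub>C x) = c *\<^sub>C g x" for c x y
      by (rule hs_eqI, rule bop_eqI, simp add: f bop_add bop_scaleC)+
    show "norm (g x) \<le> norm x * K" for x
    proof -
      have "(norm (g x))\<^sup>2 \<le> (norm x)\<^sup>2 * K\<^sup>2"
      proof (rule has_sum_mono[OF hs_norm_has_sum has_sum_cmult_left[OF hs_norm_has_sum]])
        show "(norm (hs_op (g x) \<cdot> e))\<^sup>2 \<le> (norm (hs_op x \<cdot> e))\<^sup>2 * K\<^sup>2" for e
          using power_mono[OF K(2)[of "hs_op x \<cdot> e"], of 2] by (simp add: f power_mult_distrib)
      qed (rule is_onb_some_onb)+
      then have "(norm (g x))\<^sup>2 \<le> (norm x * K)\<^sup>2" by (simp add: power_mult_distrib)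
      then show ?thesis
        by (rule power2_le_imp_le) (use K(1) in simp)
    qed
  qed
  then have "left_mult a \<cdot> y = g y"
    by (simp add: left_mult_def Abs_bop_inverse flip: g_def)
  then show ?thesis by (simp add: f)
qed

lemma hs_norm_adj_has_sum: "((\<lambda>e. (norm (adj (hs_op x) \<cdot> e))\<^sup>2) has_sum (norm x)\<^sup>2) some_onb"
proof -
  have "(norm x)\<^sup>2 = Re (hs_inner x x)"
    using hs.ip_ge_zero[of x] by (simp add: norm_hs_def cinner_hs_def hs_inner_def less_eq_complex_def)
  then show ?thesis using hs_inner_self[of x] by simp
qed

lemma hs_op_right_mult [simp]: "hs_op (right_mult a \<cdot> y) = hs_op (y :: 'a::chilbert_space hs) \<circ>\<^sub>B a"
proof -
  define g where "g = (\<lambda>y. Abs_hs (hs_op y \<circ>\<^sub>B a))"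
  have f: "hs_op (g y) = hs_op y \<circ>\<^sub>B a" for y
    by (simp add: g_def Abs_hs_inverse hs_comp_right hilbert_schmidt_hs_op)
  obtain K where K: "0 \<le> K" "\<And>x. norm (adj a \<cdot> x) \<le> norm x * K" using bop_bound[of "adj a"] by blast
  have "clinear g \<and> bounded_linear g"
  proof (rule bounded_clinearI)
    show "g (x + y) = g x + g y" "g (c *\<^sub>C x) = c *\<^sub>C g x" for c x y
      by (rule hs_eqI, rule bop_eqI, simp add: f)+
    show "norm (g x) \<le> norm x * K" for x
    proof -
      have "(norm (g x))\<^sup>2 \<le> (norm x)\<^sup>2 * K\<^sup>2"
      proof (rule has_sum_mono[OF hs_norm_adj_has_sum has_sum_cmult_left[OF hs_norm_adj_has_sum]])
        show "(norm (adj (hs_op (g x)) \<cdot> e))\<^sup>2 \<le> (norm (adj (hs_op x) \<cdot> e))\<^sup>2 * K\<^sup>2" for e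
          using power_mono[OF K(2)[of "adj (hs_op x) \<cdot> e"], of 2]
          by (simp add: f power_mult_distrib adj_simps)
      qed
      then have "(norm (g x))\<^sup>2 \<le> (norm x * K)\<^sup>2" by (simp add: power_mult_distrib)
      then show ?thesis
        by (rule power2_le_imp_le) (use K(1) in simp)
    qed
  qed
  then have "right_mult a \<cdot> y = g y"
    by (simp add: right_mult_def Abs_bop_inverse flip: g_def)
  then show ?thesis by (simp add: f)
qed

definition separating :: "'a::chilbert_space hs \<Rightarrow> bool"
  where "separating x \<longleftrightarrow> (\<forall>a. left_mult a \<cdot> x = 0 \<longrightarrow> a = 0)"

definition cyclic :: "'a::chilbert_space hs \<Rightarrow> bool"
  where "cyclic x \<longleftrightarrow> closure (range (\<lambda>a. left_mult a \<cdot> x)) = UNIV"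

section \<open>Trace duality and normal maps\<close>

text \<open>The trace class operators are the products of two Hilbert-Schmidt operators; for these the
  series defining \<open>ctrace\<close> converges absolutely.\<close>

definition trace_class :: "'a::chilbert_space bop \<Rightarrow> bool"
  where "trace_class T \<longleftrightarrow> (\<exists>A B. hilbert_schmidt A \<and> hilbert_schmidt B \<and> T = A \<circ>\<^sub>B B)"

definition pairing :: "'a::chilbert_space bop \<Rightarrow> 'a bop \<Rightarrow> complex"
  where "pairing A B = ctrace (A \<circ>\<^sub>B B)"

definition vector_functional :: "'a::chilbert_space \<Rightarrow> 'a \<Rightarrow> 'a bop \<Rightarrow> complex"
  where "vector_functional x y A = cinner (A \<cdot> x) y"

definition sigma_weak_topology :: "'a::chilbert_space bop topology"
  where "sigma_weak_topology =
    topology_generated_by {{A. pairing A T \<in> U} | T U. trace_class T \<and> open U}"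

definition normal_map :: "('a::chilbert_space bop \<Rightarrow> 'a bop) \<Rightarrow> bool"
  where "normal_map \<Phi> \<longleftrightarrow> continuous_map sigma_weak_topology sigma_weak_topology \<Phi>"

section \<open>Matrices of operators\<close>

text \<open>A matrix in \<open>M\<^sub>n(B(K))\<close> is a function \<open>a\<close> on pairs of indices of which only the values at
  \<open>i, j < n\<close> matter; it acts on \<open>K\<^sup>n\<close>, whose elements are likewise functions on \<open>nat\<close>.\<close>

definition mat_app :: "nat \<Rightarrow> (nat \<Rightarrow> nat \<Rightarrow> 'a::complex_inner bop) \<Rightarrow> (nat \<Rightarrow> 'a) \<Rightarrow> nat \<Rightarrow> 'a"
  where "mat_app n a v i = (\<Sum>j<n. a i j \<cdot> v j)"

definition vec_norm :: "nat \<Rightarrow> (nat \<Rightarrow> 'a::complex_inner) \<Rightarrow> real"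
  where "vec_norm n v = L2_set (\<lambda>i. norm (v i)) {..<n}"

definition mat_norm :: "nat \<Rightarrow> (nat \<Rightarrow> nat \<Rightarrow> 'a::complex_inner bop) \<Rightarrow> real"
  where "mat_norm n a = Sup {vec_norm n (mat_app n a v) | v. vec_norm n v \<le> 1}"

definition mat_positive :: "nat \<Rightarrow> (nat \<Rightarrow> nat \<Rightarrow> 'a::complex_inner bop) \<Rightarrow> bool"
  where "mat_positive n a \<longleftrightarrow> (\<forall>v. 0 \<le> (\<Sum>i<n. cinner (mat_app n a v i) (v i)))"

definition k_positive :: "nat \<Rightarrow> ('a::complex_inner bop \<Rightarrow> 'a bop) \<Rightarrow> bool"
  where "k_positive k \<phi> \<longleftrightarrow> (\<forall>a. mat_positive k a \<longrightarrow> mat_positive k (\<lambda>i j. \<phi> (a i j)))"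

definition completely_bounded :: "('a::complex_inner bop \<Rightarrow> 'a bop) \<Rightarrow> bool"
  where "completely_bounded \<phi> \<longleftrightarrow>
    (\<exists>C. \<forall>n a. mat_norm n (\<lambda>i j. \<phi> (a i j)) \<le> C * mat_norm n a)"

definition CB_sigma :: "('a::chilbert_space bop \<Rightarrow> 'a bop) set"
  where "CB_sigma = {\<phi>. clinear \<phi> \<and> normal_map \<phi> \<and> completely_bounded \<phi>}"

section \<open>The operators associated with a normal completely bounded map\<close>

text \<open>For \<open>\<phi>\<close> in \<open>CB_sigma\<close> there is exactly one such \<open>\<Phi>\<close>; likewise exactly one \<open>D\<close> in
  \<open>predual_map\<close> when \<open>\<Phi>\<close> is a normal linear map and \<open>B\<close> is trace class.\<close>

definition tilde :: "('a::chilbert_space bop \<Rightarrow> 'a bop) \<Rightarrow> 'a hs bop \<Rightarrow> 'a hs bop"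
  where "tilde \<phi> = (THE \<Phi>. clinear \<Phi> \<and> normal_map \<Phi> \<and>
    (\<forall>x y. \<Phi> (right_mult y \<circ>\<^sub>B left_mult x) = right_mult y \<circ>\<^sub>B left_mult (\<phi> x)))"

definition predual_map :: "('a::chilbert_space bop \<Rightarrow> 'a bop) \<Rightarrow> 'a bop \<Rightarrow> 'a bop"
  where "predual_map \<Phi> B = (THE D. trace_class D \<and> (\<forall>A. pairing A D = pairing (\<Phi> A) B))"

definition C_op :: "'a::chilbert_space hs \<Rightarrow> ('a bop \<Rightarrow> 'a bop) \<Rightarrow> 'a hs bop"
  where "C_op x\<^sub>0 \<phi> = tilde \<phi> (x\<^sub>0 \<boxtimes> x\<^sub>0)"

definition D_op :: "'a::chilbert_space hs \<Rightarrow> ('a bop \<Rightarrow> 'a bop) \<Rightarrow> 'a hs bop"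
  where "D_op x\<^sub>0 \<phi> = predual_map (tilde \<phi>) (x\<^sub>0 \<boxtimes> x\<^sub>0)"

text \<open>The rank is the dimension of the range; the case distinction is needed because
  \<open>complex_vector.dim\<close> is \<open>0\<close> on infinite-dimensional subspaces.\<close>

definition op_rank :: "'a::complex_inner bop \<Rightarrow> enat"
  where "op_rank T = (if \<exists>B. finite B \<and> range (bop_app T) \<subseteq> complex_vector.span B
    then enat (complex_vector.dim (range (bop_app T))) else \<infinity>)"

end

theory Submission
  imports Defs
begin

text \<open>Identify \<open>H\<close> with \<open>K \<otimes> K*\<close>, its elementary tensors being the rank one operators \<open>ket v w\<close>. Then
  \<open>tilde \<phi>\<close> applies \<open>\<phi>\<close> to the blocks of an operator matrix. Complete boundedness makes the result
  bounded; its normality amounts to writing a functional that is bounded on \<open>B(H)\<close> and continuous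
  along finite-dimensional compressions as \<open>A \<mapsto> Tr(A D)\<close>, where the factorization of \<open>D\<close> into
  Hilbert-Schmidt operators comes from its singular value decomposition.

  For \<open>x = (\<Sum>l<k. ket (a l) (b l))\<close>, which is the general element of rank at most \<open>k\<close>, the two numbers
  in (ii) and (iii) are the values of one form
  \<open>Q(h, v) = (\<Sum>l m. cinner (\<phi> (h l \<boxtimes> h m) \<cdot> v m) (v l))\<close>, namely \<open>Q(x\<^sub>0 b, a)\<close> and \<open>Q(a, x\<^sub>0 b)\<close>. As \<open>x\<^sub>0\<close> has
  dense range and \<open>Q\<close> is continuous in both arguments, each condition says that \<open>Q \<ge> 0\<close>. This is
  \<open>k\<close>-positivity, since compressing a positive matrix to finite dimensions and splitting off Schur
  complements exhibits it as a limit of sums of matrices \<open>(h l \<boxtimes> h m)\<close>.\<close>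

text \<open>\<open>tilde \<phi>\<close> and \<open>predual_map\<close> are given by
  \<open>THE\<close>, and normality is continuity for a topology, so nothing about them can be used
  before existence and uniqueness are proved. Both rest on one criterion,
  \<open>normal_functional_representation\<close>: a bounded functional \<open>f\<close> with
  \<open>f (A \<circ>\<^sub>B P n)\<close> tending to \<open>f A\<close> along increasing finite
  basis projections \<open>P n\<close> is a trace pairing. Compressing on one side is enough,
  because \<open>A \<circ>\<^sub>B P n\<close> is already a finite sum of rank one operators, on
  which \<open>f\<close> is a bounded sesquilinear form. Separability of K supplies countable bases
  of K and H, so that sequences replace nets and a summable majorant lets limits pass through
  traces. The two conditions are not symmetric: for \<open>x\<close> of finite rank
  \<open>x \<boxtimes> x\<close> is a finite sum of products of right and left multiplications,
  whereas for \<open>x\<^sub>0\<close>, of dense range,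
  \<open>x\<^sub>0 \<boxtimes> x\<^sub>0\<close> is not, and evaluating \<open>tilde \<phi>\<close>
  there takes normality.\<close>

section \<open>Bounded operators and functionals\<close>

text \<open>\<open>bop\<close> carries no norm, so bounds travel as explicit parameters. On the zero
  space the inequality holds for every \<open>K\<close>, hence the separate condition
  \<open>0 \<le> K\<close>.\<close>

definition bounded_by :: "real \<Rightarrow> 'a::complex_inner bop \<Rightarrow> bool"
  where "bounded_by K A \<longleftrightarrow> 0 \<le> K \<and> (\<forall>x. norm (A \<cdot> x) \<le> K * norm x)"

lemma bounded_byI: "0 \<le> K \<Longrightarrow> (\<And>x. norm (A \<cdot> x) \<le> K * norm x) \<Longrightarrow> bounded_by K A"
  by (simp add: bounded_by_def)

lemma bounded_by_nonneg: "bounded_by K A \<Longrightarrow> 0 \<le> K"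
  by (simp add: bounded_by_def)

lemma bounded_byD: "bounded_by K A \<Longrightarrow> norm (A \<cdot> x) \<le> K * norm x"
  by (simp add: bounded_by_def)

lemma ex_bounded_by: "\<exists>K. bounded_by K A"
  using bop_bound[of A] by (auto simp: bounded_by_def mult.commute)

lemma bounded_by_comp:
  assumes "bounded_by K A" "bounded_by L B"
  shows "bounded_by (K * L) (A \<circ>\<^sub>B B)"
proof (rule bounded_byI)
  show "0 \<le> K * L" using assms by (simp add: bounded_by_def)
  fix x
  have "norm (A \<cdot> B \<cdot> x) \<le> K * norm (B \<cdot> x)" using assms by (simp add: bounded_by_def)
  also have "\<dots> \<le> K * (L * norm x)" using assms by (intro mult_left_mono) (auto simp: bounded_by_def)
  finally show "norm ((A \<circ>\<^sub>B B) \<cdot> x) \<le> K * L * norm x" by (simp add: mult.assoc)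
qed

lemma cinner_bounded_by:
  assumes "bounded_by K A"
  shows "cmod (cinner (A \<cdot> x) y) \<le> K * norm x * norm y"
proof -
  have "cmod (cinner (A \<cdot> x) y) \<le> norm (A \<cdot> x) * norm y" by (rule cinner.Cauchy_Schwarz)
  also have "\<dots> \<le> K * norm x * norm y"
    using assms by (intro mult_right_mono) (auto simp: bounded_by_def)
  finally show ?thesis .
qed

lemma norm_le_if_cinner_le:
  fixes x :: "'a::complex_inner"
  assumes "cmod (cinner x x) \<le> K * norm x" "0 \<le> K"
  shows "norm x \<le> K"
proof (cases "x = 0")
  case False
  have "norm x * norm x \<le> K * norm x"
    using assms(1) by (simp add: cinner.ip_self power2_eq_square norm_mult)
  then show ?thesis using False by simp
qed (use assms in simp)

lemma bounded_by_cinnerI: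
  fixes A :: "'a::complex_inner bop"
  assumes "0 \<le> K" "\<And>x y. cmod (cinner (A \<cdot> x) y) \<le> K * norm x * norm y"
  shows "bounded_by K A"
  using assms by (intro bounded_byI norm_le_if_cinner_le) auto

lemma bounded_by_adj:
  fixes A :: "'a::chilbert_space bop"
  assumes "bounded_by K A"
  shows "bounded_by K (adj A)"
proof (rule bounded_by_cinnerI)
  show "0 \<le> K" using assms by (rule bounded_by_nonneg)
  show "cmod (cinner (adj A \<cdot> x) y) \<le> K * norm x * norm y" for x y
    using cinner_bounded_by[OF assms, of y x]
    by (metis cinner_adj_left cinner_commute complex_mod_cnj mult.commute mult.left_commute)
qed

lemma bounded_by_rank_one: "bounded_by (norm x * norm y) (x \<boxtimes> y)"
proof (rule bounded_byI)
  show "norm ((x \<boxtimes> y) \<cdot> z) \<le> norm x * norm y * norm z" for z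
    using mult_right_mono[OF cinner.Cauchy_Schwarz[of z y] norm_ge_zero[of x]]
    by (simp add: norm_scaleC mult_ac)
qed simp

lemma bop_sum_app: "sum f F \<cdot> x = (\<Sum>i\<in>F. f i \<cdot> x)"
  by (induction F rule: infinite_finite_induct) auto

lemma bop_app_sum: "A \<cdot> sum f F = (\<Sum>i\<in>F. A \<cdot> f i)"
  by (rule linear_sum[OF bounded_linear.linear[OF bop_bounded_linear]])

lemma bop_app_zero [simp]: "A \<cdot> 0 = 0"
  using bop_app_sum[of A "\<lambda>_. 0" "{}"] by simp

lemma cinner_sum_right: "cinner y (sum f A) = (\<Sum>i\<in>A. cinner (y::'a::complex_inner) (f i))"
  by (induction A rule: infinite_finite_induct) (auto simp: cinner.ip_add_right)

lemma bop_comp_algebra: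
  "(A + B) \<circ>\<^sub>B C = A \<circ>\<^sub>B C + B \<circ>\<^sub>B C" "C \<circ>\<^sub>B (A + B) = C \<circ>\<^sub>B A + C \<circ>\<^sub>B B"
  "(c *\<^sub>C A) \<circ>\<^sub>B C = c *\<^sub>C (A \<circ>\<^sub>B C)" "C \<circ>\<^sub>B (c *\<^sub>C A) = c *\<^sub>C (C \<circ>\<^sub>B A)"
  "A \<circ>\<^sub>B B \<circ>\<^sub>B C = A \<circ>\<^sub>B (B \<circ>\<^sub>B C)"
  by (rule bop_eqI; simp add: bop_add bop_scaleC)+

lemma rank_one_algebra:
  "(x + x') \<boxtimes> y = x \<boxtimes> y + x' \<boxtimes> y" "x \<boxtimes> (y + y') = x \<boxtimes> y + x \<boxtimes> y'"
  "(c *\<^sub>C x) \<boxtimes> y = c *\<^sub>C (x \<boxtimes> y)" "x \<boxtimes> (c *\<^sub>C y) = cnj c *\<^sub>C (x \<boxtimes> y)"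
  by (rule bop_eqI; simp add: scaleC_add_right scaleC_add_left cinner.ip_add_right scaleC_scaleC
      cinner.ip_scaleC_right mult.commute)+

lemma comp_rank_one: "A \<circ>\<^sub>B (x \<boxtimes> y) = (A \<cdot> x) \<boxtimes> y"
  by (rule bop_eqI) (simp add: bop_scaleC)

lemma rank_one_comp: "(x \<boxtimes> y) \<circ>\<^sub>B A = x \<boxtimes> (adj A \<cdot> (y::'a::chilbert_space))"
  by (rule bop_eqI) (simp add: cinner_adj_right)

lemma adj_rank_one [simp]: "adj (x \<boxtimes> y) = y \<boxtimes> (x::'a::chilbert_space)"
proof (rule adj_eqI)
  show "cinner ((x \<boxtimes> y) \<cdot> u) v = cinner u ((y \<boxtimes> x) \<cdot> v)" for u v
    using cinner_commute[of x v] by (simp add: cinner_scaleC_left cinner.ip_scaleC_right)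
qed

lemma bounded_bilinear_cinner: "bounded_bilinear (cinner :: 'a::complex_inner \<Rightarrow> _)"
proof
  show "\<exists>K. \<forall>a b. norm (cinner a b) \<le> norm (a::'a) * norm b * K"
    using cinner.Cauchy_Schwarz by (intro exI[of _ 1]) auto
qed (simp_all add: cinner_add_left cinner.ip_add_right scaleR_scaleC cinner_scaleC_left
    cinner.ip_scaleC_right scaleR_conv_of_real)

lemmas tendsto_cinner = bounded_bilinear.tendsto[OF bounded_bilinear_cinner]
lemmas tendsto_bop_app = bounded_linear.tendsto[OF bop_bounded_linear]

text \<open>Riesz representation in the second argument. The form is conjugate linear there, so its
  conjugate is represented; testing the resulting vector against itself shows that the bound
  \<open>K\<close> survives.\<close>

lemma bop_of_form:
  fixes q :: "'a::chilbert_space \<Rightarrow> 'a \<Rightarrow> complex"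
  assumes add_left: "\<And>x x' y. q (x + x') y = q x y + q x' y"
    and scale_left: "\<And>c x y. q (c *\<^sub>C x) y = c * q x y"
    and add_right: "\<And>x y y'. q x (y + y') = q x y + q x y'"
    and scale_right: "\<And>c x y. q x (c *\<^sub>C y) = cnj c * q x y"
    and bound: "\<And>x y. cmod (q x y) \<le> K * norm x * norm y" and K: "0 \<le> K"
  shows "\<exists>T. bounded_by K T \<and> (\<forall>x y. cinner (T \<cdot> x) y = q x y)"
proof -
  have "\<exists>z. \<forall>y. cnj (q x y) = cinner y z" for x
  proof (rule Riesz_representation)
    show "bounded_linear (\<lambda>y. cnj (q x y))"
      by (rule bounded_linear_intro[where K = "K * norm x"])
        (use bound[of x] in \<open>auto simp: add_right scaleR_scaleC scale_right scaleR_conv_of_real mult_ac\<close>)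
  qed (simp add: scale_right)
  then obtain g where "\<And>x y. cnj (q x y) = cinner y (g x)" by metis
  then have g: "cinner (g x) y = q x y" for x y
    by (metis cinner_commute complex_cnj_cnj)
  have gK: "norm (g x) \<le> K * norm x" for x
    using bound[of x "g x"] K by (intro norm_le_if_cinner_le) (auto simp: g)
  have "clinear g \<and> bounded_linear g"
  proof (rule bounded_clinearI[where K = K])
    show "g (x + y) = g x + g y" for x y
      by (rule cinner_ext) (simp add: g cinner_add_left add_left)
    show "g (c *\<^sub>C x) = c *\<^sub>C g x" for c x
      by (rule cinner_ext) (simp add: g cinner_scaleC_left scale_left)
    show "norm (g x) \<le> norm x * K" for x
      using gK[of x] by (simp add: mult.commute)
  qed
  then have "bop_app (Abs_bop g) = g"
    by (simp add: Abs_bop_inverse)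
  then show ?thesis
    using g gK K by (intro exI[of _ "Abs_bop g"]) (simp add: bounded_by_def)
qed

text \<open>The estimate ranges over all bounds \<open>K\<close> of \<open>A\<close>, which amounts
  to continuity for the operator norm.\<close>

definition bounded_functional :: "('a::chilbert_space bop \<Rightarrow> complex) \<Rightarrow> bool"
  where "bounded_functional f \<longleftrightarrow> (\<forall>A B. f (A + B) = f A + f B) \<and> (\<forall>c A. f (c *\<^sub>C A) = c * f A) \<and>
    (\<exists>C. \<forall>A K. bounded_by K A \<longrightarrow> cmod (f A) \<le> C * K)"

context
  fixes f :: "'a::chilbert_space bop \<Rightarrow> complex"
  assumes f: "bounded_functional f"
begin

lemma bounded_functional_add: "f (A + B) = f A + f B"
  using f by (simp add: bounded_functional_def)

lemma bounded_functional_scaleC: "f (c *\<^sub>C A) = c * f A"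
  using f by (simp add: bounded_functional_def)

lemma bounded_functional_zero: "f 0 = 0"
  using bounded_functional_add[of 0 0] by simp

lemma bounded_functional_diff: "f (A - B) = f A - f B"
  using bounded_functional_add[of "A - B" B] by simp

lemma bounded_functional_sum: "f (sum h F) = (\<Sum>i\<in>F. f (h i))"
  by (induction F rule: infinite_finite_induct) (simp_all add: bounded_functional_zero bounded_functional_add)

lemma bounded_functional_bound: "\<exists>C\<ge>0. \<forall>A K. bounded_by K A \<longrightarrow> cmod (f A) \<le> C * K"
proof -
  obtain C where "\<And>A K. bounded_by K A \<Longrightarrow> cmod (f A) \<le> C * K"
    using f by (auto simp: bounded_functional_def)
  then have "\<And>A K. bounded_by K A \<Longrightarrow> cmod (f A) \<le> \<bar>C\<bar> * K"
    by (meson abs_ge_self bounded_by_nonneg mult_right_mono order_trans)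
  then show ?thesis by (intro exI[of _ "\<bar>C\<bar>"]) auto
qed

lemma bounded_functional_rank_one: "\<exists>S. \<forall>x y. f (x \<boxtimes> y) = cinner (S \<cdot> x) y"
proof -
  obtain C where C: "C \<ge> 0" "\<And>A K. bounded_by K A \<Longrightarrow> cmod (f A) \<le> C * K"
    using bounded_functional_bound by blast
  have "\<exists>S. bounded_by C S \<and> (\<forall>x y. cinner (S \<cdot> x) y = f (x \<boxtimes> y))"
    by (rule bop_of_form)
      (use C(1) C(2)[OF bounded_by_rank_one] in \<open>auto simp: rank_one_algebra
        bounded_functional_add bounded_functional_scaleC mult_ac\<close>)
  then show ?thesis by metis
qed

end

section \<open>Trace class operators\<close>

lemma Re_cinner_polar: "Re (cinner x y) = ((norm (x + y))\<^sup>2 - (norm x)\<^sup>2 - (norm y)\<^sup>2) / 2"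
  for x y :: "'a::complex_inner"
  using cinner.nrm_add_square[of x y] by simp

text \<open>Real parts come from the norms of \<open>x\<close>, \<open>y\<close> and
  \<open>x + y\<close>, imaginary parts from replacing \<open>x\<close> by
  \<open>(- \<i>) *\<^sub>C x\<close>, as \<open>Re (- \<i> * z) = Im z\<close>.\<close>

lemma has_sum_polarize:
  fixes q :: "'c \<Rightarrow> 'a::complex_inner \<Rightarrow> 'b::complex_inner"
  assumes add: "\<And>e x y. q e (x + y) = q e x + q e y"
    and scale: "\<And>e c x. q e (c *\<^sub>C x) = c *\<^sub>C q e x"
    and norm: "\<And>x. ((\<lambda>e. (norm (q e x))\<^sup>2) has_sum (norm x)\<^sup>2) B"
  shows "((\<lambda>e. cinner (q e x) (q e y)) has_sum cinner x y) B"
proof -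
  have Re: "((\<lambda>e. Re (cinner (q e x) (q e y))) has_sum Re (cinner x y)) B" for x y
  proof -
    have "((\<lambda>e. ((norm (q e (x + y)))\<^sup>2 + - (norm (q e x))\<^sup>2 + - (norm (q e y))\<^sup>2) / 2)
        has_sum ((norm (x + y))\<^sup>2 + - (norm x)\<^sup>2 + - (norm y)\<^sup>2) / 2) B"
      unfolding divide_inverse
      by (intro has_sum_cmult_left has_sum_add has_sum_uminusI norm)
    then show ?thesis
      by (simp add: Re_cinner_polar add)
  qed
  have *: "complex_of_real (Re z) + \<i> * complex_of_real (Re (- \<i> * z)) = z" for z
    by (simp add: complex_eq_iff)
  have "((\<lambda>e. complex_of_real (Re (cinner (q e x) (q e y))) + 
      \<i> * complex_of_real (Re (cinner (q e ((- \<i>) *\<^sub>C x)) (q e y)))) has_sum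
      complex_of_real (Re (cinner x y)) + \<i> * complex_of_real (Re (cinner ((- \<i>) *\<^sub>C x) y))) B"
    by (intro has_sum_add has_sum_cmult_right has_sum_of_real Re)
  then show ?thesis
    by (simp only: scale cinner_scaleC_left *)
qed

lemma hs_cinner_has_sum:
  "is_onb B \<Longrightarrow> ((\<lambda>e. cinner (hs_op x \<cdot> e) (hs_op y \<cdot> e)) has_sum cinner x y) B"
  by (rule has_sum_polarize[where q = "\<lambda>e x. hs_op x \<cdot> e"]) (simp_all add: hs_norm_has_sum)

lemma cinner_has_sum:
  fixes x y :: "'a::chilbert_space"
  assumes B: "is_onb B"
  shows "((\<lambda>e. cinner x e * cinner e y) has_sum cinner x y) B"
proof -
  have unit: "cinner e e = 1" "norm e = 1" if "e \<in> B" for e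
    using B that by (auto simp: is_onb_def orthonormal_def cinner.ip_self)
  \<comment> \<open>The coordinate \<open>cinner x e\<close> is encoded as a multiple of
    \<open>e\<close>, since \<open>has_sum_polarize\<close> wants values in an inner product space;
    unit vectors keep its modulus.\<close>
  let ?q = "\<lambda>e x. cinner x e *\<^sub>C (if e \<in> B then e else 0)"
  have "((\<lambda>e. cinner (?q e x) (?q e y)) has_sum cinner x y) B"
  proof (rule has_sum_polarize[where q = ?q])
    show "((\<lambda>e. (norm (?q e x))\<^sup>2) has_sum (norm x)\<^sup>2) B" for x
      using Parseval[OF B, of x] by (rule has_sum_cong[THEN iffD1, rotated]) (simp add: norm_scaleC unit)
  qed (auto simp: cinner_add_left scaleC_add_left cinner_scaleC_left scaleC_scaleC)
  then show ?thesis
    by (rule has_sum_cong[THEN iffD1, rotated])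
      (simp add: cinner_scaleC_left cinner.ip_scaleC_right unit flip: cinner_commute)
qed

text \<open>The trace of \<open>A \<circ>\<^sub>B (X \<circ>\<^sub>B Y)\<close> is the
  Hilbert-Schmidt inner product of \<open>A \<circ>\<^sub>B X\<close> with \<open>adj Y\<close>,
  which can be computed from the columns in any basis. This frees the pairing from
  \<open>some_onb\<close>.\<close>

lemma pairing_has_sum:
  assumes "is_onb B" "hilbert_schmidt X" "hilbert_schmidt Y"
  shows "((\<lambda>e. cinner (A \<cdot> X \<cdot> e) (adj Y \<cdot> e)) has_sum pairing A (X \<circ>\<^sub>B Y)) B"
proof -
  have "pairing A (X \<circ>\<^sub>B Y) = cinner (Abs_hs (A \<circ>\<^sub>B X)) (Abs_hs (adj Y))"
    using assms by (simp add: pairing_def cinner_hs_def Abs_hs_inverse hs_comp_left bop_comp_algebra)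
  then show ?thesis
    using hs_cinner_has_sum[OF assms(1), of "Abs_hs (A \<circ>\<^sub>B X)" "Abs_hs (adj Y)"] assms
    by (simp add: Abs_hs_inverse hs_comp_left)
qed

text \<open>With a factorization \<open>X \<circ>\<^sub>B Y\<close>, take
  \<open>\<xi> e = X \<cdot> e\<close> and \<open>\<eta> e = adj Y \<cdot> e\<close>: the pairing
  becomes an absolutely convergent series of vector functionals.\<close>

lemma trace_class_expansion:
  fixes T :: "'a::chilbert_space bop"
  assumes "trace_class T"
  obtains \<xi> \<eta> where "(\<lambda>e. norm (\<xi> e) * norm (\<eta> e)) summable_on (some_onb :: 'a set)"
    and "\<And>A. ((\<lambda>e. cinner (A \<cdot> \<xi> e) (\<eta> e)) has_sum pairing A T) (some_onb :: 'a set)"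
proof -
  obtain X Y where XY: "hilbert_schmidt X" "hilbert_schmidt Y" "T = X \<circ>\<^sub>B Y"
    using assms by (auto simp: trace_class_def)
  have "(\<lambda>e. norm (X \<cdot> e) * norm (adj Y \<cdot> e)) summable_on some_onb"
  proof (rule summable_on_le)
    show "(\<lambda>e. (norm (X \<cdot> e))\<^sup>2 + (norm (adj Y \<cdot> e))\<^sup>2) summable_on some_onb"
      using XY hs_adj[of Y] by (intro summable_on_add) (simp_all add: hs_iff[OF is_onb_some_onb])
    have "a * b \<le> a\<^sup>2 + b\<^sup>2" if "0 \<le> a" "0 \<le> b" for a b :: real
    proof -
      have "0 \<le> (a - b)\<^sup>2" "0 \<le> a * b" using that by simp_all
      then show ?thesis unfolding power2_diff by linarith
    qed
    then show "norm (X \<cdot> e) * norm (adj Y \<cdot> e) \<le> (norm (X \<cdot> e))\<^sup>2 + (norm (adj Y \<cdot> e))\<^sup>2" for e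
      by simp
  qed simp
  with pairing_has_sum[OF is_onb_some_onb XY(1,2)] show ?thesis
    using that[of "bop_app X" "bop_app (adj Y)"] by (simp add: XY(3))
qed

lemma bounded_functional_pairing:
  assumes "trace_class T"
  shows "bounded_functional (\<lambda>A. pairing A T)"
proof -
  obtain \<xi> \<eta> where sm: "(\<lambda>e. norm (\<xi> e) * norm (\<eta> e)) summable_on (some_onb :: 'a set)"
    and p: "\<And>A. ((\<lambda>e. cinner (A \<cdot> \<xi> e) (\<eta> e)) has_sum pairing A T) (some_onb :: 'a set)"
    using trace_class_expansion[OF assms] by blast
  have "pairing (A + B) T = pairing A T + pairing B T" for A B
    by (rule has_sum_unique[OF p]) (use has_sum_add[OF p[of A] p[of B]] in \<open>simp add: cinner_add_left\<close>)
  moreover have "pairing (c *\<^sub>C A) T = c * pairing A T" for c A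
    by (rule has_sum_unique[OF p]) (use has_sum_cmult_right[OF p[of A], of c] in \<open>simp add: cinner_scaleC_left\<close>)
  moreover have "cmod (pairing A T) \<le> infsum (\<lambda>e. norm (\<xi> e) * norm (\<eta> e)) some_onb * K"
    if "bounded_by K A" for A K
  proof -
    have "((\<lambda>e. norm (\<xi> e) * norm (\<eta> e) * K) has_sum infsum (\<lambda>e. norm (\<xi> e) * norm (\<eta> e)) some_onb * K) some_onb"
      by (intro has_sum_cmult_left has_sum_infsum sm)
    then show ?thesis
    proof (rule norm_infsum_le[OF p])
      show "norm (cinner (A \<cdot> \<xi> e) (\<eta> e)) \<le> norm (\<xi> e) * norm (\<eta> e) * K" for e
        using cinner_bounded_by[OF that, of "\<xi> e" "\<eta> e"] by (simp add: mult.commute mult.left_commute)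
    qed
  qed
  ultimately show ?thesis
    unfolding bounded_functional_def by blast
qed

text \<open>Dominated convergence: the common bound \<open>K\<close> provides a summable majorant of
  the series from \<open>trace_class_expansion\<close>, uniformly in \<open>n\<close>. So bounded
  weak operator convergence implies sigma-weak convergence.\<close>

lemma pairing_tendsto:
  fixes A :: "nat \<Rightarrow> 'a::chilbert_space bop"
  assumes T: "trace_class T" and A: "\<And>n. bounded_by K (A n)"
    and lim: "\<And>x y. (\<lambda>n. cinner (A n \<cdot> x) y) \<longlonglongrightarrow> cinner (A' \<cdot> x) y"
  shows "(\<lambda>n. pairing (A n) T) \<longlonglongrightarrow> pairing A' T"
proof -
  obtain \<xi> \<eta> where sm: "(\<lambda>e. norm (\<xi> e) * norm (\<eta> e)) summable_on (some_onb :: 'a set)"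
    and p: "\<And>A. ((\<lambda>e. cinner (A \<cdot> \<xi> e) (\<eta> e)) has_sum pairing A T) (some_onb :: 'a set)"
    using trace_class_expansion[OF T] by blast
  let ?f = "\<lambda>e n. cinner (A n \<cdot> \<xi> e) (\<eta> e)"
  have "uniform_limit UNIV (\<lambda>F n. \<Sum>e\<in>F. ?f e n) (\<lambda>n. pairing (A n) T) (finite_subsets_at_top some_onb)"
  proof (rule Weierstrass_m_test_general'[where M = "\<lambda>e. norm (\<xi> e) * norm (\<eta> e) * K"])
    show "norm (?f e n) \<le> norm (\<xi> e) * norm (\<eta> e) * K" for e n
      using cinner_bounded_by[OF A, of n "\<xi> e" "\<eta> e"] by (simp add: mult.commute mult.left_commute)
  qed (use p sm in \<open>auto intro: summable_on_cmult_left\<close>)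
  then show ?thesis
  proof (rule swap_uniform_limit'[rotated 2])
    show "\<forall>\<^sub>F F in finite_subsets_at_top some_onb.
        ((\<lambda>n. \<Sum>e\<in>F. ?f e n) \<longlongrightarrow> (\<Sum>e\<in>F. cinner (A' \<cdot> \<xi> e) (\<eta> e))) sequentially"
      by (intro always_eventually allI tendsto_sum lim)
    show "((\<lambda>F. \<Sum>e\<in>F. cinner (A' \<cdot> \<xi> e) (\<eta> e)) \<longlongrightarrow> pairing A' T) (finite_subsets_at_top some_onb)"
      using p[of A'] by (simp add: has_sum_def)
  qed simp_all
qed

section \<open>Rank one operators in the trace pairing\<close>

lemma cmod_cinner_commute: "cmod (cinner x y) = cmod (cinner y (x::'a::complex_inner))"
  by (metis cinner_commute complex_mod_cnj)

lemma hilbert_schmidt_rank_one [simp]: "hilbert_schmidt (x \<boxtimes> (y::'a::chilbert_space))"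
proof -
  have "(\<lambda>e. (cmod (cinner y e))\<^sup>2 * (norm x)\<^sup>2) summable_on some_onb"
    using Parseval[OF is_onb_some_onb, of y]
    by (intro summable_on_cmult_left) (rule has_sum_imp_summable)
  then show ?thesis
    unfolding hs_iff[OF is_onb_some_onb]
    by (simp add: norm_scaleC power_mult_distrib cmod_cinner_commute[of y])
qed

lemma rank_one_factor: "norm u = 1 \<Longrightarrow> x \<boxtimes> y = (x \<boxtimes> u) \<circ>\<^sub>B (u \<boxtimes> (y::'a::chilbert_space))"
  by (rule bop_eqI) (simp add: cinner.ip_self cinner_scaleC_left)

lemma trace_class_rank_one [simp]: "trace_class (x \<boxtimes> (y::'a::chilbert_space))"
proof (cases "y = 0")
  \<comment> \<open>The factorization needs a unit vector, and the space may be zero;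
    \<open>sgn y\<close> provides one only for \<open>y \<noteq> 0\<close>.\<close>
  case True
  then have "x \<boxtimes> y = (0 \<boxtimes> y) \<circ>\<^sub>B (0 \<boxtimes> y)" by (intro bop_eqI) simp
  then show ?thesis unfolding trace_class_def by (metis hilbert_schmidt_rank_one)
next
  case False
  then show ?thesis
    using rank_one_factor[of "sgn y" x y] unfolding trace_class_def
    by (metis hilbert_schmidt_rank_one norm_sgn)
qed

lemma pairing_rank_one_right: "pairing A (x \<boxtimes> y) = cinner (A \<cdot> x) (y::'a::chilbert_space)"
  using infsumI[OF cinner_has_sum[OF is_onb_some_onb, of "A \<cdot> x" y]]
  by (simp add: pairing_def ctrace_def comp_rank_one cinner_scaleC_left mult.commute)

text \<open>A case of cyclicity of the trace: for \<open>T = X \<circ>\<^sub>B Y\<close> the series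
  is Parseval's for the vectors \<open>Y \<cdot> x\<close> and
  \<open>adj X \<cdot> y\<close>.\<close>

lemma pairing_rank_one_left:
  assumes "trace_class T"
  shows "pairing (x \<boxtimes> y) T = cinner (T \<cdot> x) y"
proof -
  obtain X Y where XY: "hilbert_schmidt X" "hilbert_schmidt Y" "T = X \<circ>\<^sub>B Y"
    using assms by (auto simp: trace_class_def)
  have "cinner ((x \<boxtimes> y) \<cdot> X \<cdot> e) (adj Y \<cdot> e) = cinner (Y \<cdot> x) e * cinner e (adj X \<cdot> y)" for e
    by (simp add: cinner_scaleC_left cinner_adj_right bop_scaleC mult.commute)
  then show ?thesis
    using pairing_has_sum[OF is_onb_some_onb XY(1,2), of "x \<boxtimes> y"]
      cinner_has_sum[OF is_onb_some_onb, of "Y \<cdot> x" "adj X \<cdot> y"]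
    by (simp add: has_sum_unique XY(3) cinner_adj_right)
qed

lemma pairing_ext:
  assumes "trace_class S" "trace_class T" "\<And>x y. pairing (x \<boxtimes> y) S = pairing (x \<boxtimes> y) T"
  shows "S = T"
  using assms by (intro bop_eqI cinner_ext) (simp add: pairing_rank_one_left)

section \<open>Singular value decomposition\<close>

lemma bounded_linear_scaleC: "bounded_linear ((*\<^sub>C) c :: 'a::complex_inner \<Rightarrow> 'a)"
  by (rule bounded_linear_intro[where K = "cmod c"])
    (auto simp: scaleC_add_right scaleR_scaleC scaleC_scaleC norm_scaleC mult_ac)

lemma onb_sum:
  assumes "is_onb B" "finite B"
  shows "x = (\<Sum>e\<in>B. cinner x e *\<^sub>C (e::'a::chilbert_space))"
proof -
  have B: "orthonormal B" using assms by (simp add: is_onb_def)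
  have "\<forall>f\<in>B. cinner (x - (\<Sum>e\<in>B. cinner x e *\<^sub>C e)) f = 0"
    using cinner_orthonormal_sum[OF B assms(2) order_refl] by (simp add: cinner.ip_diff_left)
  then have "x - (\<Sum>e\<in>B. cinner x e *\<^sub>C e) = 0"
    using assms(1) unfolding is_onb_def by blast
  then show ?thesis by (rule right_minus_eq[THEN iffD1])
qed

text \<open>Keep finitely many basis vectors, leaving less than \<open>\<epsilon>\<^sup>2\<close> of
  the squared Hilbert-Schmidt norm. The Hilbert-Schmidt norm of the remainder dominates its operator
  norm.\<close>

lemma hilbert_schmidt_approx:
  fixes S :: "'a::chilbert_space bop"
  assumes S: "hilbert_schmidt S" and \<epsilon>: "0 < \<epsilon>"
  shows "\<exists>F. finite F \<and> orthonormal F \<and> (\<forall>v. norm (S \<cdot> v - (\<Sum>e\<in>F. cinner v e *\<^sub>C (S \<cdot> e))) \<le> norm v * \<epsilon>)"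
proof -
  let ?B = "some_onb :: 'a set"
  have B: "is_onb ?B" "orthonormal ?B" using is_onb_some_onb by (auto simp: is_onb_def)
  let ?g = "\<lambda>e. (norm (S \<cdot> e))\<^sup>2"
  have sm: "?g summable_on ?B" using S hs_iff[OF B(1)] by simp
  have "(sum ?g \<longlongrightarrow> infsum ?g ?B) (finite_subsets_at_top ?B)"
    using has_sum_infsum[OF sm] by (simp add: has_sum_def)
  then have "\<forall>\<^sub>F F in finite_subsets_at_top ?B. dist (sum ?g F) (infsum ?g ?B) < \<epsilon>\<^sup>2"
    using \<epsilon> by (intro tendstoD) auto
  then obtain F where F: "finite F" "F \<subseteq> ?B" "dist (sum ?g F) (infsum ?g ?B) < \<epsilon>\<^sup>2"
    by (auto simp: eventually_finite_subsets_at_top)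
  define R where "R = S - (\<Sum>e\<in>F. (S \<cdot> e) \<boxtimes> e)"
  have hs_sum: "hilbert_schmidt (\<Sum>e\<in>F. (S \<cdot> e) \<boxtimes> e)"
    by (induction F rule: infinite_finite_induct) (auto simp: hs_zero hs_add)
  obtain x where x: "hs_op x = R"
    using hs_diff[OF S hs_sum] by (metis R_def Abs_hs_inverse mem_Collect_eq)
  have R: "R \<cdot> e = (if e \<in> F then 0 else S \<cdot> e)" if e: "e \<in> ?B" for e
  proof -
    have "(\<Sum>f\<in>F. cinner e f *\<^sub>C S \<cdot> f) = (\<Sum>f\<in>F. if f = e then S \<cdot> e else 0)"
      using F e by (intro sum.cong refl) (auto simp: orthonormal_cinner[OF B(2)] subset_iff scaleC_one)
    then show ?thesis using F by (simp add: R_def bop_sum_app)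
  qed
  have "(?g has_sum (infsum ?g ?B - sum ?g F)) (?B - F)"
    by (intro has_sum_Diff has_sum_infsum sm has_sum_finite F)
  then have "((\<lambda>e. (norm (R \<cdot> e))\<^sup>2) has_sum (infsum ?g ?B - sum ?g F)) ?B"
    by (rule has_sum_cong_neutral[THEN iffD1, rotated -1]) (auto simp: R)
  then have "(norm x)\<^sup>2 = infsum ?g ?B - sum ?g F"
    using hs_norm_has_sum[OF B(1), of x] by (simp add: has_sum_unique x)
  then have "(norm x)\<^sup>2 \<le> \<epsilon>\<^sup>2" using F(3) by (simp add: dist_real_def)
  then have "norm x \<le> \<epsilon>" by (rule power2_le_imp_le) (use \<epsilon> in simp)
  then have "norm (R \<cdot> v) \<le> norm v * \<epsilon>" for v
    using order_trans[OF norm_hs_op_le[of x v] mult_left_mono[OF _ norm_ge_zero]] by (simp add: x)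
  moreover have "orthonormal F" using B(2) F(2) by (auto simp: orthonormal_def)
  ultimately show ?thesis
    using F(1) by (intro exI[of _ F]) (simp add: R_def bop_sum_app)
qed

text \<open>A finite Minkowski sum of images of the unit disc; it stands in for a bounded closed set
  in finite dimensions.\<close>

lemma compact_bounded_combinations:
  fixes w :: "'b \<Rightarrow> 'a::complex_inner"
  assumes "finite F"
  shows "compact {\<Sum>e\<in>F. c e *\<^sub>C w e | c. \<forall>e\<in>F. cmod (c e) \<le> 1}"
  using assms
proof (induction F)
  case (insert f F)
  have "continuous_on (cball 0 1) (\<lambda>c::complex. c *\<^sub>C w f)"
  proof (rule linear_continuous_on, rule bounded_linear_intro)
    show "norm (c *\<^sub>C w f) \<le> norm c * norm (w f)" for c by (simp add: norm_scaleC)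
  qed (simp_all add: scaleC_add_left scaleR_scaleC scaleC_scaleC scaleR_conv_of_real)
  then have "compact ((\<lambda>c::complex. c *\<^sub>C w f) ` cball 0 1)"
    by (intro compact_continuous_image compact_cball)
  from compact_sums[OF this insert.IH]
  have "compact {x + y |x y. x \<in> (\<lambda>c::complex. c *\<^sub>C w f) ` cball 0 1 \<and>
      y \<in> {\<Sum>e\<in>F. c e *\<^sub>C w e | c. \<forall>e\<in>F. cmod (c e) \<le> 1}}" .
  also have "{x + y |x y. x \<in> (\<lambda>c::complex. c *\<^sub>C w f) ` cball 0 1 \<and>
      y \<in> {\<Sum>e\<in>F. c e *\<^sub>C w e | c. \<forall>e\<in>F. cmod (c e) \<le> 1}} =
      {\<Sum>e\<in>insert f F. c e *\<^sub>C w e | c. \<forall>e\<in>insert f F. cmod (c e) \<le> 1}" (is "?L = ?R")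
  proof
    show "?L \<subseteq> ?R"
    proof clarify
      fix d :: complex and c assume d: "d \<in> cball 0 1" and c: "\<forall>e\<in>F. cmod (c e) \<le> 1"
      have "(\<Sum>e\<in>F. (if e = f then d else c e) *\<^sub>C w e) = (\<Sum>e\<in>F. c e *\<^sub>C w e)"
        using insert.hyps by (intro sum.cong) auto
      then show "\<exists>c'. d *\<^sub>C w f + (\<Sum>e\<in>F. c e *\<^sub>C w e) = (\<Sum>e\<in>insert f F. c' e *\<^sub>C w e) \<and>
          (\<forall>e\<in>insert f F. cmod (c' e) \<le> 1)"
        using insert.hyps d c by (intro exI[of _ "\<lambda>e. if e = f then d else c e"]) auto
    qed
    show "?R \<subseteq> ?L"
    proof clarify
      fix c assume c: "\<forall>e\<in>insert f F. cmod (c e) \<le> 1"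
      then show "\<exists>x y. (\<Sum>e\<in>insert f F. c e *\<^sub>C w e) = x + y \<and>
          x \<in> (\<lambda>c. c *\<^sub>C w f) ` cball 0 1 \<and>
          y \<in> {\<Sum>e\<in>F. c e *\<^sub>C w e |c. \<forall>e\<in>F. cmod (c e) \<le> 1}"
        using insert.hyps
        by (intro exI[of _ "c f *\<^sub>C w f"] exI[of _ "\<Sum>e\<in>F. c e *\<^sub>C w e"]) auto
    qed
  qed
  finally show ?case .
qed simp

text \<open>By \<open>hilbert_schmidt_approx\<close> the image of the unit ball lies within
  \<open>\<epsilon> / 3\<close> of a compact set, so it is totally bounded and its closure is
  compact.\<close>

lemma hilbert_schmidt_compact:
  fixes S :: "'a::chilbert_space bop"
  assumes S: "hilbert_schmidt S" and v: "\<And>n. norm (v n) \<le> 1"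
  shows "\<exists>l r. strict_mono (r::nat \<Rightarrow> nat) \<and> (\<lambda>n. S \<cdot> v (r n)) \<longlonglongrightarrow> l"
proof -
  define A where "A = bop_app S ` cball 0 1"
  have "\<exists>k. finite k \<and> closure A \<subseteq> (\<Union>x\<in>k. ball x \<epsilon>)" if \<epsilon>: "\<epsilon> > 0" for \<epsilon>
  proof -
    obtain F where F: "finite F" "orthonormal F"
      "\<And>v. norm (S \<cdot> v - (\<Sum>e\<in>F. cinner v e *\<^sub>C (S \<cdot> e))) \<le> norm v * (\<epsilon> / 3)"
      using hilbert_schmidt_approx[OF S, of "\<epsilon> / 3"] \<epsilon> by auto
    let ?C = "{\<Sum>e\<in>F. c e *\<^sub>C (S \<cdot> e) | c. \<forall>e\<in>F. cmod (c e) \<le> 1}"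
    have "compact ?C" by (rule compact_bounded_combinations) fact
    then obtain k where k: "finite k" "?C \<subseteq> (\<Union>x\<in>k. ball x (\<epsilon> / 3))"
      unfolding compact_eq_totally_bounded using \<epsilon> by (meson divide_pos_pos zero_less_numeral)
    \<comment> \<open>Closed balls of radius \<open>2 * \<epsilon> / 3\<close> survive passing to
      the closure of \<open>A\<close> and still fit into open balls of radius
      \<open>\<epsilon>\<close>.\<close>
    have "A \<subseteq> (\<Union>x\<in>k. cball x (2 * \<epsilon> / 3))"
    proof
      fix y assume "y \<in> A"
      then obtain v where v: "norm v \<le> 1" "y = S \<cdot> v" by (auto simp: A_def)
      let ?z = "\<Sum>e\<in>F. cinner v e *\<^sub>C (S \<cdot> e)"
      have "cmod (cinner v e) \<le> 1" if "e \<in> F" for e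
      proof -
        have "cmod (cinner v e) \<le> norm v * norm e" by (rule cinner.Cauchy_Schwarz)
        then show ?thesis using F(2) that v(1) by (simp add: orthonormal_def)
      qed
      then have "?z \<in> ?C" by blast
      then obtain x where x: "x \<in> k" "dist x ?z < \<epsilon> / 3" using k(2) by auto
      have "dist y ?z \<le> norm v * (\<epsilon> / 3)" using F(3)[of v] by (simp add: v(2) dist_norm)
      also have "\<dots> \<le> \<epsilon> / 3" using v(1) \<epsilon> by (intro mult_left_le_one_le) auto
      finally have "dist x y \<le> 2 * \<epsilon> / 3"
        using x(2) dist_triangle2[of x y ?z] by simp
      then show "y \<in> (\<Union>x\<in>k. cball x (2 * \<epsilon> / 3))" using x(1) by auto
    qed
    then have "closure A \<subseteq> (\<Union>x\<in>k. cball x (2 * \<epsilon> / 3))"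
      using k(1) by (intro closure_minimal closed_UN) auto
    also have "\<dots> \<subseteq> (\<Union>x\<in>k. ball x \<epsilon>)"
      using \<epsilon> by (intro UN_mono) auto
    finally show ?thesis using k(1) by blast
  qed
  then have "compact (closure A)"
    by (simp add: compact_eq_totally_bounded complete_eq_closed)
  moreover have "S \<cdot> v n \<in> closure A" for n
    using v[of n] closure_subset[of A] by (auto simp: A_def)
  ultimately obtain l r where "strict_mono r" "((\<lambda>n. S \<cdot> v n) \<circ> r) \<longlonglongrightarrow> l"
    using compact_def[THEN iffD1, rule_format, of "closure A" "\<lambda>n. S \<cdot> v n"] by blast
  then show ?thesis
    by (intro exI[of _ l] exI[of _ r]) (simp add: comp_def)
qed

text \<open>The new eigenvector is the limit of a maximizing sequence of \<open>norm (S \<cdot> v)\<close> on the unit ball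
  of the invariant subspace \<open>M\<close>; compactness of \<open>S\<close> makes the sequence converge.\<close>

lemma ex_singular_vector:
  fixes S :: "'a::chilbert_space bop"
  assumes S: "hilbert_schmidt S"
    and M: "\<And>x y. x \<in> M \<Longrightarrow> y \<in> M \<Longrightarrow> x + y \<in> M" "\<And>c x. x \<in> M \<Longrightarrow> c *\<^sub>C x \<in> M" "closed M"
    and inv: "\<And>x. x \<in> M \<Longrightarrow> adj S \<cdot> S \<cdot> x \<in> M"
    and x: "x \<in> M" "x \<noteq> 0"
  shows "\<exists>u\<in>M. norm u = 1 \<and> (\<exists>c. adj S \<cdot> S \<cdot> u = c *\<^sub>C u)"
proof -
  let ?n = "\<lambda>v. complex_of_real (inverse (norm v)) *\<^sub>C v"
  have normalize: "\<exists>u\<in>M. norm u = 1 \<and> (\<exists>c. adj S \<cdot> S \<cdot> u = c *\<^sub>C u)"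
    if "v \<in> M" "v \<noteq> 0" "adj S \<cdot> S \<cdot> v = c *\<^sub>C v" for v c
    using that M by (intro bexI[of _ "?n v"])
      (auto simp: norm_scaleC norm_inverse bop_scaleC scaleC_scaleC mult.commute)
  show ?thesis
  proof (cases "\<forall>v\<in>M. S \<cdot> v = 0")
    case True
    then show ?thesis using normalize[OF x, of 0] x by simp
  next
    case False
    then obtain v0 where v0: "v0 \<in> M" "S \<cdot> v0 \<noteq> 0" by blast
    define U where "U = {v \<in> M. norm v \<le> 1}"
    define s where "s = Sup ((\<lambda>v. norm (S \<cdot> v)) ` U)"
    obtain K where K: "bounded_by K S" using ex_bounded_by by blast
    have bdd: "bdd_above ((\<lambda>v. norm (S \<cdot> v)) ` U)"
    proof (rule bdd_aboveI2)
      fix v assume "v \<in> U"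
      then show "norm (S \<cdot> v) \<le> K"
        using bounded_byD[OF K, of v] bounded_by_nonneg[OF K] mult_left_le[of "norm v" K]
        by (auto simp: U_def)
    qed
    have s_le1: "norm (S \<cdot> v) \<le> s" if "v \<in> U" for v
      unfolding s_def using that bdd by (rule cSUP_upper)
    have s_le: "norm (S \<cdot> v) \<le> s * norm v" if "v \<in> M" for v
    proof (cases "v = 0")
      case False
      then have "norm (S \<cdot> ?n v) \<le> s"
        using that M by (intro s_le1) (auto simp: U_def norm_scaleC norm_inverse)
      moreover have "norm (S \<cdot> ?n v) = norm (S \<cdot> v) / norm v"
        by (simp add: bop_scaleC norm_scaleC norm_inverse divide_inverse mult.commute)
      ultimately show ?thesis using False by (simp add: pos_divide_le_eq)
    qed simp
    have s_pos: "s > 0"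
    proof -
      have "0 < norm (S \<cdot> v0)" using v0 by simp
      also have "\<dots> \<le> s * norm v0" by (rule s_le) fact
      finally show ?thesis by (metis norm_ge_zero not_less zero_less_mult_iff)
    qed
    have "U \<noteq> {}" using M(2)[OF x(1), of 0] by (auto simp: U_def intro!: exI[of _ 0])
    then have "\<exists>v\<in>U. s - inverse (real (Suc n)) < norm (S \<cdot> v)" for n
      using less_cSUP_iff[OF _ bdd, of "s - inverse (real (Suc n))"] by (simp add: s_def)
    then obtain v where v: "\<And>n. v n \<in> U" "\<And>n. s - inverse (real (Suc n)) < norm (S \<cdot> v n)"
      by metis
    have "norm (v n) \<le> 1" for n using v(1)[of n] by (simp add: U_def)
    then obtain l r where r: "strict_mono r" "(\<lambda>n. S \<cdot> v (r n)) \<longlonglongrightarrow> l"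
      using hilbert_schmidt_compact[OF S, of v] by blast
    have lim_s: "(\<lambda>n. norm (S \<cdot> v n)) \<longlonglongrightarrow> s"
    proof (rule tendsto_sandwich)
      show "(\<lambda>n. s - inverse (real (Suc n))) \<longlonglongrightarrow> s"
        using tendsto_diff[OF tendsto_const LIMSEQ_inverse_real_of_nat, of s] by simp
      show "(\<lambda>n. s) \<longlonglongrightarrow> s" by simp
    qed (use v s_le1 in \<open>auto intro!: always_eventually simp: less_imp_le\<close>)
    let ?N = "\<lambda>v. adj S \<cdot> S \<cdot> v" and ?s2 = "complex_of_real (s\<^sup>2)"
    \<comment> \<open>In the expanded square, invariance of \<open>M\<close> bounds
      \<open>(norm (?N u))\<^sup>2\<close> by
      \<open>s\<^sup>2 * (norm (S \<cdot> u))\<^sup>2\<close>, and the cross term is minus twice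
      this bound. A maximizing sequence thus consists of approximate eigenvectors.\<close>
    have key: "(norm (?N u - ?s2 *\<^sub>C u))\<^sup>2 \<le> s\<^sup>2 * (s\<^sup>2 - (norm (S \<cdot> u))\<^sup>2)" if u: "u \<in> U" for u
    proof -
      have uM: "u \<in> M" "norm u \<le> 1" using u by (auto simp: U_def)
      have "norm (?N u) \<le> norm (S \<cdot> u) * s"
      proof (rule norm_le_if_cinner_le)
        have "cmod (cinner (?N u) (?N u)) = cmod (cinner (S \<cdot> u) (S \<cdot> ?N u))"
          by (simp add: cinner_adj_left)
        also have "\<dots> \<le> norm (S \<cdot> u) * norm (S \<cdot> ?N u)" by (rule cinner.Cauchy_Schwarz)
        also have "\<dots> \<le> norm (S \<cdot> u) * (s * norm (?N u))"
          by (intro mult_left_mono s_le inv uM) simp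
        finally show "cmod (cinner (?N u) (?N u)) \<le> norm (S \<cdot> u) * s * norm (?N u)" by simp
      qed (use s_pos in simp)
      then have 1: "(norm (?N u))\<^sup>2 \<le> (norm (S \<cdot> u))\<^sup>2 * s\<^sup>2"
        using power_mono[of "norm (?N u)" "norm (S \<cdot> u) * s" 2] by (simp add: power_mult_distrib)
      have 2: "(norm (?s2 *\<^sub>C u))\<^sup>2 \<le> s\<^sup>2 * s\<^sup>2"
      proof -
        have "(norm u)\<^sup>2 \<le> 1" using uM(2) by (simp add: power_le_one)
        then have "(s\<^sup>2 * s\<^sup>2) * (norm u)\<^sup>2 \<le> s\<^sup>2 * s\<^sup>2" by (intro mult_left_le) auto
        then show ?thesis by (simp only: norm_scaleC norm_of_real abs_power2 power_mult_distrib power2_eq_square[of "s\<^sup>2"])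
      qed
      have 3: "Re (cinner (?N u) (- (?s2 *\<^sub>C u))) = - (s\<^sup>2 * (norm (S \<cdot> u))\<^sup>2)"
      proof -
        have "cinner (?N u) (- (?s2 *\<^sub>C u)) = - (?s2 * complex_of_real ((norm (S \<cdot> u))\<^sup>2))"
          by (simp only: cinner.ip_minus_right cinner.ip_scaleC_right cinner_adj_left cinner.ip_self
              complex_cnj_complex_of_real)
        then show ?thesis by (simp only: flip: of_real_mult of_real_minus) simp
      qed
      show ?thesis
        using cinner.nrm_add_square[of "?N u" "- (?s2 *\<^sub>C u)"] 1 2 3 by (simp add: algebra_simps)
    qed
    have "(\<lambda>n. norm (?N (v (r n)) - ?s2 *\<^sub>C v (r n))) \<longlonglongrightarrow> 0"
    proof -
      have "(\<lambda>n. s\<^sup>2 * (s\<^sup>2 - (norm (S \<cdot> v (r n)))\<^sup>2)) \<longlonglongrightarrow> s\<^sup>2 * (s\<^sup>2 - s\<^sup>2)"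
        using LIMSEQ_subseq_LIMSEQ[OF lim_s r(1)] by (intro tendsto_intros) (simp add: comp_def)
      then have "(\<lambda>n. s\<^sup>2 * (s\<^sup>2 - (norm (S \<cdot> v (r n)))\<^sup>2)) \<longlonglongrightarrow> 0" by simp
      then have "(\<lambda>n. (norm (?N (v (r n)) - ?s2 *\<^sub>C v (r n)))\<^sup>2) \<longlonglongrightarrow> 0"
        by (rule tendsto_sandwich[OF _ _ tendsto_const, rotated 2]) (intro always_eventually allI key v(1) zero_le_power2)+
      from tendsto_real_sqrt[OF this] show ?thesis by simp
    qed
    then have d: "(\<lambda>n. ?N (v (r n)) - ?s2 *\<^sub>C v (r n)) \<longlonglongrightarrow> 0"
      by (rule tendsto_norm_zero_cancel)
    have Nl: "(\<lambda>n. ?N (v (r n))) \<longlonglongrightarrow> adj S \<cdot> l"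
      by (rule tendsto_bop_app[OF r(2)])
    \<comment> \<open>\<open>?N (v (r n))\<close> converges by compactness and differs from
      \<open>?s2 *\<^sub>C v (r n)\<close> by a null sequence; as \<open>s > 0\<close>, the vectors
      themselves converge.\<close>
    have "(\<lambda>n. ?s2 *\<^sub>C v (r n)) \<longlonglongrightarrow> adj S \<cdot> l"
      using tendsto_diff[OF Nl d] by simp
    from bounded_linear.tendsto[OF bounded_linear_scaleC this, of "inverse ?s2"]
    have w: "(\<lambda>n. v (r n)) \<longlonglongrightarrow> inverse ?s2 *\<^sub>C (adj S \<cdot> l)" (is "_ \<longlonglongrightarrow> ?w")
      using s_pos by (simp add: scaleC_scaleC scaleC_one)
    have "?w \<in> M"
      by (rule closed_sequentially[OF M(3) _ w]) (use v(1) in \<open>simp add: U_def\<close>)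
    moreover have "norm (S \<cdot> ?w) = s"
      using LIMSEQ_unique[OF tendsto_norm[OF tendsto_bop_app[OF w]] LIMSEQ_subseq_LIMSEQ[OF lim_s r(1), unfolded comp_def]]
      by simp
    then have "?w \<noteq> 0" using s_pos by auto
    moreover have "?N ?w = ?s2 *\<^sub>C ?w"
    proof -
      have "(\<lambda>n. ?N (v (r n)) - ?s2 *\<^sub>C v (r n)) \<longlonglongrightarrow> ?N ?w - ?s2 *\<^sub>C ?w"
        by (intro tendsto_diff tendsto_bop_app bounded_linear.tendsto[OF bounded_linear_scaleC] w)
      then have "0 = ?N ?w - ?s2 *\<^sub>C ?w" by (rule LIMSEQ_unique[OF d])
      from this[symmetric] show ?thesis by (rule right_minus_eq[THEN iffD1])
    qed
    ultimately show ?thesis by (rule normalize)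
  qed
qed

text \<open>Zorn gives a maximal orthonormal set of eigenvectors of
  \<open>adj S \<circ>\<^sub>B S\<close>. Its orthogonal complement is closed and invariant, so a
  nonzero vector there would yield one more eigenvector. Images stay orthogonal since
  \<open>cinner (S \<cdot> e) (S \<cdot> f)\<close> equals
  \<open>cinner e (adj S \<cdot> S \<cdot> f)\<close>.\<close>

lemma singular_value_decomposition:
  fixes S :: "'a::chilbert_space bop"
  assumes S: "hilbert_schmidt S"
  shows "\<exists>B. is_onb B \<and> (\<forall>e\<in>B. \<forall>f\<in>B. e \<noteq> f \<longrightarrow> cinner (S \<cdot> e) (S \<cdot> f) = 0)"
proof -
  let ?N = "\<lambda>v. adj S \<cdot> S \<cdot> v"
  let ?P = "{B. orthonormal B \<and> (\<forall>e\<in>B. \<exists>c. ?N e = c *\<^sub>C e)}"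
  have "\<exists>M\<in>?P. \<forall>X\<in>?P. M \<subseteq> X \<longrightarrow> X = M"
  proof (rule subset_Zorn')
    fix C assume C: "subset.chain ?P C"
    have "cinner e f = 0" if "e \<in> X" "f \<in> Y" "X \<in> C" "Y \<in> C" "e \<noteq> f" for e f X Y
    proof -
      have "X \<subseteq> Y \<or> Y \<subseteq> X" "orthonormal X" "orthonormal Y"
        using C that by (auto simp: subset_chain_def)
      then show ?thesis using that by (auto simp: orthonormal_def subset_iff)
    qed
    moreover have "norm e = 1" "\<exists>c. ?N e = c *\<^sub>C e" if "e \<in> X" "X \<in> C" for e X
      using C that by (auto simp: subset.chain_def orthonormal_def)
    ultimately show "\<Union>C \<in> ?P"
      unfolding orthonormal_def by blast
  qed
  then obtain B where "B \<in> ?P" and max: "\<forall>X\<in>?P. B \<subseteq> X \<longrightarrow> X = B"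
    by (rule bexE)
  then have B: "orthonormal B" "\<And>e. e \<in> B \<Longrightarrow> \<exists>c. ?N e = c *\<^sub>C e"
    by simp_all
  have "is_onb B"
  proof (rule ccontr)
    assume "\<not> is_onb B"
    then obtain x where x: "\<forall>e\<in>B. cinner x e = 0" "x \<noteq> 0"
      using B(1) by (auto simp: is_onb_def)
    define M where "M = {v. \<forall>e\<in>B. cinner v e = 0}"
    have "\<exists>u\<in>M. norm u = 1 \<and> (\<exists>c. ?N u = c *\<^sub>C u)"
    proof (rule ex_singular_vector[OF S])
      have "M = (\<Inter>e\<in>B. (\<lambda>v. cinner v e) -` {0})" by (auto simp: M_def)
      moreover have "closed ((\<lambda>v. cinner v e) -` {0})" for e :: 'a
        by (intro continuous_closed_vimage closed_singleton
            linear_continuous_at bounded_linear_cinner_left)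
      ultimately show "closed M" by auto
      show "?N v \<in> M" if "v \<in> M" for v
      proof -
        have "cinner (?N v) e = 0" if e: "e \<in> B" for e
        proof -
          obtain c where "?N e = c *\<^sub>C e" using B(2) e by blast
          then have "cinner v (?N e) = 0"
            using \<open>v \<in> M\<close> e by (simp add: M_def cinner.ip_scaleC_right)
          then show ?thesis by (simp add: cinner_adj_left cinner_adj_right)
        qed
        then show ?thesis by (simp add: M_def)
      qed
    qed (use x in \<open>auto simp: M_def cinner_add_left cinner_scaleC_left\<close>)
    then obtain u where u: "\<forall>e\<in>B. cinner u e = 0" "norm u = 1" "\<exists>c. ?N u = c *\<^sub>C u"
      by (auto simp: M_def)
    have u': "\<forall>e\<in>B. cinner e u = 0"
      using u(1) by (metis cinner_commute complex_cnj_zero)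
    have "insert u B \<in> ?P"
      using B u u' by (auto simp: orthonormal_def)
    then have "u \<in> B" using max by blast
    then have "cinner u u = 0" using u by blast
    then show False using u(2) by (simp add: cinner.ip_self)
  qed
  moreover have "cinner (S \<cdot> e) (S \<cdot> f) = 0" if ef: "e \<in> B" "f \<in> B" "e \<noteq> f" for e f
  proof -
    obtain c where "?N f = c *\<^sub>C f" using B(2) ef by blast
    then have "cinner e (?N f) = 0"
      using B(1) ef by (simp add: cinner.ip_scaleC_right orthonormal_def)
    then show ?thesis by (simp add: cinner_adj_right)
  qed
  ultimately show ?thesis by blast
qed

section \<open>Bounded functionals and trace class operators\<close>

text \<open>The operator is built as an adjoint: Riesz-Fischer provides the vector
  \<open>h y\<close> with coordinates \<open>cinner y (w e)\<close>, and the adjoint of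
  \<open>h\<close> sends \<open>e\<close> to \<open>w e\<close>.\<close>

lemma bop_of_square_summable:
  fixes w :: "'a::chilbert_space \<Rightarrow> 'a"
  assumes B: "is_onb B" and w: "(\<lambda>e. (norm (w e))\<^sup>2) summable_on B"
  shows "\<exists>X. hilbert_schmidt X \<and> (\<forall>e\<in>B. X \<cdot> e = w e)"
proof -
  have B': "orthonormal B" using B by (simp add: is_onb_def)
  define K where "K = infsum (\<lambda>e. (norm (w e))\<^sup>2) B"
  have le: "(cmod (cinner y (w e)))\<^sup>2 \<le> (norm y)\<^sup>2 * (norm (w e))\<^sup>2" for y e
    using power_mono[OF cinner.Cauchy_Schwarz[of y "w e"], of 2] by (simp add: power_mult_distrib)
  have hK: "((\<lambda>e. (norm y)\<^sup>2 * (norm (w e))\<^sup>2) has_sum (norm y)\<^sup>2 * K) B" for y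
    unfolding K_def by (intro has_sum_cmult_right has_sum_infsum w)
  have "\<exists>h. \<forall>e\<in>B. cinner h e = cinner y (w e)" for y
  proof -
    have "\<forall>F. finite F \<and> F \<subseteq> B \<longrightarrow> (\<Sum>e\<in>F. (cmod (cinner y (w e)))\<^sup>2) \<le> (norm y)\<^sup>2 * K"
    proof (intro allI impI)
      fix F assume F: "finite F \<and> F \<subseteq> B"
      have "(\<Sum>e\<in>F. (cmod (cinner y (w e)))\<^sup>2) \<le> (\<Sum>e\<in>F. (norm y)\<^sup>2 * (norm (w e))\<^sup>2)"
        by (intro sum_mono le)
      also have "\<dots> \<le> (norm y)\<^sup>2 * K"
        by (rule finite_sum_le_has_sum[OF hK]) (use F in auto)
      finally show "(\<Sum>e\<in>F. (cmod (cinner y (w e)))\<^sup>2) \<le> (norm y)\<^sup>2 * K" .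
    qed
    from Riesz_Fischer[OF B' this] show ?thesis by blast
  qed
  then obtain h where h: "\<And>y e. e \<in> B \<Longrightarrow> cinner (h y) e = cinner y (w e)" by metis
  have h_eq: "x = h y" if "\<And>e. e \<in> B \<Longrightarrow> cinner x e = cinner y (w e)" for x y
  proof -
    have "\<forall>e\<in>B. cinner (x - h y) e = 0" using that h by (simp add: cinner.ip_diff_left)
    then have "x - h y = 0" using B unfolding is_onb_def by blast
    then show ?thesis by simp
  qed
  have "clinear h \<and> bounded_linear h"
  proof (rule bounded_clinearI[where K = "sqrt K"])
    show "h (x + y) = h x + h y" for x y
      by (rule h_eq[symmetric]) (simp add: cinner_add_left h)
    show "h (c *\<^sub>C x) = c *\<^sub>C h x" for c x
      by (rule h_eq[symmetric]) (simp add: cinner_scaleC_left h)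
    show "norm (h y) \<le> norm y * sqrt K" for y
    proof -
      have "(norm (h y))\<^sup>2 \<le> (norm y)\<^sup>2 * K"
      proof (rule has_sum_mono[OF Parseval[OF B] hK])
        show "(cmod (cinner (h y) e))\<^sup>2 \<le> (norm y)\<^sup>2 * (norm (w e))\<^sup>2" if "e \<in> B" for e
          using le[of y e] h[OF that, of y] by simp
      qed
      from real_sqrt_le_mono[OF this] show ?thesis by (simp add: real_sqrt_mult)
    qed
  qed
  then have Z: "Abs_bop h \<cdot> y = h y" for y by (simp add: Abs_bop_inverse)
  have X: "adj (Abs_bop h) \<cdot> e = w e" if "e \<in> B" for e
  proof (rule cinner_ext)
    show "cinner (adj (Abs_bop h) \<cdot> e) z = cinner (w e) z" for z
      using h[OF that, of z] by (metis Z cinner_adj_left cinner_commute)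
  qed
  have "(\<lambda>e. (norm (adj (Abs_bop h) \<cdot> e))\<^sup>2) summable_on B"
    using w by (rule summable_on_cong[THEN iffD1, rotated]) (simp add: X)
  then show ?thesis
    using X by (intro exI[of _ "adj (Abs_bop h)"]) (simp add: hs_iff[OF B])
qed

text \<open>The image of \<open>z\<close> has coordinates \<open>cinner z (g i)\<close> along the
  orthonormal vectors \<open>E i\<close>, so its squared norm is the sum in the hypothesis.\<close>

lemma bounded_by_sum_rank_one:
  fixes E :: "'b \<Rightarrow> 'a::chilbert_space"
  assumes F: "finite F" "orthonormal (E ` F)" "inj_on E F"
    and K: "0 \<le> K" "\<And>z. (\<Sum>i\<in>F. (cmod (cinner z (g i)))\<^sup>2) \<le> (K * norm z)\<^sup>2"
  shows "bounded_by K (\<Sum>i\<in>F. E i \<boxtimes> g i)"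
proof (rule bounded_byI)
  show "norm ((\<Sum>i\<in>F. E i \<boxtimes> g i) \<cdot> z) \<le> K * norm z" for z
  proof -
    have "(\<Sum>i\<in>F. cinner z (g i) *\<^sub>C E i) = (\<Sum>e\<in>E ` F. cinner z (g (the_inv_into F E e)) *\<^sub>C e)"
      using F by (simp add: sum.reindex the_inv_into_f_f)
    then have "(norm ((\<Sum>i\<in>F. E i \<boxtimes> g i) \<cdot> z))\<^sup>2 = (\<Sum>e\<in>E ` F. (cmod (cinner z (g (the_inv_into F E e))))\<^sup>2)"
      using norm_orthonormal_sum[OF F(2) _ order_refl, of "\<lambda>e. cinner z (g (the_inv_into F E e))"] F(1)
      by (simp add: bop_sum_app)
    also have "\<dots> = (\<Sum>i\<in>F. (cmod (cinner z (g i)))\<^sup>2)"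
      using F by (simp add: sum.reindex the_inv_into_f_f)
    also have "\<dots> \<le> (K * norm z)\<^sup>2" by (rule K)
    finally show ?thesis by (rule power2_le_imp_le) (use K(1) in simp)
  qed
qed (rule K)

text \<open>Pairing \<open>f\<close> with finite sums of \<open>e \<boxtimes> (S \<cdot> e)\<close> bounds the Hilbert-Schmidt norm of \<open>S\<close>; pairing it
  with finite sums of \<open>e \<boxtimes> g e\<close>, where \<open>g e\<close> is the direction of \<open>S \<cdot> e\<close> for a basis \<open>B\<close> of singular
  vectors, bounds the sum of the singular values.\<close>

lemma trace_class_of_bounded_functional:
  fixes f :: "'a::chilbert_space bop \<Rightarrow> complex"
  assumes f: "bounded_functional f" and S: "\<And>x y. f (x \<boxtimes> y) = cinner (S \<cdot> x) y"
  shows "trace_class S"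
proof -
  obtain C where C: "C \<ge> 0" "\<And>A K. bounded_by K A \<Longrightarrow> cmod (f A) \<le> C * K"
    using bounded_functional_bound[OF f] by blast
  obtain K where K: "bounded_by K S" using ex_bounded_by by blast
  have hs: "hilbert_schmidt S"
    unfolding hs_iff[OF is_onb_some_onb]
  proof (rule nonneg_bdd_above_summable_on)
    show "bdd_above (sum (\<lambda>e. (norm (S \<cdot> e))\<^sup>2) ` {F. F \<subseteq> some_onb \<and> finite F})"
    proof (rule bdd_aboveI2, clarify)
      fix F :: "'a set" assume F: "F \<subseteq> some_onb" "finite F"
      have F': "orthonormal F"
        using is_onb_some_onb F by (auto simp: is_onb_def orthonormal_def subset_iff)
      \<comment> \<open>The sum is the projection onto the span of \<open>F\<close> after
        \<open>adj S\<close>, so its bound does not depend on \<open>F\<close>.\<close>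
      have "bounded_by K (\<Sum>e\<in>F. e \<boxtimes> (S \<cdot> e))"
      proof (rule bounded_by_sum_rank_one)
        fix z
        have "(\<Sum>e\<in>F. (cmod (cinner z (S \<cdot> e)))\<^sup>2) = (\<Sum>e\<in>F. (cmod (cinner (adj S \<cdot> z) e))\<^sup>2)"
          by (simp add: cinner_adj_left)
        also have "\<dots> \<le> (norm (adj S \<cdot> z))\<^sup>2" by (rule Bessel[OF F' F(2)]) simp
        also have "\<dots> \<le> (K * norm z)\<^sup>2"
          by (intro power_mono bounded_byD[OF bounded_by_adj[OF K]]) simp
        finally show "(\<Sum>e\<in>F. (cmod (cinner z (S \<cdot> e)))\<^sup>2) \<le> (K * norm z)\<^sup>2" .
      qed (use F F' bounded_by_nonneg[OF K] in auto)
      then have "cmod (f (\<Sum>e\<in>F. e \<boxtimes> (S \<cdot> e))) \<le> C * K" by (rule C)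
      moreover have "f (\<Sum>e\<in>F. e \<boxtimes> (S \<cdot> e)) = complex_of_real (\<Sum>e\<in>F. (norm (S \<cdot> e))\<^sup>2)"
        by (simp add: bounded_functional_sum[OF f] S cinner.ip_self)
      ultimately show "(\<Sum>e\<in>F. (norm (S \<cdot> e))\<^sup>2) \<le> C * K"
        by (metis abs_ge_self norm_of_real order_trans)
    qed
  qed simp
  obtain B where B: "is_onb B" and ortho: "\<And>e f. e \<in> B \<Longrightarrow> f \<in> B \<Longrightarrow> e \<noteq> f \<Longrightarrow> cinner (S \<cdot> e) (S \<cdot> f) = 0"
    using singular_value_decomposition[OF hs] by blast
  have B': "orthonormal B" using B by (simp add: is_onb_def)
  define s where "s e = norm (S \<cdot> e)" for e
  \<comment> \<open>Since \<open>inverse 0 = 0\<close>, \<open>g e\<close> vanishes with the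
    singular value, and the polar relation \<open>Sg\<close> holds for every
    \<open>e\<close>.\<close>
  define g where "g e = complex_of_real (inverse (s e)) *\<^sub>C (S \<cdot> e)" for e
  have Sg: "S \<cdot> e = complex_of_real (s e) *\<^sub>C g e" for e
    by (cases "s e = 0") (auto simp: g_def scaleC_scaleC scaleC_one s_def)
  have ng: "norm (g e) = (if s e = 0 then 0 else 1)" for e
    by (auto simp: g_def norm_scaleC norm_inverse s_def)
  have og: "cinner (g e) (g f) = 0" if "e \<in> B" "f \<in> B" "e \<noteq> f" for e f
    using ortho[OF that] by (simp add: g_def cinner_scaleC_left cinner.ip_scaleC_right)
  have s_sum: "s summable_on B"
  proof (rule nonneg_bdd_above_summable_on)
    show "bdd_above (sum s ` {F. F \<subseteq> B \<and> finite F})"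
    proof (rule bdd_aboveI2, clarify)
      fix F assume F: "F \<subseteq> B" "finite F"
      have F': "orthonormal F" using B' F by (auto simp: orthonormal_def subset_iff)
      have "bounded_by 1 (\<Sum>e\<in>F. e \<boxtimes> g e)"
      proof (rule bounded_by_sum_rank_one)
        fix z
        \<comment> \<open>The vectors \<open>g e\<close> with \<open>s e = 0\<close> vanish; the
          remaining ones are distinct and orthonormal, so Bessel's inequality applies to
          them.\<close>
        define G where "G = {e \<in> F. s e \<noteq> 0}"
        have G: "inj_on g G" "orthonormal (g ` G)"
        proof -
          show "inj_on g G"
          proof (rule inj_onI, rule ccontr)
            fix e e' assume *: "e \<in> G" "e' \<in> G" "g e = g e'" "e \<noteq> e'"
            then have "cinner (g e) (g e) = 0" using og[of e e'] F by (auto simp: G_def)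
            then have "norm (g e) = 0" by (simp add: cinner.ip_self)
            then show False using * ng[of e] by (simp add: G_def)
          qed
          show "orthonormal (g ` G)"
            using F ng by (auto simp: orthonormal_def G_def intro!: og)
        qed
        have "(\<Sum>e\<in>F. (cmod (cinner z (g e)))\<^sup>2) = (\<Sum>e\<in>G. (cmod (cinner z (g e)))\<^sup>2)"
          using F by (intro sum.mono_neutral_right) (auto simp: G_def g_def)
        also have "\<dots> = (\<Sum>e\<in>g ` G. (cmod (cinner z e))\<^sup>2)"
          using G by (simp add: sum.reindex)
        also have "\<dots> \<le> (norm z)\<^sup>2"
          by (rule Bessel[OF G(2)]) (use F in \<open>auto simp: G_def\<close>)
        finally show "(\<Sum>e\<in>F. (cmod (cinner z (g e)))\<^sup>2) \<le> (1 * norm z)\<^sup>2" by simp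
      qed (use F F' in auto)
      then have "cmod (f (\<Sum>e\<in>F. e \<boxtimes> g e)) \<le> C * 1" by (rule C)
      moreover have "f (\<Sum>e\<in>F. e \<boxtimes> g e) = complex_of_real (\<Sum>e\<in>F. s e)"
      proof -
        have "cinner (S \<cdot> e) (g e) = complex_of_real (s e)" for e
          by (cases "s e = 0") (auto simp: Sg cinner_scaleC_left cinner.ip_self ng)
        then show ?thesis by (simp add: bounded_functional_sum[OF f] S)
      qed
      ultimately show "sum s F \<le> C"
        by (metis abs_ge_self mult.right_neutral norm_of_real order_trans)
    qed
  qed (simp add: s_def)
  have sq: "(cmod (complex_of_real (sqrt (s e))))\<^sup>2 = s e" for e
    by (simp add: s_def)
  \<comment> \<open>Summability of \<open>s\<close> makes the roots \<open>sqrt (s e)\<close> square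
    summable. Splitting each singular value evenly between \<open>X\<close> and \<open>Y\<close>
    makes both factors Hilbert-Schmidt.\<close>
  obtain Y where Y: "hilbert_schmidt Y" "\<And>e. e \<in> B \<Longrightarrow> Y \<cdot> e = complex_of_real (sqrt (s e)) *\<^sub>C e"
  proof -
    have "(\<lambda>e. (norm (complex_of_real (sqrt (s e)) *\<^sub>C e))\<^sup>2) summable_on B"
      using s_sum by (rule summable_on_cong[THEN iffD1, rotated])
        (use B' in \<open>auto simp: norm_scaleC power_mult_distrib sq orthonormal_def simp del: norm_of_real\<close>)
    from bop_of_square_summable[OF B this] show ?thesis using that by blast
  qed
  obtain X where X: "hilbert_schmidt X" "\<And>e. e \<in> B \<Longrightarrow> X \<cdot> e = complex_of_real (sqrt (s e)) *\<^sub>C g e"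
  proof -
    have "(\<lambda>e. (norm (complex_of_real (sqrt (s e)) *\<^sub>C g e))\<^sup>2) summable_on B"
      using s_sum by (rule summable_on_cong[THEN iffD1, rotated])
        (auto simp: norm_scaleC power_mult_distrib sq ng simp del: norm_of_real)
    from bop_of_square_summable[OF B this] show ?thesis using that by blast
  qed
  have "S - X \<circ>\<^sub>B Y = 0"
  proof (rule onb_zero[OF B])
    fix e assume "e \<in> B"
    moreover have "complex_of_real (sqrt (s e)) * complex_of_real (sqrt (s e)) = complex_of_real (s e)"
      by (simp add: s_def flip: of_real_mult)
    ultimately show "(S - X \<circ>\<^sub>B Y) \<cdot> e = 0"
      by (simp add: X Y bop_scaleC scaleC_scaleC Sg)
  qed
  then show ?thesis
    unfolding trace_class_def using X(1) Y(1) by (intro exI[of _ X] exI[of _ Y]) simp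
qed

text \<open>Agreement is claimed on rank one operators only: in infinite dimensions a nonzero
  bounded functional may vanish on all of them. Excluding this singular part is the task of the
  continuity condition in \<open>normal_functional_representation\<close>.\<close>

lemma bounded_functional_representation:
  assumes f: "bounded_functional f"
  shows "\<exists>S. trace_class S \<and> (\<forall>x y. f (x \<boxtimes> y) = pairing (x \<boxtimes> y) S)"
proof -
  obtain S where S: "\<And>x y. f (x \<boxtimes> y) = cinner (S \<cdot> x) y"
    using bounded_functional_rank_one[OF f] by blast
  then have "trace_class S" by (rule trace_class_of_bounded_functional[OF f])
  then show ?thesis using S by (auto simp: pairing_rank_one_left)
qed

section \<open>Normal functionals and normal maps\<close>

lemmas pairing_zero = bounded_functional_zero[OF bounded_functional_pairing]
  and pairing_add = bounded_functional_add[OF bounded_functional_pairing]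
  and pairing_diff = bounded_functional_diff[OF bounded_functional_pairing]
  and pairing_scaleC = bounded_functional_scaleC[OF bounded_functional_pairing]
  and pairing_sum = bounded_functional_sum[OF bounded_functional_pairing]

definition basis_proj :: "'a::chilbert_space set \<Rightarrow> 'a bop"
  where "basis_proj F = (\<Sum>e\<in>F. e \<boxtimes> e)"

text \<open>Kept general because it is used both with the vectors \<open>e i\<close> of K and with
  the vectors \<open>ket (e i) (e j)\<close> of H.\<close>

definition onb_exhaustion :: "(nat \<Rightarrow> 'a::chilbert_space set) \<Rightarrow> bool"
  where "onb_exhaustion E \<longleftrightarrow> (\<forall>n. finite (E n)) \<and> mono E \<and> is_onb (\<Union>n. E n)"

lemma basis_proj_app: "basis_proj F \<cdot> x = (\<Sum>e\<in>F. cinner x e *\<^sub>C e)"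
  by (simp add: basis_proj_def bop_sum_app)

lemma bounded_by_basis_proj:
  assumes "finite F" "orthonormal F"
  shows "bounded_by 1 (basis_proj F)"
  unfolding basis_proj_def
  using bounded_by_sum_rank_one[of F "\<lambda>e. e" 1 "\<lambda>e. e"] Bessel[OF assms(2,1) order_refl] assms by simp

context
  fixes E :: "nat \<Rightarrow> 'a::chilbert_space set"
  assumes E: "onb_exhaustion E"
begin

lemma onb_exhaustion_finite: "finite (E n)"
  using E by (simp add: onb_exhaustion_def)

lemma onb_exhaustion_orthonormal: "orthonormal (E n)"
  using E by (fastforce simp: onb_exhaustion_def is_onb_def orthonormal_def)

lemma onb_exhaustion_mono: "m \<le> n \<Longrightarrow> E m \<subseteq> E n"
  using E by (simp add: onb_exhaustion_def monoD)

lemma bounded_by_exhaustion: "bounded_by 1 (basis_proj (E n))"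
  by (intro bounded_by_basis_proj onb_exhaustion_finite onb_exhaustion_orthonormal)

text \<open>The sets \<open>E n\<close> eventually contain every finite part of the basis, so
  Parseval's unordered sum is also the limit along \<open>E\<close>; the squared distance to
  \<open>x\<close> is the remainder of that sum.\<close>

lemma basis_proj_tendsto: "(\<lambda>n. basis_proj (E n) \<cdot> x) \<longlonglongrightarrow> x"
proof -
  let ?g = "\<lambda>e. (cmod (cinner x e))\<^sup>2" and ?B = "\<Union>n. E n"
  have "filterlim E (finite_subsets_at_top ?B) sequentially"
    unfolding filterlim_finite_subsets_at_top
  proof (intro allI impI)
    fix X assume X: "finite X \<and> X \<subseteq> ?B"
    then obtain n where n: "\<And>x. x \<in> X \<Longrightarrow> x \<in> E (n x)" by (metis UN_E subsetD)
    define N where "N = Max (insert 0 (n ` X))"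
    have "X \<subseteq> E N"
    proof
      fix x assume "x \<in> X"
      then have "n x \<le> N" using X by (simp add: N_def)
      then show "x \<in> E N" using n[OF \<open>x \<in> X\<close>] onb_exhaustion_mono by blast
    qed
    then have "X \<subseteq> E m" if "m \<ge> N" for m
      using onb_exhaustion_mono[OF that] by (rule subset_trans)
    then show "\<forall>\<^sub>F y in sequentially. finite (E y) \<and> X \<subseteq> E y \<and> E y \<subseteq> ?B"
      unfolding eventually_sequentially using onb_exhaustion_finite by blast
  qed
  moreover have "(sum ?g \<longlongrightarrow> (norm x)\<^sup>2) (finite_subsets_at_top ?B)"
    using Parseval[of ?B x] E by (simp add: has_sum_def onb_exhaustion_def)
  ultimately have lim: "(\<lambda>n. sum ?g (E n)) \<longlonglongrightarrow> (norm x)\<^sup>2"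
    by (rule filterlim_compose[rotated])
  have "(norm (basis_proj (E n) \<cdot> x - x))\<^sup>2 = (norm x)\<^sup>2 - sum ?g (E n)" for n
  proof -
    note ortho = onb_exhaustion_orthonormal[of n] and fin = onb_exhaustion_finite[of n]
    let ?p = "\<Sum>e\<in>E n. cinner x e *\<^sub>C e"
    have "cinner x ?p = cnj (cinner ?p x)" by (rule cinner_commute)
    also have "cinner ?p x = complex_of_real (sum ?g (E n))"
      unfolding cinner_sum_left cinner_scaleC_left of_real_sum
      by (intro sum.cong refl) (simp add: complex_norm_square del: of_real_power flip: cinner_commute)
    finally have "cinner x ?p = complex_of_real (sum ?g (E n))" by simp
    then show ?thesis
      using cinner.nrm_add_square[of x "- ?p"] norm_orthonormal_sum[OF ortho fin order_refl, of "cinner x"]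
      by (simp add: basis_proj_app norm_minus_commute)
  qed
  moreover have "(\<lambda>n. (norm x)\<^sup>2 - sum ?g (E n)) \<longlonglongrightarrow> 0"
    using tendsto_diff[OF tendsto_const lim, of "(norm x)\<^sup>2"] by simp
  ultimately have "(\<lambda>n. (norm (basis_proj (E n) \<cdot> x - x))\<^sup>2) \<longlonglongrightarrow> 0" by simp
  from tendsto_real_sqrt[OF this] have "(\<lambda>n. norm (basis_proj (E n) \<cdot> x - x)) \<longlonglongrightarrow> 0" by simp
  then show ?thesis
    using Lim_null tendsto_norm_zero_iff by blast
qed

lemma pairing_comp_basis_proj_tendsto:
  assumes "trace_class T"
  shows "(\<lambda>n. pairing (A \<circ>\<^sub>B basis_proj (E n)) T) \<longlonglongrightarrow> pairing A T"
proof -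
  obtain K where K: "bounded_by K A" using ex_bounded_by by blast
  show ?thesis
  proof (rule pairing_tendsto[OF assms])
    show "bounded_by (K * 1) (A \<circ>\<^sub>B basis_proj (E n))" for n
      by (intro bounded_by_comp K bounded_by_exhaustion)
    show "(\<lambda>n. cinner ((A \<circ>\<^sub>B basis_proj (E n)) \<cdot> x) y) \<longlonglongrightarrow> cinner (A \<cdot> x) y" for x y
      unfolding bop_comp_app by (intro tendsto_cinner tendsto_bop_app basis_proj_tendsto tendsto_const)
  qed
qed

text \<open>\<open>A \<circ>\<^sub>B basis_proj (E n)\<close> is the finite sum of the operators
  \<open>(A \<cdot> e) \<boxtimes> e\<close>, where \<open>f\<close> already agrees with the pairing
  with \<open>D\<close>; both sides converge.\<close>

lemma normal_functional_representation:
  assumes f: "bounded_functional f"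
    and lim: "\<And>A. (\<lambda>n. f (A \<circ>\<^sub>B basis_proj (E n))) \<longlonglongrightarrow> f A"
  shows "\<exists>D. trace_class D \<and> (\<forall>A. f A = pairing A D)"
proof -
  obtain D where D: "trace_class D" "\<And>x y. f (x \<boxtimes> y) = pairing (x \<boxtimes> y) D"
    using bounded_functional_representation[OF f] by blast
  have "f (A \<circ>\<^sub>B basis_proj (E n)) = pairing (A \<circ>\<^sub>B basis_proj (E n)) D" for A n
  proof -
    have "A \<circ>\<^sub>B basis_proj (E n) = (\<Sum>e\<in>E n. (A \<cdot> e) \<boxtimes> e)"
      by (rule bop_eqI) (simp add: basis_proj_app bop_sum_app bop_app_sum bop_scaleC)
    then show ?thesis
      by (simp add: bounded_functional_sum[OF f]
          pairing_sum[OF D(1)] D)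
  qed
  then have "f A = pairing A D" for A
    using LIMSEQ_unique[OF lim[of A]] pairing_comp_basis_proj_tendsto[OF D(1), of A] by simp
  then show ?thesis using D(1) by blast
qed

end

section \<open>The sigma-weak topology and normality expressed by trace pairings\<close>

lemma topspace_sigma_weak [simp]: "topspace sigma_weak_topology = UNIV"
proof -
  have "UNIV \<in> {{A :: 'a bop. pairing A T \<in> U} |T U. trace_class T \<and> open U}"
    using trace_class_rank_one[of "0::'a" 0] open_UNIV by blast
  then show ?thesis
    unfolding sigma_weak_topology_def topology_generated_by_topspace by blast
qed

lemma continuous_map_pairing:
  assumes "trace_class T"
  shows "continuous_map sigma_weak_topology euclidean (\<lambda>A. pairing A T)"
  unfolding continuous_map_def
proof (intro conjI allI impI)
  fix U :: "complex set" assume "openin euclidean U"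
  then have "openin sigma_weak_topology {A. pairing A T \<in> U}"
    unfolding sigma_weak_topology_def using assms
    by (intro topology_generated_by_Basis) auto
  then show "openin sigma_weak_topology {x \<in> topspace sigma_weak_topology. pairing x T \<in> U}"
    by simp
qed simp

text \<open>Induction over the generated topology turns the subbasis into the usual neighbourhoods
  given by finitely many seminorms; intersections join the finite families and take the smaller
  radius.\<close>

lemma sigma_weak_neighbourhood:
  assumes "openin sigma_weak_topology U" "A \<in> U"
  shows "\<exists>\<T> \<epsilon>. finite \<T> \<and> (\<forall>T\<in>\<T>. trace_class T) \<and> 0 < \<epsilon> \<and>
    (\<forall>B. (\<forall>T\<in>\<T>. cmod (pairing B T - pairing A T) < \<epsilon>) \<longrightarrow> B \<in> U)" (is "?P U")
proof -
  have "generate_topology_on {{A. pairing A T \<in> U} |T U. trace_class T \<and> open U} U"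
    using assms(1) unfolding sigma_weak_topology_def by (rule openin_topology_generated_by)
  then show ?thesis
    using assms(2)
  proof induction
    case (Int U V)
    then obtain \<T> \<epsilon> \<T>' \<epsilon>' where
      "finite \<T>" "\<forall>T\<in>\<T>. trace_class T" "0 < \<epsilon>" "\<forall>B. (\<forall>T\<in>\<T>. cmod (pairing B T - pairing A T) < \<epsilon>) \<longrightarrow> B \<in> U"
      "finite \<T>'" "\<forall>T\<in>\<T>'. trace_class T" "0 < \<epsilon>'" "\<forall>B. (\<forall>T\<in>\<T>'. cmod (pairing B T - pairing A T) < \<epsilon>') \<longrightarrow> B \<in> V"
      by auto
    then show ?case
      by (intro exI[of _ "\<T> \<union> \<T>'"] exI[of _ "min \<epsilon> \<epsilon>'"]) auto
  next
    case (UN K)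
    then obtain k where k: "k \<in> K" "A \<in> k" by blast
    from UN.IH[OF k] obtain \<T> \<epsilon> where "finite \<T>" "\<forall>T\<in>\<T>. trace_class T" "0 < \<epsilon>"
      "\<forall>B. (\<forall>T\<in>\<T>. cmod (pairing B T - pairing A T) < \<epsilon>) \<longrightarrow> B \<in> k"
      by blast
    then show ?case using k by (intro exI[of _ \<T>] exI[of _ \<epsilon>]) blast
  next
    case (Basis s)
    then obtain T V where T: "s = {A. pairing A T \<in> V}" "trace_class T" "open V" by blast
    then obtain \<epsilon> where "0 < \<epsilon>" "ball (pairing A T) \<epsilon> \<subseteq> V"
      using Basis by (auto elim: openE)
    then show ?case
      using T by (intro exI[of _ "{T}"] exI[of _ \<epsilon>]) (auto simp: dist_norm norm_minus_commute)
  qed simp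
qed

text \<open>Near 0 the functional is controlled by finitely many trace pairings. Scaling gives
  boundedness, and the convergence of these pairings under compressions carries over to
  \<open>f\<close>.\<close>

lemma sigma_weak_functional_representation:
  fixes f :: "'a::chilbert_space bop \<Rightarrow> complex"
  assumes E: "onb_exhaustion (E :: nat \<Rightarrow> 'a set)"
    and add: "\<And>A B. f (A + B) = f A + f B" and scale: "\<And>c A. f (c *\<^sub>C A) = c * f A"
    and cont: "continuous_map sigma_weak_topology euclidean f"
  shows "\<exists>D. trace_class D \<and> (\<forall>A. f A = pairing A D)"
proof -
  have f0: "f 0 = 0" using add[of 0 0] by simp
  have nhd: "\<exists>\<T> \<epsilon>. finite \<T> \<and> (\<forall>T\<in>\<T>. trace_class T) \<and> 0 < \<epsilon> \<and>
    (\<forall>B. (\<forall>T\<in>\<T>. cmod (pairing B T) < \<epsilon>) \<longrightarrow> cmod (f B) < \<delta>)" if "\<delta> > 0" for \<delta>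
  proof -
    have "openin sigma_weak_topology {A \<in> topspace sigma_weak_topology. f A \<in> ball 0 \<delta>}"
      using cont by (rule openin_continuous_map_preimage) simp
    then have "openin sigma_weak_topology {A. f A \<in> ball 0 \<delta>}"
      by (simp only: topspace_sigma_weak UNIV_I simp_thms)
    then obtain \<T> \<epsilon> where T: "finite \<T>" "\<forall>T\<in>\<T>. trace_class T" "0 < \<epsilon>"
      "\<forall>B. (\<forall>T\<in>\<T>. cmod (pairing B T - pairing 0 T) < \<epsilon>) \<longrightarrow> B \<in> {A. f A \<in> ball 0 \<delta>}"
      using sigma_weak_neighbourhood[of "{A. f A \<in> ball 0 \<delta>}" 0] \<open>\<delta> > 0\<close> f0
      by (elim meta_impE exE conjE) simp_all
    moreover have "pairing 0 T = 0" if "T \<in> \<T>" for T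
      using T(2) that by (simp add: pairing_zero)
    ultimately show ?thesis
      by (intro exI[of _ \<T>] exI[of _ \<epsilon>]) simp
  qed
  have bdd: "bounded_functional f"
  proof -
    obtain \<T> \<epsilon> where T: "finite \<T>" "\<And>T. T \<in> \<T> \<Longrightarrow> trace_class T" "0 < \<epsilon>"
      "\<And>B. (\<forall>T\<in>\<T>. cmod (pairing B T) < \<epsilon>) \<Longrightarrow> cmod (f B) < 1"
      using nhd[of 1] by auto
    have "\<exists>C\<ge>0. \<forall>A K. bounded_by K A \<longrightarrow> cmod (pairing A T) \<le> C * K" if "T \<in> \<T>" for T
      by (rule bounded_functional_bound[OF bounded_functional_pairing[OF T(2)[OF that]]])
    then obtain c where c: "\<And>T. T \<in> \<T> \<Longrightarrow> 0 \<le> c T"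
      "\<And>T A K. T \<in> \<T> \<Longrightarrow> bounded_by K A \<Longrightarrow> cmod (pairing A T) \<le> c T * K"
      by metis
    \<comment> \<open>The summand 1 makes \<open>C\<close> positive even for empty
      \<open>\<T>\<close> and strictly larger than every \<open>c T\<close>.\<close>
    define C where "C = sum c \<T> + 1"
    have C: "c T \<le> C - 1" "0 < C" if "T \<in> \<T>" for T
      using member_le_sum[OF that, of c] c(1) T(1) sum_nonneg[of \<T> c] by (auto simp: C_def)
    have C0: "0 < C" using c(1) sum_nonneg[of \<T> c] by (simp add: C_def add_nonneg_pos)
    have "cmod (f A) \<le> C / \<epsilon> * K" if A: "bounded_by K A" for A K
    proof (cases "K = 0")
      case True
      then have "A = 0" using bounded_byD[OF A] by (intro bop_eqI) simp
      then show ?thesis using f0 True by simp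
    next
      case False
      then have K: "0 < K" using bounded_by_nonneg[OF A] by simp
      \<comment> \<open>This factor shrinks \<open>A\<close> into the neighbourhood where
        \<open>f\<close> is smaller than 1.\<close>
      define t where "t = \<epsilon> / (C * K)"
      have t: "t > 0" using T(3) C0 K by (simp add: t_def)
      have "cmod (pairing (complex_of_real t *\<^sub>C A) S) < \<epsilon>" if S: "S \<in> \<T>" for S
      proof -
        have "cmod (pairing (complex_of_real t *\<^sub>C A) S) = t * cmod (pairing A S)"
          using t by (simp add: pairing_scaleC[OF T(2)[OF S]] norm_mult)
        also have "\<dots> \<le> t * (c S * K)"
          using c(2)[OF S A] t by (intro mult_left_mono) auto
        also have "\<dots> < t * (C * K)"
          using C(1)[OF S] t K by (intro mult_strict_left_mono mult_strict_right_mono) auto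
        also have "\<dots> = \<epsilon>" using C0 K by (simp add: t_def)
        finally show ?thesis .
      qed
      then have "cmod (f (complex_of_real t *\<^sub>C A)) < 1" by (intro T(4)) simp
      then have "t * cmod (f A) < 1" using t by (simp add: scale norm_mult)
      then have "cmod (f A) < 1 / t" using t by (simp add: pos_less_divide_eq mult.commute)
      then show ?thesis using T(3) by (simp add: t_def)
    qed
    then show ?thesis unfolding bounded_functional_def using add scale by blast
  qed
  show ?thesis
  proof (rule normal_functional_representation[OF E bdd])
    fix A
    show "(\<lambda>n. f (A \<circ>\<^sub>B basis_proj (E n))) \<longlonglongrightarrow> f A"
    proof (rule tendstoI)
      fix \<delta> :: real assume "\<delta> > 0"
      then obtain \<T> \<epsilon> where T: "finite \<T>" "\<And>T. T \<in> \<T> \<Longrightarrow> trace_class T" "0 < \<epsilon>"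
        "\<And>B. (\<forall>T\<in>\<T>. cmod (pairing B T) < \<epsilon>) \<Longrightarrow> cmod (f B) < \<delta>"
        using nhd[of \<delta>] by blast
      have "\<forall>\<^sub>F n in sequentially. \<forall>T\<in>\<T>. cmod (pairing (A \<circ>\<^sub>B basis_proj (E n)) T - pairing A T) < \<epsilon>"
        using tendstoD[OF pairing_comp_basis_proj_tendsto[OF E T(2)] T(3)]
        by (intro eventually_ball_finite T(1)) (simp add: dist_norm)
      then show "\<forall>\<^sub>F n in sequentially. dist (f (A \<circ>\<^sub>B basis_proj (E n))) (f A) < \<delta>"
      proof (rule eventually_mono)
        fix n assume *: "\<forall>T\<in>\<T>. cmod (pairing (A \<circ>\<^sub>B basis_proj (E n)) T - pairing A T) < \<epsilon>"
        have "cmod (f (A \<circ>\<^sub>B basis_proj (E n) - A)) < \<delta>"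
          using * by (intro T(4)) (simp add: pairing_diff T(2))
        then show "dist (f (A \<circ>\<^sub>B basis_proj (E n))) (f A) < \<delta>"
          by (simp add: dist_norm bounded_functional_diff[OF bdd])
      qed
    qed
  qed
qed

lemma normal_map_predual:
  fixes \<psi> :: "'a::chilbert_space bop \<Rightarrow> 'a bop"
  assumes E: "onb_exhaustion (E :: nat \<Rightarrow> 'a set)" and "clinear \<psi>" "normal_map \<psi>" "trace_class T"
  shows "\<exists>D. trace_class D \<and> (\<forall>A. pairing (\<psi> A) T = pairing A D)"
proof (rule sigma_weak_functional_representation[OF E])
  show "pairing (\<psi> (A + B)) T = pairing (\<psi> A) T + pairing (\<psi> B) T" for A B
    using assms(2) pairing_add[OF assms(4)] by (simp add: Vector_Spaces.linear_iff)
  show "pairing (\<psi> (c *\<^sub>C A)) T = c * pairing (\<psi> A) T" for c A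
    using assms(2) pairing_scaleC[OF assms(4)] by (simp add: Vector_Spaces.linear_iff)
  show "continuous_map sigma_weak_topology euclidean (\<lambda>A. pairing (\<psi> A) T)"
    using continuous_map_compose[OF _ continuous_map_pairing[OF assms(4)], of _ \<psi>] assms(3)
    by (simp add: normal_map_def comp_def)
qed

text \<open>The preimage of the subbasic set of \<open>T\<close> is that of its predual
  \<open>D\<close>. This is a converse to \<open>normal_map_predual\<close>.\<close>

lemma normal_mapI:
  assumes "\<And>T. trace_class T \<Longrightarrow> \<exists>D. trace_class D \<and> (\<forall>A. pairing (\<psi> A) T = pairing A D)"
  shows "normal_map \<psi>"
  unfolding normal_map_def sigma_weak_topology_def[where 'a = 'a]
proof (rule continuous_on_generated_topo, unfold sigma_weak_topology_def[symmetric])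
  fix U assume "U \<in> {{A :: 'a bop. pairing A T \<in> U} |T U. trace_class T \<and> open U}"
  then obtain T V where U: "U = {A. pairing A T \<in> V}" "trace_class T" "open V" by blast
  obtain D where D: "trace_class D" "\<And>A. pairing (\<psi> A) T = pairing A D"
    using assms[OF U(2)] by blast
  have "\<psi> -` U \<inter> topspace sigma_weak_topology = {A \<in> topspace sigma_weak_topology. pairing A D \<in> V}"
    by (auto simp: U D)
  then show "openin sigma_weak_topology (\<psi> -` U \<inter> topspace sigma_weak_topology)"
    using continuous_map_pairing[OF D(1)] U(3) by (simp add: continuous_map_def)
next
  have "UNIV \<in> {{A :: 'a bop. pairing A T \<in> U} |T U. trace_class T \<and> open U}"
    using trace_class_rank_one[of "0::'a" 0] open_UNIV by blast
  then show "\<psi> ` topspace sigma_weak_topology \<subseteq> \<Union> {{A. pairing A T \<in> U} |T U. trace_class T \<and> open U}"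
    by blast
qed

text \<open>Distinct basis vectors have distance \<open>sqrt 2\<close>, so points of a countable
  dense set chosen within \<open>1 / 2\<close> of them are distinct. A finite basis would span the
  space.\<close>

lemma ex_onb_sequence:
  assumes sep: "separable_space (euclidean :: 'a::chilbert_space topology)"
    and inf: "\<And>B :: 'a set. finite B \<Longrightarrow> complex_vector.span B \<noteq> UNIV"
  shows "\<exists>e :: nat \<Rightarrow> 'a. inj e \<and> is_onb (range e)"
proof -
  let ?B = "some_onb :: 'a set"
  have B: "is_onb ?B" "orthonormal ?B" using is_onb_some_onb by (auto simp: is_onb_def)
  obtain D :: "'a set" where D: "countable D" "closure D = UNIV"
    using sep by (auto simp: separable_space_def)
  have "\<exists>d\<in>D. dist d e < 1 / 2" for e :: 'a
    using D(2) closure_approachable[of e D] by (metis UNIV_I half_gt_zero zero_less_one)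
  then obtain d where d: "\<And>e. d e \<in> D" "\<And>e :: 'a. dist (d e) e < 1 / 2" by metis
  have "inj_on d ?B"
  proof (rule inj_onI, rule ccontr)
    fix e f assume ef: "e \<in> ?B" "f \<in> ?B" "d e = d f" "e \<noteq> f"
    have "dist e f \<le> dist (d e) e + dist (d e) f" by (rule dist_triangle3)
    also have "\<dots> < 1" using d(2)[of e] d(2)[of f] ef(3) by simp
    finally have "norm (e - f) < 1" by (simp add: dist_norm)
    moreover have "(norm (e - f))\<^sup>2 = 2"
      using cinner.nrm_add_square[of e "- f"] ef B(2) by (simp add: orthonormal_def)
    ultimately show False
      using power_le_one[of "norm (e - f)" 2] by simp
  qed
  then have "countable ?B"
    using d(1) D(1) by (meson countable_image_inj_on countable_subset image_subset_iff)
  moreover have "infinite ?B"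
  proof
    assume fin: "finite ?B"
    have "x \<in> complex_vector.span ?B" for x
      by (subst onb_sum[OF B(1) fin, of x])
        (intro complex_vector.span_sum complex_vector.span_scale complex_vector.span_base)
    then show False using inf[OF fin] by blast
  qed
  ultimately have "bij_betw (from_nat_into ?B) UNIV ?B"
    by (rule bij_betw_from_nat_into)
  then show ?thesis
    using B(1) by (intro exI[of _ "from_nat_into ?B"]) (simp add: bij_betw_def)
qed

section \<open>Hilbert-Schmidt operators of rank one\<close>

definition ket :: "'a::chilbert_space \<Rightarrow> 'a \<Rightarrow> 'a hs"
  where "ket v w = Abs_hs (v \<boxtimes> w)"

lemma hs_op_ket [simp]: "hs_op (ket v w) = v \<boxtimes> w"
  by (simp add: ket_def Abs_hs_inverse)

lemma ket_algebra:
  "ket (v + v') w = ket v w + ket v' w" "ket v (w + w') = ket v w + ket v w'"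
  "ket (c *\<^sub>C v) w = c *\<^sub>C ket v w" "ket v (c *\<^sub>C w) = cnj c *\<^sub>C ket v w"
  by (rule hs_eqI; simp add: rank_one_algebra)+

lemma cinner_ket_right: "cinner x (ket v w) = cinner (hs_op x \<cdot> w) v"
  using pairing_rank_one_right[of "hs_op x" w v] by (simp add: cinner_hs_def pairing_def)

lemma cinner_ket_left: "cinner (ket v w) x = cinner v (hs_op x \<cdot> w)"
  by (metis cinner_ket_right cinner_commute)

lemma norm_ket: "norm (ket v w) = norm v * norm w"
proof -
  have "complex_of_real ((norm (ket v w))\<^sup>2) = complex_of_real ((norm v * norm w)\<^sup>2)"
    unfolding cinner.ip_self[symmetric] cinner_ket_right
    by (simp add: cinner_scaleC_left cinner.ip_self power_mult_distrib mult.commute)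
  then have "(norm (ket v w))\<^sup>2 = (norm v * norm w)\<^sup>2" using of_real_eq_iff by blast
  then show ?thesis by simp
qed

lemma left_mult_ket: "left_mult a \<cdot> ket v w = ket (a \<cdot> v) w"
  by (rule hs_eqI) (simp add: comp_rank_one)

lemma right_mult_rank_one: "right_mult (u \<boxtimes> v) \<cdot> x = ket (hs_op x \<cdot> u) v"
  by (rule hs_eqI) (simp add: comp_rank_one)

text \<open>The matrix units of B(H) are among the products on which \<open>tilde \<phi>\<close> is
  prescribed; uniqueness and all evaluations rest on this.\<close>

lemma ket_rank_one_ket: "ket v w \<boxtimes> ket v' w' = right_mult (w' \<boxtimes> w) \<circ>\<^sub>B left_mult (v \<boxtimes> v')"
  by (rule bop_eqI) (simp add: cinner_ket_right right_mult_rank_one ket_algebra)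

text \<open>A slice map: the entry of \<open>A\<close> in row \<open>b'\<close> and column
  \<open>b\<close> when operators on H are read as matrices over B(K). \<open>cinner_block\<close>
  gives its matrix coefficients.\<close>

definition block :: "'a::chilbert_space hs bop \<Rightarrow> 'a \<Rightarrow> 'a \<Rightarrow> 'a bop"
  where "block A b' b = Abs_bop (\<lambda>v. hs_op (A \<cdot> ket v b) \<cdot> b')"

lemma block_app: "block A b' b \<cdot> v = hs_op (A \<cdot> ket v b) \<cdot> b'"
proof -
  obtain K where K: "bounded_by K A" using ex_bounded_by by blast
  have "clinear (\<lambda>v. hs_op (A \<cdot> ket v b) \<cdot> b') \<and> bounded_linear (\<lambda>v. hs_op (A \<cdot> ket v b) \<cdot> b')"
  proof (rule bounded_clinearI)
    show "norm (hs_op (A \<cdot> ket v b) \<cdot> b') \<le> norm v * (K * norm b * norm b')" for v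
    proof -
      have "norm (hs_op (A \<cdot> ket v b) \<cdot> b') \<le> norm b' * norm (A \<cdot> ket v b)" by (rule norm_hs_op_le)
      also have "\<dots> \<le> norm b' * (K * (norm v * norm b))"
        using bounded_byD[OF K, of "ket v b"] by (intro mult_left_mono) (simp_all add: norm_ket)
      finally show ?thesis by (simp add: mult_ac)
    qed
  qed (simp_all add: ket_algebra bop_add bop_scaleC)
  then show ?thesis by (simp add: block_def Abs_bop_inverse)
qed

lemma cinner_block: "cinner (block A b' b \<cdot> v) w = cinner (A \<cdot> ket v b) (ket w b')"
  by (simp add: block_app cinner_ket_right)

lemma block_add: "block (A + B) b' b = block A b' b + block B b' b"
  by (rule bop_eqI) (simp add: block_app)

lemma block_scaleC: "block (c *\<^sub>C A) b' b = c *\<^sub>C block A b' b"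
  by (rule bop_eqI) (simp add: block_app)

lemma block_right_left_mult:
  "block (right_mult y \<circ>\<^sub>B left_mult a) b' b = cinner (y \<cdot> b') b *\<^sub>C a"
  by (rule bop_eqI) (simp add: block_app left_mult_ket bop_scaleC)

section \<open>Operator matrices\<close>

text \<open>A real \<open>Sup\<close> says something only for bounded sets; the sum of bounds of all
  entries is a crude upper bound here.\<close>

lemma mat_norm_upper:
  assumes "vec_norm n v \<le> 1"
  shows "vec_norm n (mat_app n a v) \<le> mat_norm n a"
  unfolding mat_norm_def
proof (rule cSup_upper)
  have "\<forall>i j. \<exists>K. bounded_by K (a i j)" using ex_bounded_by by blast
  then obtain K where K: "\<And>i j. bounded_by (K i j) (a i j)" by metis
  show "bdd_above {vec_norm n (mat_app n a v) |v. vec_norm n v \<le> 1}"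
  proof (rule bdd_aboveI, clarify)
    fix v :: "nat \<Rightarrow> 'a" assume v: "vec_norm n v \<le> 1"
    have v': "norm (v j) \<le> 1" if "j < n" for j
      using member_le_L2_set[of "{..<n}" j "\<lambda>i. norm (v i)"] that v by (simp add: vec_norm_def)
    have "vec_norm n (mat_app n a v) \<le> (\<Sum>i<n. norm (mat_app n a v i))"
      unfolding vec_norm_def by (rule L2_set_le_sum) simp
    also have "\<dots> \<le> (\<Sum>i<n. \<Sum>j<n. K i j)"
      unfolding mat_app_def
    proof (intro sum_mono order_trans[OF norm_sum])
      fix i j assume "j \<in> {..<n}"
      then have "K i j * norm (v j) \<le> K i j"
        using v'[of j] bounded_by_nonneg[OF K] by (intro mult_left_le) auto
      then show "norm (a i j \<cdot> v j) \<le> K i j" using bounded_byD[OF K, of i j "v j"] by simp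
    qed
    finally show "vec_norm n (mat_app n a v) \<le> (\<Sum>i<n. \<Sum>j<n. K i j)" .
  qed
qed (use assms in blast)

lemma vec_norm_scaleC: "vec_norm n (\<lambda>i. c *\<^sub>C v i) = cmod c * vec_norm n v"
  by (simp add: vec_norm_def norm_scaleC L2_set_right_distrib)

lemma mat_app_scaleC: "mat_app n a (\<lambda>i. c *\<^sub>C v i) = (\<lambda>i. c *\<^sub>C mat_app n a v i)"
  by (rule ext) (simp add: mat_app_def bop_scaleC complex_vector.scale_sum_right)

lemma vec_norm_nonneg: "0 \<le> vec_norm n v"
  by (simp add: vec_norm_def L2_set_nonneg)

lemma vec_norm_mat_app_le: "vec_norm n (mat_app n a v) \<le> mat_norm n a * vec_norm n v"
proof (cases "vec_norm n v = 0")
  case True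
  then have "v j = 0" if "j < n" for j
    using that by (simp add: vec_norm_def L2_set_eq_0_iff)
  then have "mat_app n a v = (\<lambda>_. 0)" by (auto simp: mat_app_def)
  then show ?thesis using True by (simp add: vec_norm_def L2_set_def)
next
  case False
  let ?c = "complex_of_real (inverse (vec_norm n v))"
  have "vec_norm n (mat_app n a (\<lambda>i. ?c *\<^sub>C v i)) \<le> mat_norm n a"
    by (rule mat_norm_upper) (use False vec_norm_nonneg[of n v] in \<open>simp add: vec_norm_scaleC norm_inverse\<close>)
  then have "vec_norm n (mat_app n a v) / vec_norm n v \<le> mat_norm n a"
    using vec_norm_nonneg[of n v]
    by (simp add: vec_norm_scaleC mat_app_scaleC norm_inverse divide_inverse mult.commute)
  then show ?thesis
    using False vec_norm_nonneg[of n v] by (simp add: pos_divide_le_eq)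
qed

lemma mat_norm_nonneg: "0 \<le> mat_norm n a"
  using order_trans[OF vec_norm_nonneg mat_norm_upper[of n "\<lambda>_. 0" a]]
  by (simp add: vec_norm_def L2_set_def)

lemma mat_norm_least:
  assumes "0 \<le> K" "\<And>v. vec_norm n v \<le> 1 \<Longrightarrow> vec_norm n (mat_app n a v) \<le> K"
  shows "mat_norm n a \<le> K"
  unfolding mat_norm_def
proof (rule cSup_least)
  have "vec_norm n (\<lambda>_. 0) \<le> 1" by (simp add: vec_norm_def L2_set_def)
  then show "{vec_norm n (mat_app n a v) |v. vec_norm n v \<le> 1} \<noteq> {}" by blast
qed (use assms in blast)

lemma mat_form_le:
  "cmod (\<Sum>i<n. cinner (mat_app n a v i) (w i)) \<le> mat_norm n a * vec_norm n v * vec_norm n w"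
proof -
  have "cmod (\<Sum>i<n. cinner (mat_app n a v i) (w i)) \<le> (\<Sum>i<n. \<bar>norm (mat_app n a v i)\<bar> * \<bar>norm (w i)\<bar>)"
    by (rule order_trans[OF norm_sum sum_mono]) (simp add: cinner.Cauchy_Schwarz)
  also have "\<dots> \<le> vec_norm n (mat_app n a v) * vec_norm n w"
    unfolding vec_norm_def by (rule L2_set_mult_ineq)
  also have "\<dots> \<le> mat_norm n a * vec_norm n v * vec_norm n w"
    by (intro mult_right_mono vec_norm_mat_app_le vec_norm_nonneg)
  finally show ?thesis .
qed

section \<open>Weak limits of bounded sequences of operators\<close>

text \<open>Uniform boundedness reduces arbitrary vectors to finite combinations of basis vectors,
  where convergence is assumed. The limits form a sesquilinear form with the same bound.\<close>

lemma weak_limit: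
  fixes T :: "nat \<Rightarrow> 'a::chilbert_space bop"
  assumes E: "onb_exhaustion E" and T: "\<And>n. bounded_by K (T n)"
    and conv: "\<And>u v. u \<in> (\<Union>n. E n) \<Longrightarrow> v \<in> (\<Union>n. E n) \<Longrightarrow> convergent (\<lambda>n. cinner (T n \<cdot> u) v)"
  shows "\<exists>T'. bounded_by K T' \<and> (\<forall>x y. (\<lambda>n. cinner (T n \<cdot> x) y) \<longlonglongrightarrow> cinner (T' \<cdot> x) y)"
proof -
  have K: "0 \<le> K" using T bounded_by_nonneg by blast
  define P where "P n = basis_proj (E n)" for n
  have convN: "convergent (\<lambda>n. cinner (T n \<cdot> P N \<cdot> x) (P N \<cdot> y))" for N x y
  proof -
    have "(\<lambda>n. cinner (T n \<cdot> P N \<cdot> x) (P N \<cdot> y)) =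
        (\<lambda>n. \<Sum>v\<in>E N. \<Sum>u\<in>E N. cinner x u * (cnj (cinner y v) * cinner (T n \<cdot> u) v))"
      by (simp add: P_def basis_proj_app bop_app_sum cinner_sum_left cinner_sum_right bop_scaleC
          cinner_scaleC_left cinner.ip_scaleC_right sum_distrib_left mult_ac)
    then show ?thesis
      using conv by (auto intro!: convergent_sum convergent_mult convergent_const)
  qed
  have "convergent (\<lambda>n. cinner (T n \<cdot> x) y)" for x y
  proof (rule Cauchy_convergent, rule metric_CauchyI)
    fix \<epsilon> :: real assume \<epsilon>: "0 < \<epsilon>"
    \<comment> \<open>Bounds the error of replacing \<open>x\<close> and \<open>y\<close> by their
      compressions, for all \<open>n\<close> at once.\<close>
    let ?d = "\<lambda>N. K * norm (x - P N \<cdot> x) * norm y + K * norm x * norm (y - P N \<cdot> y)"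
    have "?d \<longlonglongrightarrow> K * norm (x - x) * norm y + K * norm x * norm (y - y)"
      unfolding P_def by (intro tendsto_intros basis_proj_tendsto[OF E])
    then have "?d \<longlonglongrightarrow> 0" by simp
    then have "\<forall>\<^sub>F N in sequentially. ?d N < \<epsilon> / 3"
      using \<epsilon> by (intro order_tendstoD) auto
    then obtain N where N: "?d N < \<epsilon> / 3" by (auto simp: eventually_sequentially)
    have close: "dist (cinner (T n \<cdot> x) y) (cinner (T n \<cdot> P N \<cdot> x) (P N \<cdot> y)) < \<epsilon> / 3" for n
    proof -
      have "cinner (T n \<cdot> x) y - cinner (T n \<cdot> P N \<cdot> x) (P N \<cdot> y) =
          cinner (T n \<cdot> (x - P N \<cdot> x)) y + cinner (T n \<cdot> P N \<cdot> x) (y - P N \<cdot> y)"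
        by (simp add: bop_diff cinner.ip_diff_left cinner.ip_diff_right)
      also have "cmod \<dots> \<le> K * norm (x - P N \<cdot> x) * norm y + K * norm (P N \<cdot> x) * norm (y - P N \<cdot> y)"
        by (intro order_trans[OF norm_triangle_ineq] add_mono cinner_bounded_by T)
      also have "\<dots> \<le> ?d N"
        using bounded_byD[OF bounded_by_exhaustion[OF E], of N x] K
        by (intro add_left_mono mult_right_mono mult_left_mono) (auto simp: P_def)
      finally show ?thesis using N by (simp add: dist_norm)
    qed
    obtain M where M: "\<And>m n. m \<ge> M \<Longrightarrow> n \<ge> M \<Longrightarrow>
        dist (cinner (T m \<cdot> P N \<cdot> x) (P N \<cdot> y)) (cinner (T n \<cdot> P N \<cdot> x) (P N \<cdot> y)) < \<epsilon> / 3"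
      using metric_CauchyD[OF convergent_Cauchy[OF convN], of "\<epsilon> / 3" N x y] \<epsilon> by auto
    have "dist (cinner (T m \<cdot> x) y) (cinner (T n \<cdot> x) y) < \<epsilon>" if "m \<ge> M" "n \<ge> M" for m n
    proof -
      let ?a = "\<lambda>n. cinner (T n \<cdot> x) y" and ?b = "\<lambda>n. cinner (T n \<cdot> P N \<cdot> x) (P N \<cdot> y)"
      have "dist (?a m) (?a n) \<le> dist (?a m) (?b m) + dist (?b m) (?a n)"
        by (rule dist_triangle)
      also have "dist (?b m) (?a n) \<le> dist (?b m) (?b n) + dist (?a n) (?b n)"
        by (rule dist_triangle2)
      finally show ?thesis
        using close[of m] close[of n] M[OF that] by simp
    qed
    then show "\<exists>M. \<forall>m\<ge>M. \<forall>n\<ge>M. dist (cinner (T m \<cdot> x) y) (cinner (T n \<cdot> x) y) < \<epsilon>" by blast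
  qed
  then obtain q where q: "\<And>x y. (\<lambda>n. cinner (T n \<cdot> x) y) \<longlonglongrightarrow> q x y"
    unfolding convergent_def by metis
  have "\<exists>T'. bounded_by K T' \<and> (\<forall>x y. cinner (T' \<cdot> x) y = q x y)"
  proof (rule bop_of_form)
    show "q (x + x') y = q x y + q x' y" for x x' y
      by (rule LIMSEQ_unique[OF q]) (use tendsto_add[OF q[of x y] q[of x' y]] in \<open>simp add: bop_add cinner_add_left\<close>)
    show "q x (y + y') = q x y + q x y'" for x y y'
      by (rule LIMSEQ_unique[OF q]) (use tendsto_add[OF q[of x y] q[of x y']] in \<open>simp add: cinner.ip_add_right\<close>)
    show "q (c *\<^sub>C x) y = c * q x y" for c x y
      by (rule LIMSEQ_unique[OF q]) (use tendsto_mult_left[OF q[of x y], of c] in \<open>simp add: bop_scaleC cinner_scaleC_left\<close>)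
    show "q x (c *\<^sub>C y) = cnj c * q x y" for c x y
      by (rule LIMSEQ_unique[OF q]) (use tendsto_mult_left[OF q[of x y], of "cnj c"] in \<open>simp add: cinner.ip_scaleC_right\<close>)
    show "cmod (q x y) \<le> K * norm x * norm y" for x y
      by (rule LIMSEQ_le_const2[OF tendsto_norm[OF q]]) (use cinner_bounded_by[OF T] in blast)
  qed (rule K)
  then show ?thesis using q by metis
qed

section \<open>The extension of a normal completely bounded map\<close>

lemma hs_op_sum: "hs_op (sum f F) = (\<Sum>i\<in>F. hs_op (f i))"
  by (induction F rule: infinite_finite_induct) auto

locale onb_sequence =
  fixes e :: "nat \<Rightarrow> 'a::chilbert_space"
  assumes inj: "inj e" and onb: "is_onb (range e)"
begin

section \<open>Finite truncations of K and of H\<close>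

definition proj :: "nat \<Rightarrow> 'a bop"
  where "proj n = basis_proj (e ` {..<n})"

definition ket_basis :: "nat \<Rightarrow> 'a hs set"
  where "ket_basis n = (\<lambda>(i, j). ket (e i) (e j)) ` ({..<n} \<times> {..<n})"

lemma cinner_e: "cinner (e i) (e j) = (if i = j then 1 else 0)"
  using onb inj by (auto simp: is_onb_def orthonormal_cinner inj_eq)

lemma norm_e: "norm (e i) = 1"
  using onb by (simp add: is_onb_def orthonormal_def)

lemma exhaustion: "onb_exhaustion (\<lambda>n. e ` {..<n})"
proof -
  have "(\<Union>n. e ` {..<n}) = range e" by (auto intro: lessI)
  then show ?thesis using onb by (auto simp: onb_exhaustion_def mono_def)
qed

lemma proj_app: "proj n \<cdot> x = (\<Sum>i<n. cinner x (e i) *\<^sub>C e i)"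
  using inj by (simp add: proj_def basis_proj_app sum.reindex inj_on_subset)

lemma Un_ket_basis: "(\<Union>n. ket_basis n) = {ket (e i) (e j) |i j. True}"
proof -
  have "ket (e i) (e j) \<in> ket_basis (Suc (max i j))" for i j
    by (auto simp: ket_basis_def)
  moreover have "ket_basis n \<subseteq> {ket (e i) (e j) |i j. True}" for n
    by (auto simp: ket_basis_def)
  ultimately show ?thesis by blast
qed

lemma cinner_ket_e:
  "cinner (ket (e i) (e j)) (ket (e k) (e l)) = (if i = k \<and> j = l then 1 else 0)"
  by (simp add: cinner_ket_right cinner_e cinner_scaleC_left)

lemma ket_exhaustion: "onb_exhaustion ket_basis"
  unfolding onb_exhaustion_def
proof (intro conjI allI)
  show "finite (ket_basis n)" for n by (simp add: ket_basis_def)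
  show "mono ket_basis" unfolding ket_basis_def mono_def by auto
  have "orthonormal {ket (e i) (e j) |i j. True}"
    unfolding orthonormal_def by (auto simp: norm_ket norm_e cinner_ket_e)
  moreover have "x = 0" if x: "\<forall>f\<in>{ket (e i) (e j) |i j. True}. cinner x f = 0" for x
  proof -
    have "hs_op x = 0"
    proof (rule onb_zero[OF onb])
      fix f assume "f \<in> range e"
      then obtain j where j: "f = e j" by blast
      have "cinner (hs_op x \<cdot> e j) (e i) = 0" for i
        using x by (auto simp: cinner_ket_right[symmetric])
      then show "hs_op x \<cdot> f = 0" using onb by (auto simp: is_onb_def j)
    qed
    then show "x = 0" by (intro hs_eqI) simp
  qed
  ultimately show "is_onb (\<Union>n. ket_basis n)"
    unfolding Un_ket_basis is_onb_def by blast
qed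

text \<open>The projection onto \<open>ket_basis n\<close> is \<open>proj n\<close> on the first
  tensor factor and a truncation of indices on the second. Compressing on H therefore compresses the
  blocks, where normality of \<open>\<phi>\<close> can be applied.\<close>

lemma ket_proj_app: "basis_proj (ket_basis n) \<cdot> ket v (e j) = (if j < n then ket (proj n \<cdot> v) (e j) else 0)"
proof -
  have inj: "inj_on (\<lambda>(i, j). ket (e i) (e j)) ({..<n} \<times> {..<n})"
  proof (rule inj_onI, clarify)
    fix i j k l assume "ket (e i) (e j) = ket (e k) (e l)"
    then show "i = k \<and> j = l" using cinner_ket_e[of i j i j] cinner_ket_e[of k l i j]
      by (auto split: if_splits)
  qed
  have "basis_proj (ket_basis n) \<cdot> ket v (e j) =
      (\<Sum>(i, l)\<in>{..<n} \<times> {..<n}. cinner (ket v (e j)) (ket (e i) (e l)) *\<^sub>C ket (e i) (e l))"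
    using inj by (simp add: ket_basis_def basis_proj_app sum.reindex case_prod_unfold)
  also have "\<dots> = (\<Sum>i<n. \<Sum>l<n. if l = j then cinner v (e i) *\<^sub>C ket (e i) (e j) else 0)"
    unfolding sum.cartesian_product[symmetric]
    by (intro sum.cong refl) (simp add: cinner_ket_right cinner_e)
  also have "\<dots> = (if j < n then \<Sum>i<n. cinner v (e i) *\<^sub>C ket (e i) (e j) else 0)"
    by simp
  also have "(\<Sum>i<n. cinner v (e i) *\<^sub>C ket (e i) (e j)) = ket (proj n \<cdot> v) (e j)"
    by (rule hs_eqI, rule bop_eqI)
      (simp add: proj_app hs_op_sum bop_sum_app complex_vector.scale_sum_right scaleC_scaleC mult.commute)
  finally show ?thesis .
qed

lemma ket_ext:
  assumes "\<And>i j k l. cinner (S \<cdot> ket (e k) (e j)) (ket (e l) (e i)) = cinner (T \<cdot> ket (e k) (e j)) (ket (e l) (e i))"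
  shows "S = T"
proof -
  have B: "is_onb {ket (e i) (e j) |i j. True}"
    using ket_exhaustion by (simp add: onb_exhaustion_def Un_ket_basis)
  have "S - T = 0"
  proof (rule onb_zero[OF B])
    fix f assume "f \<in> {ket (e i) (e j) |i j. True}"
    then obtain k j where f: "f = ket (e k) (e j)" by blast
    have "\<forall>g\<in>{ket (e i) (e j) |i j. True}. cinner ((S - T) \<cdot> f) g = 0"
      using assms by (auto simp: f cinner.ip_diff_left)
    then show "(S - T) \<cdot> f = 0" using B by (simp only: is_onb_def)
  qed
  then show ?thesis by simp
qed

lemma sum_norm_columns_le: "(\<Sum>i<n. (norm (hs_op x \<cdot> e i))\<^sup>2) \<le> (norm x)\<^sup>2"
proof -
  have "(\<Sum>f\<in>e ` {..<n}. (norm (hs_op x \<cdot> f))\<^sup>2) \<le> (norm x)\<^sup>2"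
    by (rule finite_sum_le_has_sum[OF hs_norm_has_sum[OF onb]]) auto
  then show ?thesis using inj by (simp add: sum.reindex inj_on_subset)
qed

lemma vec_norm_columns_le: "vec_norm n (\<lambda>i. hs_op x \<cdot> e i) \<le> norm x"
  unfolding vec_norm_def L2_set_def using sum_norm_columns_le by (intro real_le_lsqrt) (auto intro: sum_nonneg)

lemma hs_op_sum_ket: "hs_op (\<Sum>j<n. ket (v j) (e j)) \<cdot> e i = (if i < n then v i else 0)"
proof -
  have "(\<Sum>j<n. cinner (e i) (e j) *\<^sub>C v j) = (\<Sum>j<n. if i = j then v j else 0)"
    by (intro sum.cong refl) (simp add: cinner_e scaleC_one)
  then show ?thesis by (simp add: hs_op_sum bop_sum_app)
qed

text \<open>The vectors \<open>\<Sum>j<n. ket (v j) (e j)\<close> form an isometric copy of the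
  n-fold power of K in H, and reading off the first columns is a contraction; the block matrix is
  \<open>A\<close> between these two maps.\<close>

lemma mat_norm_block_le:
  assumes A: "bounded_by K A"
  shows "mat_norm n (\<lambda>i j. block A (e i) (e j)) \<le> K"
proof (rule mat_norm_least)
  show K: "0 \<le> K" using A by (rule bounded_by_nonneg)
  fix v :: "nat \<Rightarrow> 'a" assume v: "vec_norm n v \<le> 1"
  define x where "x = (\<Sum>j<n. ket (v j) (e j))"
  have "hs_op x \<cdot> e i = v i" if "i < n" for i
    using that by (simp add: x_def hs_op_sum_ket)
  moreover have "cinner x x = (\<Sum>j<n. cinner (hs_op x \<cdot> e j) (v j))"
    by (subst (2) x_def) (simp add: cinner_sum_right cinner_ket_right)
  ultimately have "cinner x x = (\<Sum>j<n. cinner (v j) (v j))" by simp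
  then have "complex_of_real ((norm x)\<^sup>2) = complex_of_real ((vec_norm n v)\<^sup>2)"
    by (simp add: cinner.ip_self vec_norm_def L2_set_def sum_nonneg)
  then have "norm x = vec_norm n v"
    using vec_norm_nonneg[of n v] by (simp flip: of_real_power)
  moreover have "mat_app n (\<lambda>i j. block A (e i) (e j)) v = (\<lambda>i. hs_op (A \<cdot> x) \<cdot> e i)"
    by (rule ext) (simp add: mat_app_def block_app x_def bop_app_sum hs_op_sum bop_sum_app)
  then have "vec_norm n (mat_app n (\<lambda>i j. block A (e i) (e j)) v) \<le> norm (A \<cdot> x)"
    by (simp add: vec_norm_columns_le)
  moreover have "K * norm x \<le> K * 1" using v K \<open>norm x = vec_norm n v\<close> by (intro mult_left_mono) auto
  ultimately show "vec_norm n (mat_app n (\<lambda>i j. block A (e i) (e j)) v) \<le> K"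
    using bounded_byD[OF A, of x] by simp
qed

text \<open>Places \<open>a i j\<close> at row \<open>i\<close>, column \<open>j\<close>. The
  indices in \<open>e j \<boxtimes> e i\<close> match because right multiplication by it moves
  column \<open>j\<close> of an operator to column \<open>i\<close>.\<close>

definition mat_op :: "nat \<Rightarrow> (nat \<Rightarrow> nat \<Rightarrow> 'a bop) \<Rightarrow> 'a hs bop"
  where "mat_op n a = (\<Sum>i<n. \<Sum>j<n. right_mult (e j \<boxtimes> e i) \<circ>\<^sub>B left_mult (a i j))"

lemma cinner_mat_op:
  "cinner (mat_op n a \<cdot> x) y = (\<Sum>i<n. cinner (mat_app n a (\<lambda>j. hs_op x \<cdot> e j) i) (hs_op y \<cdot> e i))"
  by (simp add: mat_op_def bop_sum_app cinner_sum_left right_mult_rank_one cinner_ket_left mat_app_def)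

definition cut :: "('a bop \<Rightarrow> 'a bop) \<Rightarrow> nat \<Rightarrow> 'a hs bop \<Rightarrow> 'a hs bop"
  where "cut \<phi> n A = mat_op n (\<lambda>i j. \<phi> (block A (e i) (e j)))"

lemmas cinner_cut = cinner_mat_op[of _ "\<lambda>i j. _ (block _ (e i) (e j))", folded cut_def]

text \<open>Complete boundedness enters here: the bound does not depend on the size \<open>n\<close>
  of the corner.\<close>

lemma bounded_by_cut:
  assumes \<phi>: "\<And>n a. mat_norm n (\<lambda>i j. \<phi> (a i j)) \<le> C * mat_norm n a" and "0 \<le> C" and A: "bounded_by K A"
  shows "bounded_by (C * K) (cut \<phi> n A)"
proof (rule bounded_by_cinnerI)
  show CK: "0 \<le> C * K" using assms bounded_by_nonneg[OF A] by simp
  fix x y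
  let ?b = "\<lambda>i j. \<phi> (block A (e i) (e j))"
  have "mat_norm n ?b \<le> C * K"
    using order_trans[OF \<phi> mult_left_mono[OF mat_norm_block_le[OF A]]] \<open>0 \<le> C\<close> by blast
  have "cmod (cinner (cut \<phi> n A \<cdot> x) y) \<le>
      mat_norm n ?b * vec_norm n (\<lambda>j. hs_op x \<cdot> e j) * vec_norm n (\<lambda>j. hs_op y \<cdot> e j)"
    unfolding cinner_cut by (rule mat_form_le)
  also have "\<dots> \<le> C * K * norm x * norm y"
    by (rule mult_mono[OF mult_mono[OF \<open>mat_norm n ?b \<le> C * K\<close> vec_norm_columns_le] vec_norm_columns_le])
      (simp_all add: CK vec_norm_nonneg)
  finally show "cmod (cinner (cut \<phi> n A \<cdot> x) y) \<le> C * K * norm x * norm y" .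
qed

text \<open>Once the corner contains the indices \<open>i\<close> and \<open>j\<close>, this
  coefficient no longer depends on \<open>n\<close>.\<close>

lemma cut_ket_eventually:
  "\<forall>\<^sub>F n in sequentially. cinner (cut \<phi> n A \<cdot> ket v (e j)) (ket w (e i)) =
    cinner (\<phi> (block A (e i) (e j)) \<cdot> v) w"
proof -
  have "cinner (cut \<phi> n A \<cdot> ket v (e j)) (ket w (e i)) =
    cinner (\<phi> (block A (e i) (e j)) \<cdot> v) w" if "n \<ge> Suc (max i j)" for n
  proof -
    have "cinner (cut \<phi> n A \<cdot> ket v (e j)) (ket w (e i)) =
      (\<Sum>k<n. \<Sum>l<n. if k = i then if l = j then cinner (\<phi> (block A (e i) (e j)) \<cdot> v) w else 0 else 0)"
      unfolding cinner_cut mat_app_def cinner_sum_left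
      by (intro sum.cong refl) (simp add: cinner_e bop_scaleC cinner.ip_scaleC_right cinner_scaleC_left scaleC_one)
    also have "\<dots> = (\<Sum>k<n. if k = i then \<Sum>l<n. if l = j then cinner (\<phi> (block A (e i) (e j)) \<cdot> v) w else 0 else 0)"
      by (intro sum.cong refl) simp
    also have "\<dots> = cinner (\<phi> (block A (e i) (e j)) \<cdot> v) w"
    proof -
      have "i < n" "j < n" using that by auto
      then show ?thesis by simp
    qed
    finally show ?thesis .
  qed
  then show ?thesis unfolding eventually_sequentially by blast
qed

text \<open>\<open>\<Phi> A\<close> is the weak limit of the truncations
  \<open>cut \<phi> n A\<close>, so its blocks are the images of the blocks of \<open>A\<close>.
  Linearity and the prescribed values are read off from them, and normality follows from the
  criterion with one-sided compressions.\<close>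

lemma ex_extension:
  fixes \<phi> :: "'a bop \<Rightarrow> 'a bop"
  assumes "\<phi> \<in> CB_sigma"
  shows "\<exists>\<Phi>. clinear \<Phi> \<and> normal_map \<Phi> \<and>
    (\<forall>x y. \<Phi> (right_mult y \<circ>\<^sub>B left_mult x) = right_mult y \<circ>\<^sub>B left_mult (\<phi> x))"
proof -
  have \<phi>: "clinear \<phi>" "normal_map \<phi>" "completely_bounded \<phi>"
    using assms by (auto simp: CB_sigma_def)
  have \<phi>_simps: "\<phi> (A + B) = \<phi> A + \<phi> B" "\<phi> (c *\<^sub>C A) = c *\<^sub>C \<phi> A" for A B c
    using \<phi>(1) by (simp_all add: Vector_Spaces.linear_iff)
  obtain C0 where C0: "\<And>n a. mat_norm n (\<lambda>i j. \<phi> (a i j)) \<le> C0 * mat_norm n a"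
    using \<phi>(3) by (auto simp: completely_bounded_def)
  \<comment> \<open>The definition of complete boundedness states no sign for its constant.\<close>
  define C where "C = \<bar>C0\<bar>"
  have C: "0 \<le> C" "\<And>n a. mat_norm n (\<lambda>i j. \<phi> (a i j)) \<le> C * mat_norm n a"
    unfolding C_def using order_trans[OF C0 mult_right_mono[OF abs_ge_self mat_norm_nonneg]] by auto
  have lim_ex: "\<exists>T. bounded_by (C * K) T \<and> (\<forall>x y. (\<lambda>n. cinner (cut \<phi> n A \<cdot> x) y) \<longlonglongrightarrow> cinner (T \<cdot> x) y)"
    if "bounded_by K A" for A K
  proof (rule weak_limit[OF ket_exhaustion])
    show "bounded_by (C * K) (cut \<phi> n A)" for n by (rule bounded_by_cut[OF C(2,1) that])
    fix u v assume "u \<in> (\<Union>n. ket_basis n)" "v \<in> (\<Union>n. ket_basis n)"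
    then obtain i j k l where "u = ket (e i) (e j)" "v = ket (e k) (e l)"
      unfolding Un_ket_basis by blast
    then show "convergent (\<lambda>n. cinner (cut \<phi> n A \<cdot> u) v)"
      using tendsto_eventually[OF cut_ket_eventually] unfolding convergent_def by blast
  qed
  then have "\<forall>A. \<exists>T. \<forall>x y. (\<lambda>n. cinner (cut \<phi> n A \<cdot> x) y) \<longlonglongrightarrow> cinner (T \<cdot> x) y"
    using ex_bounded_by by metis
  then obtain \<Phi> where \<Phi>: "\<And>A x y. (\<lambda>n. cinner (cut \<phi> n A \<cdot> x) y) \<longlonglongrightarrow> cinner (\<Phi> A \<cdot> x) y"
    by metis
  \<comment> \<open>\<open>\<Phi>\<close> was chosen without reference to a particular bound
    \<open>K\<close>; uniqueness of weak limits lets it inherit each of them.\<close>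
  have \<Phi>_bounded: "bounded_by (C * K) (\<Phi> A)" if "bounded_by K A" for A K
  proof -
    obtain T where T: "bounded_by (C * K) T" "\<And>x y. (\<lambda>n. cinner (cut \<phi> n A \<cdot> x) y) \<longlonglongrightarrow> cinner (T \<cdot> x) y"
      using lim_ex[OF \<open>bounded_by K A\<close>] by blast
    have "\<Phi> A = T"
      by (intro bop_eqI cinner_ext LIMSEQ_unique[OF \<Phi> T(2)])
    then show ?thesis using T(1) by simp
  qed
  have \<Phi>_ket: "cinner (\<Phi> A \<cdot> ket v (e j)) (ket w (e i)) = cinner (\<phi> (block A (e i) (e j)) \<cdot> v) w" for A v w i j
    by (rule LIMSEQ_unique[OF \<Phi> tendsto_eventually[OF cut_ket_eventually]])
  have lin: "clinear \<Phi>"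
    by (rule clinearI; rule ket_ext)
      (simp_all add: \<Phi>_ket block_add block_scaleC \<phi>_simps cinner_add_left cinner_scaleC_left)
  have bimodule: "\<Phi> (right_mult y \<circ>\<^sub>B left_mult x) = right_mult y \<circ>\<^sub>B left_mult (\<phi> x)" for x y
  proof (rule ket_ext)
    fix i j k l
    have "cinner (\<Phi> (right_mult y \<circ>\<^sub>B left_mult x) \<cdot> ket (e k) (e j)) (ket (e l) (e i)) =
        cinner ((cinner (y \<cdot> e i) (e j) *\<^sub>C \<phi> x) \<cdot> e k) (e l)"
      by (simp only: \<Phi>_ket block_right_left_mult \<phi>_simps)
    also have "\<dots> = cinner ((right_mult y \<circ>\<^sub>B left_mult (\<phi> x)) \<cdot> ket (e k) (e j)) (ket (e l) (e i))"
      unfolding cinner_block[symmetric] block_right_left_mult ..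
    finally show "cinner (\<Phi> (right_mult y \<circ>\<^sub>B left_mult x) \<cdot> ket (e k) (e j)) (ket (e l) (e i)) =
        cinner ((right_mult y \<circ>\<^sub>B left_mult (\<phi> x)) \<cdot> ket (e k) (e j)) (ket (e l) (e i))" .
  qed
  have "normal_map \<Phi>"
  proof (rule normal_mapI)
    fix T :: "'a hs bop" assume T: "trace_class T"
    define P where "P n = basis_proj (ket_basis n)" for n
    show "\<exists>D. trace_class D \<and> (\<forall>A. pairing (\<Phi> A) T = pairing A D)"
    proof (rule normal_functional_representation[OF ket_exhaustion])
      obtain c where c: "c \<ge> 0" "\<And>A K. bounded_by K A \<Longrightarrow> cmod (pairing A T) \<le> c * K"
        using bounded_functional_bound[OF bounded_functional_pairing[OF T]] by blast
      have "cmod (pairing (\<Phi> A) T) \<le> c * C * K" if "bounded_by K A" for A K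
        using c(2)[OF \<Phi>_bounded[OF that]] by (simp add: mult.assoc)
      then show "bounded_functional (\<lambda>A. pairing (\<Phi> A) T)"
        unfolding bounded_functional_def using lin
        by (auto simp: Vector_Spaces.linear_iff pairing_add[OF T] pairing_scaleC[OF T])
      fix A :: "'a hs bop"
      obtain K where K: "bounded_by K A" using ex_bounded_by by blast
      have bdd: "bounded_by (C * (K * 1)) (\<Phi> (A \<circ>\<^sub>B P n))" for n
        unfolding P_def by (intro \<Phi>_bounded bounded_by_comp K bounded_by_exhaustion[OF ket_exhaustion])
      \<comment> \<open>For \<open>n > j\<close> the block of the compressed operator is the block
        of \<open>A\<close> composed with \<open>proj n\<close>, and the predual of
        \<open>v \<boxtimes> w\<close> under \<open>\<phi>\<close> gives convergence.\<close>
      have ket_lim: "(\<lambda>n. cinner (\<Phi> (A \<circ>\<^sub>B P n) \<cdot> ket v (e j)) (ket w (e i))) \<longlonglongrightarrow>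
          cinner (\<Phi> A \<cdot> ket v (e j)) (ket w (e i))" for v w i j
      proof -
        obtain D where D: "trace_class D" "\<And>a. pairing (\<phi> a) (v \<boxtimes> w) = pairing a D"
          using normal_map_predual[OF exhaustion \<phi>(1,2) trace_class_rank_one[of v w]] by blast
        have "\<forall>\<^sub>F n in sequentially. cinner (\<Phi> (A \<circ>\<^sub>B P n) \<cdot> ket v (e j)) (ket w (e i)) =
            pairing (block A (e i) (e j) \<circ>\<^sub>B proj n) D"
          unfolding eventually_sequentially
        proof (intro exI[of _ "Suc j"] allI impI)
          fix n assume "Suc j \<le> n"
          then have "block (A \<circ>\<^sub>B P n) (e i) (e j) = block A (e i) (e j) \<circ>\<^sub>B proj n"
            by (intro bop_eqI) (simp add: block_app P_def ket_proj_app)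
          then show "cinner (\<Phi> (A \<circ>\<^sub>B P n) \<cdot> ket v (e j)) (ket w (e i)) =
              pairing (block A (e i) (e j) \<circ>\<^sub>B proj n) D"
            by (simp only: \<Phi>_ket D(2)[symmetric] pairing_rank_one_right)
        qed
        moreover have "(\<lambda>n. pairing (block A (e i) (e j) \<circ>\<^sub>B proj n) D) \<longlonglongrightarrow> pairing (block A (e i) (e j)) D"
          unfolding proj_def by (rule pairing_comp_basis_proj_tendsto[OF exhaustion D(1)])
        ultimately have "(\<lambda>n. cinner (\<Phi> (A \<circ>\<^sub>B P n) \<cdot> ket v (e j)) (ket w (e i))) \<longlonglongrightarrow>
            pairing (block A (e i) (e j)) D"
          by (rule tendsto_cong[THEN iffD2])
        then show ?thesis by (simp only: \<Phi>_ket D(2)[symmetric] pairing_rank_one_right)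
      qed
      \<comment> \<open>Convergence on kets of basis vectors extends to all vectors, and the entries
        identify the limit as \<open>\<Phi> A\<close>.\<close>
      have "\<exists>T'. bounded_by (C * (K * 1)) T' \<and>
          (\<forall>x y. (\<lambda>n. cinner (\<Phi> (A \<circ>\<^sub>B P n) \<cdot> x) y) \<longlonglongrightarrow> cinner (T' \<cdot> x) y)"
        by (rule weak_limit[OF ket_exhaustion bdd]) (use convergentI[OF ket_lim] in \<open>auto simp: Un_ket_basis\<close>)
      then obtain T' where T': "\<And>x y. (\<lambda>n. cinner (\<Phi> (A \<circ>\<^sub>B P n) \<cdot> x) y) \<longlonglongrightarrow> cinner (T' \<cdot> x) y"
        by blast
      have "T' = \<Phi> A" by (rule ket_ext) (rule LIMSEQ_unique[OF T' ket_lim])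
      then show "(\<lambda>n. pairing (\<Phi> (A \<circ>\<^sub>B basis_proj (ket_basis n))) T) \<longlonglongrightarrow> pairing (\<Phi> A) T"
        using T' bdd by (intro pairing_tendsto[OF T]) (auto simp: P_def)
    qed
  qed
  then show ?thesis using lin bimodule by blast
qed

text \<open>By normality the functionals have trace class densities \<open>D\<close> and
  \<open>D'\<close>. Their matrix coefficients are values on matrix units, which are products of the
  prescribed kind.\<close>

lemma extension_unique:
  fixes \<Phi> \<Psi> :: "'a hs bop \<Rightarrow> 'a hs bop"
  assumes "clinear \<Phi>" "normal_map \<Phi>" "clinear \<Psi>" "normal_map \<Psi>"
    and eq: "\<And>x y. \<Phi> (right_mult y \<circ>\<^sub>B left_mult x) = \<Psi> (right_mult y \<circ>\<^sub>B left_mult (x :: 'a bop))"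
  shows "\<Phi> = \<Psi>"
proof (rule ext)
  fix A
  show "\<Phi> A = \<Psi> A"
  proof (rule bop_eqI, rule cinner_ext)
    fix x y
    obtain D where D: "trace_class D" "\<And>A. pairing (\<Phi> A) (x \<boxtimes> y) = pairing A D"
      using normal_map_predual[OF ket_exhaustion assms(1,2) trace_class_rank_one] by blast
    obtain D' where D': "trace_class D'" "\<And>A. pairing (\<Psi> A) (x \<boxtimes> y) = pairing A D'"
      using normal_map_predual[OF ket_exhaustion assms(3,4) trace_class_rank_one] by blast
    have "D = D'"
    proof (rule ket_ext)
      fix i j k l
      have "pairing (ket (e k) (e j) \<boxtimes> ket (e l) (e i)) D = pairing (ket (e k) (e j) \<boxtimes> ket (e l) (e i)) D'"
        by (simp only: ket_rank_one_ket D(2)[symmetric] D'(2)[symmetric] eq)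
      then show "cinner (D \<cdot> ket (e k) (e j)) (ket (e l) (e i)) = cinner (D' \<cdot> ket (e k) (e j)) (ket (e l) (e i))"
        by (simp only: pairing_rank_one_left D(1) D'(1))
    qed
    then show "cinner (\<Phi> A \<cdot> x) y = cinner (\<Psi> A \<cdot> x) y"
      by (simp only: pairing_rank_one_right[symmetric] D(2) D'(2))
  qed
qed

lemma tilde:
  fixes \<phi> :: "'a bop \<Rightarrow> 'a bop"
  assumes "\<phi> \<in> CB_sigma"
  shows clinear_tilde: "clinear (tilde \<phi>)" and normal_map_tilde: "normal_map (tilde \<phi>)"
    and tilde_right_left_mult: "\<And>x y. tilde \<phi> (right_mult y \<circ>\<^sub>B left_mult x) = right_mult y \<circ>\<^sub>B left_mult (\<phi> x)"
proof -
  let ?P = "\<lambda>\<Phi>. clinear \<Phi> \<and> normal_map \<Phi> \<and>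
    (\<forall>x y. \<Phi> (right_mult y \<circ>\<^sub>B left_mult x) = right_mult y \<circ>\<^sub>B left_mult (\<phi> x))"
  have "\<exists>!\<Phi>. ?P \<Phi>"
    using ex_extension[OF assms] extension_unique by (intro ex_ex1I) metis+
  from theI'[OF this] have "?P (tilde \<phi>)" unfolding tilde_def .
  then show "clinear (tilde \<phi>)" "normal_map (tilde \<phi>)"
    "\<And>x y. tilde \<phi> (right_mult y \<circ>\<^sub>B left_mult x) = right_mult y \<circ>\<^sub>B left_mult (\<phi> x)"
    by blast+
qed

lemma pairing_predual_map:
  assumes "clinear \<Phi>" "normal_map \<Phi>" "trace_class (T :: 'a hs bop)"
  shows "pairing A (predual_map \<Phi> T) = pairing (\<Phi> A) T"
proof -
  have "\<exists>!D. trace_class D \<and> (\<forall>A. pairing A D = pairing (\<Phi> A) T)"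
  proof (rule ex_ex1I)
    show "\<exists>D. trace_class D \<and> (\<forall>A. pairing A D = pairing (\<Phi> A) T)"
      using normal_map_predual[OF ket_exhaustion assms] by (simp only: eq_commute[of "pairing (\<Phi> _) T"])
    show "D = D'" if "trace_class D \<and> (\<forall>A. pairing A D = pairing (\<Phi> A) T)"
      "trace_class D' \<and> (\<forall>A. pairing A D' = pairing (\<Phi> A) T)" for D D'
      using that by (intro pairing_ext) auto
  qed
  from theI'[OF this] show ?thesis unfolding predual_map_def by blast
qed

end

section \<open>Positivity\<close>

lemma adj_basis_proj: "adj (basis_proj F) = basis_proj F"
proof (rule adj_eqI)
  show "cinner (basis_proj F \<cdot> x) y = cinner x (basis_proj F \<cdot> y)" for x y
    unfolding basis_proj_app cinner_sum_left cinner_sum_right cinner_scaleC_left cinner.ip_scaleC_right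
    by (intro sum.cong refl) (simp add: mult.commute flip: cinner_commute)
qed

lemma basis_proj_idem:
  assumes "finite F" "orthonormal F"
  shows "basis_proj F \<cdot> basis_proj F \<cdot> x = basis_proj F \<cdot> x"
  unfolding basis_proj_app
  by (intro sum.cong refl) (simp add: cinner_orthonormal_sum[OF assms(2,1) order_refl])

definition positive :: "'a::complex_inner bop \<Rightarrow> bool"
  where "positive A \<longleftrightarrow> (\<forall>x. 0 \<le> cinner (A \<cdot> x) x)"

text \<open>In the order on complex numbers \<open>0 \<le> z\<close> includes that \<open>z\<close>
  is real. Polarizing with \<open>x + y\<close>, and once more with \<open>\<i> *\<^sub>C x\<close>,
  yields symmetry.\<close>

lemma positive_hermitian:
  assumes "positive A"
  shows "cinner x (A \<cdot> y) = cinner (A \<cdot> x) y"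
proof -
  have real: "Im (cinner (A \<cdot> x) x) = 0" for x
    using assms by (simp add: positive_def less_eq_complex_def)
  have sym: "Im (cinner (A \<cdot> x) y) = - Im (cinner (A \<cdot> y) x)" for x y
    using real[of "x + y"] real[of x] real[of y] by (simp add: bop_add cinner_add_left cinner.ip_add_right)
  have "cinner (A \<cdot> x) y = cnj (cinner (A \<cdot> y) x)"
    using sym[of x y] sym[of "\<i> *\<^sub>C x" y]
    by (simp add: complex_eq_iff bop_scaleC cinner_scaleC_left cinner.ip_scaleC_right)
  then show ?thesis by (simp flip: cinner_commute)
qed

lemma positive_null:
  assumes A: "positive A" and g: "cinner (A \<cdot> g) g = 0"
  shows "A \<cdot> g = 0"
proof (rule ccontr)
  let ?y = "A \<cdot> g"
  assume "?y \<noteq> 0"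
  then have n: "(norm ?y)\<^sup>2 > 0" by simp
  define b where "b = Re (cinner (A \<cdot> ?y) ?y)"
  \<comment> \<open>Moving from \<open>?y\<close> along \<open>g\<close> changes the form linearly,
    as its value at \<open>g\<close> vanishes; this \<open>s\<close> brings the value down to
    \<open>- 1\<close>.\<close>
  define s where "s = - (b + 1) / (2 * (norm ?y)\<^sup>2)"
  have g': "cinner g (A \<cdot> g) = 0" using g positive_hermitian[OF A, of g g] by simp
  have "cinner (A \<cdot> (?y + complex_of_real s *\<^sub>C g)) (?y + complex_of_real s *\<^sub>C g) =
      cinner (A \<cdot> ?y) ?y + 2 * complex_of_real s * cinner ?y ?y"
    by (simp add: bop_add bop_scaleC cinner_add_left cinner.ip_add_right cinner_scaleC_left
        cinner.ip_scaleC_right g g' positive_hermitian[OF A, symmetric])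
  then have "0 \<le> Re (cinner (A \<cdot> ?y) ?y + 2 * complex_of_real s * cinner ?y ?y)"
    using A by (metis positive_def less_eq_complex_def zero_complex.sel(1))
  also have "\<dots> = b + 2 * s * (norm ?y)\<^sup>2"
    by (simp add: b_def cinner.ip_self flip: of_real_power)
  also have "\<dots> = - 1" using n by (simp add: s_def) (simp add: field_simps)
  finally show False by simp
qed

text \<open>If \<open>cinner (A \<cdot> g) g = 0\<close>, then \<open>A' = A\<close> because \<open>inverse 0 = 0\<close>, and \<open>A \<cdot> g = 0\<close>.\<close>

lemma positive_Schur_complement:
  fixes A :: "'a::complex_inner bop" and g :: 'a
  assumes A: "positive A"
  defines "A' \<equiv> A - inverse (cinner (A \<cdot> g) g) *\<^sub>C ((A \<cdot> g) \<boxtimes> (A \<cdot> g))"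
  shows "positive A'" "A' \<cdot> g = 0"
proof -
  let ?\<gamma> = "cinner (A \<cdot> g) g"
  note herm = positive_hermitian[OF A]
  have cnj\<gamma>: "cnj ?\<gamma> = ?\<gamma>" using herm[of g g] by (simp flip: cinner_commute)
  show "A' \<cdot> g = 0"
  proof (cases "?\<gamma> = 0")
    case True
    then show ?thesis using positive_null[OF A] by (simp add: A'_def)
  next
    case False
    then show ?thesis by (simp add: A'_def herm scaleC_scaleC scaleC_one)
  qed
  show "positive A'"
  proof (cases "?\<gamma> = 0")
    case True
    then show ?thesis using A by (simp add: A'_def)
  next
    case False
    \<comment> \<open>Completing the square: the multiple of \<open>g\<close> removed from
      \<open>x\<close> is the one that minimizes the form of \<open>A\<close>.\<close>
    have "cinner (A' \<cdot> x) x = cinner (A \<cdot> (x - (cinner (A \<cdot> x) g / ?\<gamma>) *\<^sub>C g)) (x - (cinner (A \<cdot> x) g / ?\<gamma>) *\<^sub>C g)" for x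
      using False
      by (simp add: A'_def herm bop_diff bop_scaleC cinner.ip_diff_left cinner.ip_diff_right cinner_scaleC_left
          cinner.ip_scaleC_right cnj\<gamma> field_simps)
    then show ?thesis using A by (simp add: positive_def)
  qed
qed

text \<open>Each induction step splits off a nonnegative multiple of
  \<open>(A \<cdot> g) \<boxtimes> (A \<cdot> g)\<close>. The Schur complement kills
  \<open>g\<close>, so it depends only on the coordinates in the smaller set.\<close>

lemma pairing_nonneg_finite:
  fixes A :: "'a::chilbert_space bop"
  assumes "finite F" and D: "trace_class D" "\<And>h. 0 \<le> pairing (h \<boxtimes> h) D"
    and "positive A" and "\<And>x. A \<cdot> x = (\<Sum>e\<in>F. cinner x e *\<^sub>C (A \<cdot> e))"
  shows "0 \<le> pairing A D"
  using assms(1,4,5)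
proof (induction F arbitrary: A)
  case empty
  then have "A = 0" by (intro bop_eqI) simp
  then show ?case by (simp add: pairing_zero[OF D(1)])
next
  case (insert g F)
  let ?\<gamma> = "cinner (A \<cdot> g) g" and ?h = "A \<cdot> g"
  let ?A' = "A - inverse ?\<gamma> *\<^sub>C (?h \<boxtimes> ?h)"
  have A': "positive ?A'" "?A' \<cdot> g = 0"
    using positive_Schur_complement[OF insert.prems(1), of g] by auto
  \<comment> \<open>The subtracted term has the same coordinate expansion, since
    \<open>cinner x ?h = cinner (A \<cdot> x) g\<close>; the summand at \<open>g\<close> then drops
    out.\<close>
  have "?A' \<cdot> x = (\<Sum>e\<in>F. cinner x e *\<^sub>C (?A' \<cdot> e))" for x
  proof -
    have "cinner x ?h = cinner (A \<cdot> x) g"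
      by (rule positive_hermitian[OF insert.prems(1)])
    also have "\<dots> = (\<Sum>e\<in>insert g F. cinner x e * cinner (A \<cdot> e) g)"
      by (subst insert.prems(2)) (simp only: cinner_sum_left cinner_scaleC_left)
    also have "\<dots> = (\<Sum>e\<in>insert g F. cinner x e * cinner e ?h)"
      by (simp only: positive_hermitian[OF insert.prems(1)])
    finally have x: "cinner x ?h = (\<Sum>e\<in>insert g F. cinner x e * cinner e ?h)" .
    have "?A' \<cdot> x = (\<Sum>e\<in>insert g F. cinner x e *\<^sub>C (A \<cdot> e)) - inverse ?\<gamma> *\<^sub>C (cinner x ?h *\<^sub>C ?h)"
      by (simp only: bop_simps rank_one_app insert.prems(2)[of x])
    also have "\<dots> = (\<Sum>e\<in>insert g F. cinner x e *\<^sub>C (A \<cdot> e) - (inverse ?\<gamma> * (cinner x e * cinner e ?h)) *\<^sub>C ?h)"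
      by (simp only: x scaleC_scaleC sum_subtractf complex_vector.scale_sum_left complex_vector.scale_sum_right)
    also have "\<dots> = (\<Sum>e\<in>insert g F. cinner x e *\<^sub>C (?A' \<cdot> e))"
      by (simp add: complex_vector.scale_right_diff_distrib scaleC_scaleC mult_ac)
    also have "\<dots> = (\<Sum>e\<in>F. cinner x e *\<^sub>C (?A' \<cdot> e))"
      by (subst sum.insert[OF insert.hyps]) (simp only: A'(2) complex_vector.scale_zero_right add_0)
    finally show ?thesis .
  qed
  from insert.IH[OF A'(1) this] have "0 \<le> pairing ?A' D" .
  moreover have "0 \<le> inverse ?\<gamma>"
  proof -
    have "0 \<le> ?\<gamma>" using insert.prems(1) by (simp add: positive_def)
    then show ?thesis by (simp add: less_eq_complex_def)
  qed
  then have "0 \<le> inverse ?\<gamma> * pairing (?h \<boxtimes> ?h) D" using D(2) by (rule mult_nonneg_nonneg)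
  moreover have "pairing A D = pairing ?A' D + inverse ?\<gamma> * pairing (?h \<boxtimes> ?h) D"
    by (simp add: pairing_diff[OF D(1)] pairing_scaleC[OF D(1)])
  ultimately show ?case by simp
qed

lemma complex_nonneg_LIMSEQ:
  fixes z :: "nat \<Rightarrow> complex"
  assumes "z \<longlonglongrightarrow> l" "\<And>n. 0 \<le> z n"
  shows "0 \<le> l"
proof -
  have "(\<lambda>n. Re (z n)) \<longlonglongrightarrow> Re l" "(\<lambda>n. Im (z n)) \<longlonglongrightarrow> Im l"
    using assms(1) by (auto intro: tendsto_Re tendsto_Im)
  moreover have "0 \<le> Re (z n)" "Im (z n) = 0" for n
    using assms(2)[of n] by (auto simp: less_eq_complex_def)
  ultimately have "0 \<le> Re l" "Im l = 0"
    by (auto intro: LIMSEQ_le_const LIMSEQ_unique)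
  then show ?thesis by (simp add: less_eq_complex_def)
qed

text \<open>Two-sided compressions are taken because they preserve positivity; they converge weakly
  with a common bound.\<close>

lemma pairing_nonneg:
  fixes E :: "nat \<Rightarrow> 'a::chilbert_space set" and A :: "'a bop"
  assumes E: "onb_exhaustion E" and D: "trace_class D" "\<And>h. 0 \<le> pairing (h \<boxtimes> h) D" and A: "positive A"
  shows "0 \<le> pairing A D"
proof (rule complex_nonneg_LIMSEQ)
  define P where "P n = basis_proj (E n)" for n
  obtain K where K: "bounded_by K A" using ex_bounded_by by blast
  have P_adj: "cinner (P n \<cdot> x) y = cinner x (P n \<cdot> y)" for n x y
    using cinner_adj_left[of "P n" x y] by (simp add: P_def adj_basis_proj)
  show "(\<lambda>n. pairing (P n \<circ>\<^sub>B (A \<circ>\<^sub>B P n)) D) \<longlonglongrightarrow> pairing A D"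
  proof (rule pairing_tendsto[OF D(1)])
    show "bounded_by (1 * (K * 1)) (P n \<circ>\<^sub>B (A \<circ>\<^sub>B P n))" for n
      unfolding P_def by (intro bounded_by_comp K bounded_by_exhaustion[OF E])
    show "(\<lambda>n. cinner ((P n \<circ>\<^sub>B (A \<circ>\<^sub>B P n)) \<cdot> x) y) \<longlonglongrightarrow> cinner (A \<cdot> x) y" for x y
      unfolding bop_comp_app P_adj unfolding P_def
      by (intro tendsto_cinner tendsto_bop_app basis_proj_tendsto[OF E])
  qed
  show "0 \<le> pairing (P n \<circ>\<^sub>B (A \<circ>\<^sub>B P n)) D" for n
  proof (rule pairing_nonneg_finite[OF onb_exhaustion_finite[OF E, of n] D])
    show "positive (P n \<circ>\<^sub>B (A \<circ>\<^sub>B P n))"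
      using A by (simp add: positive_def P_adj)
    fix x
    have "(P n \<circ>\<^sub>B (A \<circ>\<^sub>B P n)) \<cdot> x = (P n \<circ>\<^sub>B (A \<circ>\<^sub>B P n)) \<cdot> (P n \<cdot> x)"
      unfolding P_def
      by (simp add: basis_proj_idem onb_exhaustion_finite[OF E] onb_exhaustion_orthonormal[OF E])
    then show "(P n \<circ>\<^sub>B (A \<circ>\<^sub>B P n)) \<cdot> x = (\<Sum>e\<in>E n. cinner x e *\<^sub>C ((P n \<circ>\<^sub>B (A \<circ>\<^sub>B P n)) \<cdot> e))"
      by (simp only: P_def[of n] basis_proj_app[of _ x] bop_app_sum[of "_ \<circ>\<^sub>B _"] bop_scaleC[of "_ \<circ>\<^sub>B _"])
  qed
qed

section \<open>Rank and range of Hilbert-Schmidt operators\<close>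

text \<open>If \<open>z\<close> is orthogonal to the range, left multiplication by
  \<open>z \<boxtimes> z\<close> annihilates \<open>x\<close>, so \<open>z = 0\<close>. Hence the
  normalized nonzero images of singular vectors form an orthonormal basis, whose finite sums lie in
  the range.\<close>

lemma separating_dense_range:
  assumes x: "separating x"
  shows "\<exists>b :: nat \<Rightarrow> 'a::chilbert_space. (\<lambda>n. hs_op x \<cdot> b n) \<longlonglongrightarrow> y"
proof -
  let ?S = "hs_op x"
  obtain B where B: "is_onb B" and ortho: "\<And>e f. e \<in> B \<Longrightarrow> f \<in> B \<Longrightarrow> e \<noteq> f \<Longrightarrow> cinner (?S \<cdot> e) (?S \<cdot> f) = 0"
    using singular_value_decomposition[OF hilbert_schmidt_hs_op, of x] by blast
  define g where "g e = complex_of_real (inverse (norm (?S \<cdot> e))) *\<^sub>C e" for e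
  define N where "N = {e \<in> B. ?S \<cdot> e \<noteq> 0}"
  define C where "C = (\<lambda>e. ?S \<cdot> g e) ` N"
  have "orthonormal C"
    unfolding orthonormal_def C_def
    by (auto simp: N_def g_def bop_scaleC norm_scaleC norm_inverse cinner_scaleC_left cinner.ip_scaleC_right intro!: ortho)
  moreover have "z = 0" if z: "\<forall>c\<in>C. cinner z c = 0" for z
  proof -
    have "\<forall>e\<in>B. cinner (adj ?S \<cdot> z) e = 0"
    proof
      fix e assume "e \<in> B"
      show "cinner (adj ?S \<cdot> z) e = 0"
      proof (cases "?S \<cdot> e = 0")
        case False
        then have "cinner z (?S \<cdot> g e) = 0" using z \<open>e \<in> B\<close> by (simp add: C_def N_def)
        then show ?thesis using False by (simp add: g_def bop_scaleC cinner.ip_scaleC_right cinner_adj_left)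
      qed (simp add: cinner_adj_left)
    qed
    then have *: "adj ?S \<cdot> z = 0" using B unfolding is_onb_def by blast
    have "left_mult (z \<boxtimes> z) \<cdot> x = 0"
      by (rule hs_eqI, rule bop_eqI) (simp add: rank_one_comp *)
    then have "z \<boxtimes> z = 0" using x by (simp add: separating_def)
    then have "cinner z z *\<^sub>C z = 0" by (metis bop_simps(1) rank_one_app)
    then show "z = 0" by (auto dest: cinner.ip_eq_zero)
  qed
  ultimately have "is_onb C" by (simp add: is_onb_def)
  then obtain F :: "nat \<Rightarrow> 'a set" where F: "\<forall>n. F n \<subseteq> C" "(\<lambda>n. \<Sum>c\<in>F n. cinner y c *\<^sub>C c) \<longlonglongrightarrow> y"
    using onb_expansion[of C y] by blast
  have "\<forall>c\<in>C. \<exists>b. ?S \<cdot> b = c" by (auto simp: C_def)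
  then obtain f where f: "\<And>c. c \<in> C \<Longrightarrow> ?S \<cdot> f c = c" by metis
  have "?S \<cdot> (\<Sum>c\<in>F n. cinner y c *\<^sub>C f c) = (\<Sum>c\<in>F n. cinner y c *\<^sub>C c)" for n
    unfolding bop_app_sum bop_scaleC using F(1) f by (intro sum.cong refl) auto
  then show ?thesis
    using F(2) by (intro exI[of _ "\<lambda>n. \<Sum>c\<in>F n. cinner y c *\<^sub>C f c"]) simp
qed

lemma orthogonal_independent:
  fixes X :: "'a::complex_inner set"
  assumes "\<And>x y. x \<in> X \<Longrightarrow> y \<in> X \<Longrightarrow> x \<noteq> y \<Longrightarrow> cinner x y = 0" "0 \<notin> X"
  shows "complex_vector.independent X"
proof
  assume "complex_vector.dependent X"
  then obtain F u v where F: "finite F" "F \<subseteq> X" "(\<Sum>x\<in>F. u x *\<^sub>C x) = 0" "v \<in> F" "u v \<noteq> 0"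
    unfolding complex_vector.dependent_explicit by blast
  have "0 = (\<Sum>x\<in>F. u x * cinner x v)"
    using arg_cong[OF F(3), of "\<lambda>z. cinner z v"] by (simp add: cinner_sum_left cinner_scaleC_left)
  also have "\<dots> = (\<Sum>x\<in>F. if x = v then u v * cinner v v else 0)"
    using F assms(1) by (intro sum.cong refl) auto
  also have "\<dots> = u v * cinner v v" using F by simp
  finally have "cinner v v = 0" using F(5) by simp
  then show False using cinner.ip_eq_zero[of v] F assms(2) by auto
qed

text \<open>The nonzero images of singular vectors are orthogonal, hence independent in the range,
  so at most \<open>k\<close> singular vectors contribute.\<close>

lemma op_rank_le_imp_sum_ket:
  assumes "op_rank (hs_op x) \<le> enat k"
  obtains a b where "x = (\<Sum>l<k. ket (a l) (b l :: 'a::chilbert_space))"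
proof -
  let ?S = "hs_op x" and ?R = "range (bop_app (hs_op x))"
  obtain B where B: "is_onb B" and ortho: "\<And>e f. e \<in> B \<Longrightarrow> f \<in> B \<Longrightarrow> e \<noteq> f \<Longrightarrow> cinner (?S \<cdot> e) (?S \<cdot> f) = 0"
    using singular_value_decomposition[OF hilbert_schmidt_hs_op, of x] by blast
  define N where "N = {e \<in> B. ?S \<cdot> e \<noteq> 0}"
  have inj: "inj_on (bop_app ?S) N"
  proof (rule inj_onI, rule ccontr)
    fix e f assume "e \<in> N" "f \<in> N" "?S \<cdot> e = ?S \<cdot> f" "e \<noteq> f"
    then have "cinner (?S \<cdot> e) (?S \<cdot> e) = 0" "?S \<cdot> e \<noteq> 0"
      using ortho[of e f] by (auto simp: N_def)
    then show False using cinner.ip_eq_zero by blast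
  qed
  have indep: "complex_vector.independent (bop_app ?S ` N)"
    by (rule orthogonal_independent) (auto simp: N_def intro!: ortho)
  have fin: "\<exists>D. finite D \<and> ?R \<subseteq> complex_vector.span D" and dim: "complex_vector.dim ?R \<le> k"
    using assms by (auto simp: op_rank_def split: if_splits)
  obtain D where D: "finite D" "?R \<subseteq> complex_vector.span D" using fin by blast
  obtain C where C: "C \<subseteq> ?R" "complex_vector.independent C" "?R \<subseteq> complex_vector.span C"
    "card C = complex_vector.dim ?R"
    using complex_vector.basis_exists[of ?R] by blast
  have "finite C"
    using complex_vector.independent_span_bound[OF D(1) C(2)] C(1) D(2) by blast
  then have "finite (bop_app ?S ` N) \<and> card (bop_app ?S ` N) \<le> card C"
    by (rule complex_vector.independent_span_bound[OF _ indep]) (use C(3) in blast)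
  then have N: "finite N" "card N \<le> k"
    using inj C(4) dim by (auto simp: card_image finite_image_iff)
  obtain h where h: "bij_betw h {..<card N} N"
    using ex_bij_betw_nat_finite[OF N(1)] by (auto simp: atLeast0LessThan)
  \<comment> \<open>Padding by zero vectors turns a shorter sum into one of exactly \<open>k\<close>
    terms.\<close>
  define b where "b l = (if l < card N then h l else 0)" for l
  have "(\<Sum>l<k. (?S \<cdot> b l) \<boxtimes> b l) = (\<Sum>l<card N. (?S \<cdot> h l) \<boxtimes> h l)"
    using N(2) by (intro sum.mono_neutral_cong_right) (auto simp: b_def intro!: bop_eqI)
  also have "\<dots> = (\<Sum>e\<in>N. (?S \<cdot> e) \<boxtimes> e)"
    by (rule sum.reindex_bij_betw[OF h])
  also have "\<dots> = ?S"
  proof -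
    have B': "orthonormal B" using B by (simp add: is_onb_def)
    have "?S - (\<Sum>e\<in>N. (?S \<cdot> e) \<boxtimes> e) = 0"
    proof (rule onb_zero[OF B])
      fix f assume f: "f \<in> B"
      have "(\<Sum>e\<in>N. cinner f e *\<^sub>C (?S \<cdot> e)) = (\<Sum>e\<in>N. if e = f then ?S \<cdot> f else 0)"
        using f by (intro sum.cong refl) (auto simp: N_def orthonormal_cinner[OF B'] scaleC_one)
      also have "\<dots> = ?S \<cdot> f" using N(1) f by (auto simp: N_def)
      finally show "(?S - (\<Sum>e\<in>N. (?S \<cdot> e) \<boxtimes> e)) \<cdot> f = 0" by (simp add: bop_sum_app)
    qed
    then show ?thesis by simp
  qed
  finally have "x = (\<Sum>l<k. ket (?S \<cdot> b l) (b l))"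
    by (intro hs_eqI) (simp add: hs_op_sum)
  then show ?thesis by (rule that)
qed

lemma op_rank_sum_ket_le: "op_rank (hs_op (\<Sum>l<k. ket (a l) (b l :: 'a::chilbert_space))) \<le> enat k"
proof -
  let ?x = "hs_op (\<Sum>l<k. ket (a l) (b l))"
  have "?x \<cdot> z \<in> complex_vector.span (a ` {..<k})" for z
    unfolding hs_op_sum bop_sum_app hs_op_ket rank_one_app
    by (rule complex_vector.span_sum, rule complex_vector.span_scale, rule complex_vector.span_base) simp
  then have sub: "range (bop_app ?x) \<subseteq> complex_vector.span (a ` {..<k})" by blast
  then have "complex_vector.dim (range (bop_app ?x)) \<le> card (a ` {..<k})"
    by (rule complex_vector.dim_le_card) simp
  also have "\<dots> \<le> k" using card_image_le[of "{..<k}" a] by simp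
  finally show ?thesis
    using sub unfolding op_rank_def by (auto intro!: exI[of _ "a ` {..<k}"])
qed

section \<open>Positivity of the extension\<close>

definition schur_form :: "('a::chilbert_space bop \<Rightarrow> 'a bop) \<Rightarrow> nat \<Rightarrow> (nat \<Rightarrow> 'a) \<Rightarrow> (nat \<Rightarrow> 'a) \<Rightarrow> complex"
  where "schur_form \<phi> k h v = (\<Sum>l<k. \<Sum>m<k. cinner (\<phi> (h l \<boxtimes> h m) \<cdot> v m) (v l))"

lemma clinear_sum: "clinear \<Phi> \<Longrightarrow> \<Phi> (sum f F) = (\<Sum>i\<in>F. \<Phi> (f i))"
  by (rule module_hom.sum[where ?s1.0 = scaleC and ?s2.0 = scaleC]) (simp add: Vector_Spaces.linear_def)

lemma rank_one_sum: "(\<Sum>i\<in>F. f i) \<boxtimes> (\<Sum>j\<in>G. g j) = (\<Sum>i\<in>F. \<Sum>j\<in>G. f i \<boxtimes> g j)"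
  by (rule bop_eqI)
    (simp add: bop_sum_app cinner_sum_right complex_vector.scale_sum_left complex_vector.scale_sum_right)

context onb_sequence
begin

context
  fixes \<phi> :: "'a bop \<Rightarrow> 'a bop"
  assumes \<phi>: "\<phi> \<in> CB_sigma"
begin

lemma CB_sigma_predual: "trace_class T \<Longrightarrow> \<exists>D. trace_class D \<and> (\<forall>A. pairing (\<phi> A) T = pairing A D)"
  using \<phi> by (intro normal_map_predual[OF exhaustion]) (auto simp: CB_sigma_def)

text \<open>Normality shows that \<open>\<phi> (h \<boxtimes> h')\<close>, tested at
  \<open>v\<close> and \<open>w\<close>, is a bounded form in \<open>h\<close> and
  \<open>h'\<close>; this allows limits in the first argument of \<open>schur_form\<close>.\<close>

lemma CB_sigma_rank_one: "\<exists>D. \<forall>h h'. cinner (\<phi> (h \<boxtimes> h') \<cdot> v) w = cinner (D \<cdot> h) h'"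
proof -
  obtain D where D: "trace_class D" "\<And>A. pairing (\<phi> A) (v \<boxtimes> w) = pairing A D"
    using CB_sigma_predual[OF trace_class_rank_one] by blast
  have "cinner (\<phi> (h \<boxtimes> h') \<cdot> v) w = cinner (D \<cdot> h) h'" for h h'
    using D(2)[of "h \<boxtimes> h'"] by (simp only: pairing_rank_one_right pairing_rank_one_left[OF D(1)])
  then show ?thesis by blast
qed

text \<open>Both sides are of the form \<open>cinner (D \<cdot> x) y\<close> with a bounded operator \<open>D\<close>, so that it suffices
  to compare them on operators of rank one.\<close>

lemma cinner_tilde_rank_one:
  "cinner (tilde \<phi> (x \<boxtimes> y) \<cdot> ket a b) (ket a' b') = cinner (\<phi> ((hs_op x \<cdot> b') \<boxtimes> (hs_op y \<cdot> b)) \<cdot> a) a'"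
proof -
  obtain D where D: "trace_class D" "\<And>A. pairing (tilde \<phi> A) (ket a b \<boxtimes> ket a' b') = pairing A D"
    using normal_map_predual[OF ket_exhaustion clinear_tilde[OF \<phi>] normal_map_tilde[OF \<phi>] trace_class_rank_one]
    by blast
  have D': "cinner (tilde \<phi> (x \<boxtimes> y) \<cdot> ket a b) (ket a' b') = cinner (D \<cdot> x) y" for x y
    using D(2)[of "x \<boxtimes> y"] by (simp only: pairing_rank_one_right pairing_rank_one_left[OF D(1)])
  obtain D0 where D0: "\<And>h h'. cinner (\<phi> (h \<boxtimes> h') \<cdot> a) a' = cinner (D0 \<cdot> h) h'"
    using CB_sigma_rank_one by blast
  have R: "cinner ((left_mult D0 \<circ>\<^sub>B right_mult (b' \<boxtimes> b)) \<cdot> x) y = cinner (\<phi> ((hs_op x \<cdot> b') \<boxtimes> (hs_op y \<cdot> b)) \<cdot> a) a'" for x y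
    by (simp add: right_mult_rank_one left_mult_ket cinner_ket_left D0)
  \<comment> \<open>On kets \<open>x \<boxtimes> y\<close> is a product of a right and a left
    multiplication, so the coefficients of \<open>D\<close> are explicit and factor into an
    elementary tensor.\<close>
  have "D = left_mult D0 \<circ>\<^sub>B right_mult (b' \<boxtimes> b)"
  proof (rule ket_ext)
    fix i j k l
    have "cinner (D \<cdot> ket (e k) (e j)) (ket (e l) (e i)) =
        cinner (right_mult (e i \<boxtimes> e j) \<cdot> left_mult (\<phi> (e k \<boxtimes> e l)) \<cdot> ket a b) (ket a' b')"
      unfolding D'[symmetric] ket_rank_one_ket tilde_right_left_mult[OF \<phi>] bop_comp_app ..
    also have "\<dots> = cinner (e i) b * cinner b' (e j) * cinner (D0 \<cdot> e k) (e l)"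
      by (simp add: right_mult_rank_one left_mult_ket cinner_ket_left cinner_ket_right ket_algebra cinner_scaleC_left
          cinner.ip_scaleC_right D0 mult_ac flip: cinner_commute)
    also have "\<dots> = cinner (D0 \<cdot> hs_op (ket (e k) (e j)) \<cdot> b') (hs_op (ket (e l) (e i)) \<cdot> b)"
      by (simp add: bop_scaleC cinner_scaleC_left cinner.ip_scaleC_right mult_ac flip: cinner_commute)
    also have "\<dots> = cinner ((left_mult D0 \<circ>\<^sub>B right_mult (b' \<boxtimes> b)) \<cdot> ket (e k) (e j)) (ket (e l) (e i))"
      by (simp only: R D0)
    finally show "cinner (D \<cdot> ket (e k) (e j)) (ket (e l) (e i)) =
        cinner ((left_mult D0 \<circ>\<^sub>B right_mult (b' \<boxtimes> b)) \<cdot> ket (e k) (e j)) (ket (e l) (e i))" .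
  qed
  then show ?thesis by (simp only: D' R)
qed

lemma cinner_tilde_sum_ket:
  assumes "x = (\<Sum>l<k. ket (a l) (b l))"
  shows "cinner (tilde \<phi> (y \<boxtimes> y) \<cdot> x) x = schur_form \<phi> k (\<lambda>l. hs_op y \<cdot> b l) a"
proof -
  have "cinner (tilde \<phi> (y \<boxtimes> y) \<cdot> x) x =
      (\<Sum>l<k. \<Sum>m<k. cinner (tilde \<phi> (y \<boxtimes> y) \<cdot> ket (a m) (b m)) (ket (a l) (b l)))"
    by (simp only: assms bop_app_sum cinner_sum_right cinner_sum_left)
  then show ?thesis by (simp only: cinner_tilde_rank_one schur_form_def)
qed

text \<open>Here \<open>x \<boxtimes> x\<close> is a finite sum of matrix units, so linearity and
  the prescribed values of \<open>tilde \<phi>\<close> give the result directly.\<close>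

lemma cinner_tilde_sum_ket':
  assumes "x = (\<Sum>l<k. ket (a l) (b l))"
  shows "cinner (tilde \<phi> (x \<boxtimes> x) \<cdot> y) y = schur_form \<phi> k a (\<lambda>l. hs_op y \<cdot> b l)"
proof -
  have "tilde \<phi> (x \<boxtimes> x) = (\<Sum>l<k. \<Sum>m<k. right_mult (b m \<boxtimes> b l) \<circ>\<^sub>B left_mult (\<phi> (a l \<boxtimes> a m)))"
    by (simp only: assms rank_one_sum clinear_sum[OF clinear_tilde[OF \<phi>]] ket_rank_one_ket tilde_right_left_mult[OF \<phi>])
  then show ?thesis
    by (simp add: bop_sum_app cinner_sum_left right_mult_rank_one cinner_ket_left schur_form_def)
qed

text \<open>Matrices \<open>h i \<boxtimes> h j\<close> are positive, as their form is
  \<open>s * cnj s\<close>. Conversely, \<open>v\<close> is encoded as a vector \<open>x\<close> of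
  H and the matrix as \<open>mat_op k a\<close>; the density \<open>D\<close> of the functional
  given by \<open>x\<close> is nonnegative on every \<open>h \<boxtimes> h\<close>, as this value is
  \<open>schur_form\<close> at the columns of \<open>h\<close>.\<close>

lemma k_positive_iff_schur_form: "k_positive k \<phi> \<longleftrightarrow> (\<forall>h v. 0 \<le> schur_form \<phi> k h v)"
proof
  assume pos: "k_positive k \<phi>"
  show "\<forall>h v. 0 \<le> schur_form \<phi> k h v"
  proof (intro allI)
    fix h v :: "nat \<Rightarrow> 'a"
    have "mat_positive k (\<lambda>i j. h i \<boxtimes> h j)"
      unfolding mat_positive_def
    proof
      fix w :: "nat \<Rightarrow> 'a"
      define s where "s = (\<Sum>j<k. cinner (w j) (h j))"
      have "(\<Sum>i<k. cinner (mat_app k (\<lambda>i j. h i \<boxtimes> h j) w i) (w i)) = s * (\<Sum>i<k. cinner (h i) (w i))"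
        by (simp add: s_def mat_app_def cinner_sum_left cinner_scaleC_left flip: sum_distrib_left sum_distrib_right)
      also have "(\<Sum>i<k. cinner (h i) (w i)) = cnj s"
        by (simp add: s_def flip: cinner_commute)
      also have "s * cnj s = complex_of_real ((cmod s)\<^sup>2)" by (rule complex_norm_square[symmetric])
      also have "0 \<le> \<dots>" unfolding less_eq_complex_def by simp
      finally show "0 \<le> (\<Sum>i<k. cinner (mat_app k (\<lambda>i j. h i \<boxtimes> h j) w i) (w i))" .
    qed
    then have "mat_positive k (\<lambda>i j. \<phi> (h i \<boxtimes> h j))"
      using pos by (simp add: k_positive_def)
    then show "0 \<le> schur_form \<phi> k h v"
      by (simp add: mat_positive_def mat_app_def schur_form_def cinner_sum_left)
  qed
next
  assume Q: "\<forall>h v. 0 \<le> schur_form \<phi> k h v"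
  show "k_positive k \<phi>"
    unfolding k_positive_def
  proof (intro allI impI)
    fix a :: "nat \<Rightarrow> nat \<Rightarrow> 'a bop" assume a: "mat_positive k a"
    show "mat_positive k (\<lambda>i j. \<phi> (a i j))"
      unfolding mat_positive_def
    proof
      fix v :: "nat \<Rightarrow> 'a"
      define x where "x = (\<Sum>j<k. ket (v j) (e j))"
      obtain D where D: "trace_class D" "\<And>A. pairing (tilde \<phi> A) (x \<boxtimes> x) = pairing A D"
        using normal_map_predual[OF ket_exhaustion clinear_tilde[OF \<phi>] normal_map_tilde[OF \<phi>] trace_class_rank_one]
        by blast
      have "0 \<le> pairing (mat_op k a) D"
      proof (rule pairing_nonneg[OF ket_exhaustion D(1)])
        show "0 \<le> pairing (h \<boxtimes> h) D" for h
          using Q cinner_tilde_sum_ket[OF x_def, of h] by (simp flip: D(2) add: pairing_rank_one_right)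
        show "positive (mat_op k a)"
          using a by (simp add: positive_def mat_positive_def cinner_mat_op)
      qed
      also have "pairing (mat_op k a) D = cinner (tilde \<phi> (mat_op k a) \<cdot> x) x"
        by (simp only: D(2)[symmetric] pairing_rank_one_right)
      also have "tilde \<phi> (mat_op k a) = mat_op k (\<lambda>i j. \<phi> (a i j))"
        by (simp only: mat_op_def clinear_sum[OF clinear_tilde[OF \<phi>]] tilde_right_left_mult[OF \<phi>])
      also have "cinner (mat_op k (\<lambda>i j. \<phi> (a i j)) \<cdot> x) x =
          (\<Sum>i<k. cinner (mat_app k (\<lambda>i j. \<phi> (a i j)) v i) (v i))"
        by (simp add: cinner_mat_op mat_app_def x_def hs_op_sum_ket)
      finally show "0 \<le> (\<Sum>i<k. cinner (mat_app k (\<lambda>i j. \<phi> (a i j)) v i) (v i))" .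
    qed
  qed
qed

section \<open>Continuity of the form and the two criteria for k-positivity\<close>

lemma schur_form_tendsto_left:
  assumes "\<And>l. (\<lambda>n. h n l) \<longlonglongrightarrow> h' l"
  shows "(\<lambda>n. schur_form \<phi> k (h n) v) \<longlonglongrightarrow> schur_form \<phi> k h' v"
  unfolding schur_form_def
proof (intro tendsto_sum)
  fix l m
  obtain D where "\<And>h h'. cinner (\<phi> (h \<boxtimes> h') \<cdot> v m) (v l) = cinner (D \<cdot> h) h'"
    using CB_sigma_rank_one by blast
  then show "(\<lambda>n. cinner (\<phi> (h n l \<boxtimes> h n m) \<cdot> v m) (v l)) \<longlonglongrightarrow> cinner (\<phi> (h' l \<boxtimes> h' m) \<cdot> v m) (v l)"
    using assms by (auto intro!: tendsto_cinner tendsto_bop_app)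
qed

lemma schur_form_tendsto_right:
  assumes "\<And>l. (\<lambda>n. v n l) \<longlonglongrightarrow> v' l"
  shows "(\<lambda>n. schur_form \<phi> k h (v n)) \<longlonglongrightarrow> schur_form \<phi> k h v'"
  unfolding schur_form_def using assms by (intro tendsto_sum tendsto_cinner tendsto_bop_app)

lemma vector_functional_C_op:
  assumes "x = (\<Sum>l<k. ket (a l) (b l))"
  shows "vector_functional x x (C_op x0 \<phi>) = schur_form \<phi> k (\<lambda>l. hs_op x0 \<cdot> b l) a"
  unfolding vector_functional_def C_op_def by (rule cinner_tilde_sum_ket[OF assms])

lemma pairing_D_op:
  assumes "x = (\<Sum>l<k. ket (a l) (b l))"
  shows "pairing (x \<boxtimes> x) (D_op x0 \<phi>) = schur_form \<phi> k a (\<lambda>l. hs_op x0 \<cdot> b l)"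
  unfolding D_op_def pairing_predual_map[OF clinear_tilde[OF \<phi>] normal_map_tilde[OF \<phi>] trace_class_rank_one]
    pairing_rank_one_right
  by (rule cinner_tilde_sum_ket'[OF assms])

lemma k_positive_iff:
  assumes x0: "separating x0"
  shows k_positive_iff_C_op: "k_positive k \<phi> \<longleftrightarrow>
      (\<forall>x. op_rank (hs_op x) \<le> enat k \<longrightarrow> 0 \<le> vector_functional x x (C_op x0 \<phi>))"
    and k_positive_iff_D_op: "k_positive k \<phi> \<longleftrightarrow>
      (\<forall>x. op_rank (hs_op x) \<le> enat k \<longrightarrow> 0 \<le> pairing (x \<boxtimes> x) (D_op x0 \<phi>))"
proof -
  have "\<forall>y. \<exists>b :: nat \<Rightarrow> 'a. (\<lambda>n. hs_op x0 \<cdot> b n) \<longlonglongrightarrow> y"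
    using separating_dense_range[OF x0] by blast
  then obtain \<beta> :: "'a \<Rightarrow> nat \<Rightarrow> 'a" where \<beta>: "\<And>y. (\<lambda>n. hs_op x0 \<cdot> \<beta> y n) \<longlonglongrightarrow> y"
    by metis
  show "k_positive k \<phi> \<longleftrightarrow>
      (\<forall>x. op_rank (hs_op x) \<le> enat k \<longrightarrow> 0 \<le> vector_functional x x (C_op x0 \<phi>))"
  proof
    assume pos: "k_positive k \<phi>"
    show "\<forall>x. op_rank (hs_op x) \<le> enat k \<longrightarrow> 0 \<le> vector_functional x x (C_op x0 \<phi>)"
    proof (intro allI impI)
      fix x :: "'a hs" assume "op_rank (hs_op x) \<le> enat k"
      then obtain a b where x: "x = (\<Sum>l<k. ket (a l) (b l))" by (rule op_rank_le_imp_sum_ket)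
      show "0 \<le> vector_functional x x (C_op x0 \<phi>)"
        unfolding vector_functional_C_op[OF x] using pos by (simp only: k_positive_iff_schur_form)
    qed
  next
    assume *: "\<forall>x. op_rank (hs_op x) \<le> enat k \<longrightarrow> 0 \<le> vector_functional x x (C_op x0 \<phi>)"
    have "0 \<le> schur_form \<phi> k h v" for h v
    proof (rule complex_nonneg_LIMSEQ)
      show "(\<lambda>n. schur_form \<phi> k (\<lambda>l. hs_op x0 \<cdot> \<beta> (h l) n) v) \<longlonglongrightarrow> schur_form \<phi> k h v"
        by (rule schur_form_tendsto_left) (rule \<beta>)
      show "0 \<le> schur_form \<phi> k (\<lambda>l. hs_op x0 \<cdot> \<beta> (h l) n) v" for n
      proof -
        define x where "x = (\<Sum>l<k. ket (v l) (\<beta> (h l) n))"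
        have "op_rank (hs_op x) \<le> enat k" unfolding x_def by (rule op_rank_sum_ket_le)
        then have "0 \<le> vector_functional x x (C_op x0 \<phi>)" using * by blast
        then show ?thesis by (simp only: vector_functional_C_op[OF x_def])
      qed
    qed
    then show "k_positive k \<phi>" unfolding k_positive_iff_schur_form by blast
  qed
  show "k_positive k \<phi> \<longleftrightarrow>
      (\<forall>x. op_rank (hs_op x) \<le> enat k \<longrightarrow> 0 \<le> pairing (x \<boxtimes> x) (D_op x0 \<phi>))"
  proof
    assume pos: "k_positive k \<phi>"
    show "\<forall>x. op_rank (hs_op x) \<le> enat k \<longrightarrow> 0 \<le> pairing (x \<boxtimes> x) (D_op x0 \<phi>)"
    proof (intro allI impI)
      fix x :: "'a hs" assume "op_rank (hs_op x) \<le> enat k"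
      then obtain a b where x: "x = (\<Sum>l<k. ket (a l) (b l))" by (rule op_rank_le_imp_sum_ket)
      show "0 \<le> pairing (x \<boxtimes> x) (D_op x0 \<phi>)"
        unfolding pairing_D_op[OF x] using pos by (simp only: k_positive_iff_schur_form)
    qed
  next
    assume *: "\<forall>x. op_rank (hs_op x) \<le> enat k \<longrightarrow> 0 \<le> pairing (x \<boxtimes> x) (D_op x0 \<phi>)"
    \<comment> \<open>The slots are exchanged: \<open>h\<close> gives the left factors of
      \<open>x\<close> unchanged, and the images under \<open>hs_op x0\<close> approximate
      \<open>v\<close>.\<close>
    have "0 \<le> schur_form \<phi> k h v" for h v
    proof (rule complex_nonneg_LIMSEQ)
      show "(\<lambda>n. schur_form \<phi> k h (\<lambda>l. hs_op x0 \<cdot> \<beta> (v l) n)) \<longlonglongrightarrow> schur_form \<phi> k h v"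
        by (rule schur_form_tendsto_right) (rule \<beta>)
      show "0 \<le> schur_form \<phi> k h (\<lambda>l. hs_op x0 \<cdot> \<beta> (v l) n)" for n
      proof -
        define x where "x = (\<Sum>l<k. ket (h l) (\<beta> (v l) n))"
        have "op_rank (hs_op x) \<le> enat k" unfolding x_def by (rule op_rank_sum_ket_le)
        then have "0 \<le> pairing (x \<boxtimes> x) (D_op x0 \<phi>)" using * by blast
        then show ?thesis by (simp only: pairing_D_op[OF x_def])
      qed
    qed
    then show "k_positive k \<phi>" unfolding k_positive_iff_schur_form by blast
  qed
qed

end

end

theorem theorem5p1:
  fixes x\<^sub>0 :: "'k::chilbert_space hs" and \<phi> :: "'k bop \<Rightarrow> 'k bop" and k :: nat
  assumes "separable_space (euclidean :: 'k topology)"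
    and "\<And>B :: 'k set. finite B \<Longrightarrow> complex_vector.span B \<noteq> UNIV"
    and "norm x\<^sub>0 = 1" and "separating x\<^sub>0" and "cyclic x\<^sub>0"
    and "k \<ge> 1"
    and "\<phi> \<in> CB_sigma"
  shows "(k_positive k \<phi> \<longleftrightarrow>
            (\<forall>x :: 'k hs. op_rank (hs_op x) \<le> enat k \<longrightarrow> 0 \<le> vector_functional x x (C_op x\<^sub>0 \<phi>))) \<and>
         (k_positive k \<phi> \<longleftrightarrow>
            (\<forall>x :: 'k hs. op_rank (hs_op x) \<le> enat k \<longrightarrow> 0 \<le> pairing (x \<boxtimes> x) (D_op x\<^sub>0 \<phi>)))"
proof -
  obtain e :: "nat \<Rightarrow> 'k" where "inj e" "is_onb (range e)"
    using ex_onb_sequence[OF assms(1,2)] by blast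
  then have "onb_sequence e" by (rule onb_sequence.intro)
  then show ?thesis
    using assms(4,7) by (intro conjI onb_sequence.k_positive_iff_C_op onb_sequence.k_positive_iff_D_op)
qed

end
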